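(* Let $M$ be a standard $P_l(\mathcal{O}_K)$-module with standard generating sequence $\mathcal{F} = (\mathcal{F}_1,\ldots,\mathcal{F}_l)$ and let $B$ be a $\mathbb{Z}$-basis for $\mathcal{O}_K$. A generating set for $\ker(\rho)$ is $$\bigcup_{i=1}^l \{ \xi_{f,g} \mid f \in \mathcal{F}_i,\ g \in \mathcal{L}_i B \}.$$
   Context: Let $K$ be an algebraic number field with maximal order $\mathcal{O}_K$, let $l \in \mathbb{N}$ be positive, and let $P_l(\mathcal{O}_K) = \mathcal{O}_K[y]/(y^l)$. Modules are written with scalars on the right. A $P_l(\mathcal{O}_K)$-module $M$ is integral if $M \cong \mathbb{Z}^n$ as abelian group for some $n \in \mathbb{N}$. Define $K_i(M) = \{ m \in M \mid m y^i = 0\}$ for $0 \leq i \leq l+1$, $L_i(M) = K_{i+1}(M)y + K_{i-1}(M)$ and $Q_i(M) = K_i(M)/L_i(M)$ for $1 \leq i \leq l$. $M$ is standard if it is integral and $Q_i(M)$ is free as $\mathcal{O}_K$-module for $1 \leq i \leq l$. A standard generating sequence for a standard module $M$ is a sequence $\mathcal{F} = (\mathcal{F}_1,\ldots,\mathcal{F}_l)$, where $\mathcal{F}_j \subseteq K_j(M)$ is a set of preimages (one for each generator) of a free generating set of $Q_j(M)$ as $\mathcal{O}_K$-module under the natural epimorphism $K_j(M) \to Q_j(M)$. By abuse of notation, $h \in \mathcal{F}$ means $h \in \mathcal{F}_1 \cup \cdots \cup \mathcal{F}_l$. The map $\rho : \mathrm{Aut}_{P_l(\mathcal{O}_K)}(M)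 \to \mathrm{Aut}_{\mathcal{O}_K}(Q_1(M)) \times \cdots \times \mathrm{Aut}_{\mathcal{O}_K}(Q_l(M))$ is given by the natural action of automorphisms of $M$ on the quotients $Q_i(M)$. For $1 \le j \le l$ let $\mathcal{T}_j = \bigcup_{k=j+1}^l \mathcal{F}_k y^{k-j}$, $\mathcal{S}_j = \bigcup_{k=j}^l \mathcal{F}_k y^{k-j}$, $\mathcal{L}_j = \mathcal{S}_1 \cup \cdots \cup \mathcal{S}_{j-1} \cup \mathcal{T}_j$ (a subset of $L_j(M)$), and $\mathcal{L}_j B = \{ g b \mid g \in \mathcal{L}_j, b \in B\}$. For $f \in \mathcal{F}_i$ and $g \in L_i(M)$, $\xi_{f,g}$ is the (well-defined) element of $\ker(\rho)$ with $\xi_{f,g}(f) = f + g$ and $\xi_{f,g}(h) = h$ for all $h \in \mathcal{F}$ with $h \neq f$. *)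

theory Defs
  imports
    "HOL-Algebra.Bij"
    "HOL-Algebra.UnivPoly"
    "HOL-Algebra.QuotRing"
    "HOL-Algebra.IntRing"
    "HOL-Algebra.Embedded_Algebras"
    "HOL-Algebra.Generated_Fields"
    "HOL-Algebra.Product_Groups"
    "HOL-Algebra.Elementary_Groups"
    "Jordan_Normal_Form.Missing_VectorSpace"
begin

section \<open>Number fields and their maximal orders\<close>

text \<open>For a field of characteristic 0, \<open>generate_field K {\<one>}\<close> is the prime field, i.e. the copy
  of the rationals in \<open>K\<close>.\<close>

definition number_field :: "('k, 'x) ring_scheme \<Rightarrow> bool" where
  "number_field K \<longleftrightarrow> field K
     \<and> (\<forall>n::nat. n > 0 \<longrightarrow> [n] \<cdot>\<^bsub>K\<^esub> \<one>\<^bsub>K\<^esub> \<noteq> \<zero>\<^bsub>K\<^esub>)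
     \<and> ring.finite_dimension K (generate_field K {\<one>\<^bsub>K\<^esub>}) (carrier K)"

text \<open>An order is a subring that is finitely generated as an abelian group and spans the field over
  the rationals; it spans the field iff its finitely many generators do.\<close>

definition is_order :: "('k, 'x) ring_scheme \<Rightarrow> 'k set \<Rightarrow> bool" where
  "is_order K A \<longleftrightarrow> subring A K
     \<and> (\<exists>us. set us \<subseteq> carrier K
            \<and> A = generate (add_monoid K) (set us)
            \<and> ring.Span K (generate_field K {\<one>\<^bsub>K\<^esub>}) us = carrier K)"

definition maximal_order :: "('k, 'x) ring_scheme \<Rightarrow> 'k set \<Rightarrow> bool" where
  "maximal_order K A \<longleftrightarrow> is_order K A \<and> (\<forall>A'. is_order K A' \<and> A \<subseteq> A' \<longrightarrow> A' = A)"


section \<open>Modules\<close>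

text \<open>\<open>HOL.Modules\<close> has homonymous type-class based notions, hence the qualified names below. The
  locale \<open>module\<close> does not involve the fields \<open>mult\<close> and \<open>one\<close> of the module record; they are
  left \<open>undefined\<close>.\<close>

definition free_generating_set ::
    "('r, 'x) ring_scheme \<Rightarrow> ('r, 'm, 'z) module_scheme \<Rightarrow> 'm set \<Rightarrow> bool" where
  "free_generating_set R M S \<longleftrightarrow> S \<subseteq> carrier M
     \<and> LinearCombinations.module.span R M S = carrier M
     \<and> \<not> LinearCombinations.module.lin_dep R M S"

definition free_module :: "('r, 'x) ring_scheme \<Rightarrow> ('r, 'm, 'z) module_scheme \<Rightarrow> bool" where
  "free_module R M \<longleftrightarrow> (\<exists>S. free_generating_set R M S)"

definition int_module :: "('a, 'x) ring_scheme \<Rightarrow> (int, 'a) module" where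
  "int_module A = \<lparr>carrier = carrier A, monoid.mult = undefined, one = undefined,
     zero = \<zero>\<^bsub>A\<^esub>, add = add A, smult = (\<lambda>z a. [z] \<cdot>\<^bsub>A\<^esub> a)\<rparr>"

text \<open>The quotient \<open>N/U\<close> for submodules \<open>U \<subseteq> N\<close> of \<open>M\<close>.\<close>

definition quotient_module ::
    "('r, 'm, 'z) module_scheme \<Rightarrow> 'm set \<Rightarrow> 'm set \<Rightarrow> ('r, 'm set) module" where
  "quotient_module M N U = \<lparr>carrier = (\<lambda>m. U +>\<^bsub>M\<^esub> m) ` N, monoid.mult = undefined, one = undefined,
     zero = U, add = set_add M, smult = (\<lambda>c X. \<Union>x\<in>X. U +>\<^bsub>M\<^esub> (c \<odot>\<^bsub>M\<^esub> x))\<rparr>"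

definition module_Aut ::
    "('r, 'x) ring_scheme \<Rightarrow> ('r, 'm, 'z) module_scheme \<Rightarrow> ('m \<Rightarrow> 'm) monoid" where
  "module_Aut R M =
     BijGroup (carrier M) \<lparr>carrier := LinearCombinations.module_hom R M M \<inter> Bij (carrier M)\<rparr>"

definition integral_module :: "('r, 'm, 'z) module_scheme \<Rightarrow> bool" where
  "integral_module M \<longleftrightarrow> (\<exists>n::nat. add_monoid M \<cong> product_group {..<n} (\<lambda>_. integer_group))"


section \<open>The ring \<open>P\<^sub>l(R) = R[y]/(y\<^sup>l)\<close>\<close>

definition trunc_ideal :: "('k, 'x) ring_scheme \<Rightarrow> nat \<Rightarrow> (nat \<Rightarrow> 'k) set" where
  "trunc_ideal R l = PIdl\<^bsub>UP R\<^esub> (monom (UP R) \<one>\<^bsub>R\<^esub> l)"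

definition trunc_poly :: "('k, 'x) ring_scheme \<Rightarrow> nat \<Rightarrow> (nat \<Rightarrow> 'k) set ring" where
  "trunc_poly R l = UP R Quot trunc_ideal R l"

definition trunc_const :: "('k, 'x) ring_scheme \<Rightarrow> nat \<Rightarrow> 'k \<Rightarrow> (nat \<Rightarrow> 'k) set" where
  "trunc_const R l c = trunc_ideal R l +>\<^bsub>UP R\<^esub> monom (UP R) c 0"

definition trunc_var :: "('k, 'x) ring_scheme \<Rightarrow> nat \<Rightarrow> (nat \<Rightarrow> 'k) set" where
  "trunc_var R l = trunc_ideal R l +>\<^bsub>UP R\<^esub> monom (UP R) \<one>\<^bsub>R\<^esub> 1"


section \<open>Modules over \<open>P\<^sub>l(R)\<close>\<close>

text \<open>As \<open>P\<^sub>l(R)\<close> is commutative, right modules are rendered by the left modules of the library: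
  \<open>act_y R l M i m\<close> is \<open>m y\<^sup>i\<close>, and \<open>act_const R l M m c\<close> is \<open>m c\<close>.\<close>

definition act_y ::
    "('k, 'x) ring_scheme \<Rightarrow> nat \<Rightarrow> ((nat \<Rightarrow> 'k) set, 'm, 'z) module_scheme \<Rightarrow> nat \<Rightarrow> 'm \<Rightarrow> 'm"
  where
  "act_y R l M i m = (trunc_var R l [^]\<^bsub>trunc_poly R l\<^esub> i) \<odot>\<^bsub>M\<^esub> m"

definition act_const ::
    "('k, 'x) ring_scheme \<Rightarrow> nat \<Rightarrow> ((nat \<Rightarrow> 'k) set, 'm, 'z) module_scheme \<Rightarrow> 'm \<Rightarrow> 'k \<Rightarrow> 'm"
  where
  "act_const R l M m c = trunc_const R l c \<odot>\<^bsub>M\<^esub> m"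

definition restrict_scalars ::
    "('k, 'x) ring_scheme \<Rightarrow> nat \<Rightarrow> ((nat \<Rightarrow> 'k) set, 'm, 'z) module_scheme \<Rightarrow> ('k, 'm) module"
  where
  "restrict_scalars R l M = \<lparr>carrier = carrier M, monoid.mult = undefined, one = undefined,
     zero = \<zero>\<^bsub>M\<^esub>, add = add M, smult = (\<lambda>c m. act_const R l M m c)\<rparr>"

definition K_sub ::
    "('k, 'x) ring_scheme \<Rightarrow> nat \<Rightarrow> ((nat \<Rightarrow> 'k) set, 'm, 'z) module_scheme \<Rightarrow> nat \<Rightarrow> 'm set"
  where
  "K_sub R l M i = {m \<in> carrier M. act_y R l M i m = \<zero>\<^bsub>M\<^esub>}"

text \<open>Only meant for \<open>1 \<le> i \<le> l\<close>, as are the notions built on it.\<close>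

definition L_sub ::
    "('k, 'x) ring_scheme \<Rightarrow> nat \<Rightarrow> ((nat \<Rightarrow> 'k) set, 'm, 'z) module_scheme \<Rightarrow> nat \<Rightarrow> 'm set"
  where
  "L_sub R l M i = (act_y R l M 1 ` K_sub R l M (i + 1)) <+>\<^bsub>M\<^esub> K_sub R l M (i - 1)"

definition Q_mod ::
    "('k, 'x) ring_scheme \<Rightarrow> nat \<Rightarrow> ((nat \<Rightarrow> 'k) set, 'm, 'z) module_scheme \<Rightarrow> nat
      \<Rightarrow> ('k, 'm set) module"
  where
  "Q_mod R l M i = quotient_module (restrict_scalars R l M) (K_sub R l M i) (L_sub R l M i)"

definition standard_module ::
    "('k, 'x) ring_scheme \<Rightarrow> nat \<Rightarrow> ((nat \<Rightarrow> 'k) set, 'm, 'z) module_scheme \<Rightarrow> bool"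
  where
  "standard_module R l M \<longleftrightarrow> Module.module (trunc_poly R l) M \<and> integral_module M
     \<and> (\<forall>i\<in>{1..l}. free_module R (Q_mod R l M i))"

definition standard_generating_sequence ::
    "('k, 'x) ring_scheme \<Rightarrow> nat \<Rightarrow> ((nat \<Rightarrow> 'k) set, 'm, 'z) module_scheme
      \<Rightarrow> (nat \<Rightarrow> 'm set) \<Rightarrow> bool"
  where
  "standard_generating_sequence R l M F \<longleftrightarrow> (\<forall>j\<in>{1..l}.
     F j \<subseteq> K_sub R l M j
     \<and> inj_on (\<lambda>m. L_sub R l M j +>\<^bsub>M\<^esub> m) (F j)
     \<and> free_generating_set R (Q_mod R l M j) ((\<lambda>m. L_sub R l M j +>\<^bsub>M\<^esub> m) ` F j))"


section \<open>The action on the quotients and its kernel\<close>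

text \<open>An automorphism \<open>\<phi>\<close> sends the coset \<open>X = L\<^sub>i(M) + m\<close> to \<open>\<phi> ` X = L\<^sub>i(M) + \<phi> m\<close>.\<close>

definition rho ::
    "('k, 'x) ring_scheme \<Rightarrow> nat \<Rightarrow> ((nat \<Rightarrow> 'k) set, 'm, 'z) module_scheme
      \<Rightarrow> ('m \<Rightarrow> 'm) \<Rightarrow> nat \<Rightarrow> 'm set \<Rightarrow> 'm set"
  where
  "rho R l M = (\<lambda>\<phi>. \<lambda>i\<in>{1..l}. \<lambda>X\<in>carrier (Q_mod R l M i). \<phi> ` X)"

definition ker_rho ::
    "('k, 'x) ring_scheme \<Rightarrow> nat \<Rightarrow> ((nat \<Rightarrow> 'k) set, 'm, 'z) module_scheme \<Rightarrow> ('m \<Rightarrow> 'm) set"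
  where
  "ker_rho R l M = kernel (module_Aut (trunc_poly R l) M)
     (product_group {1..l} (\<lambda>i. module_Aut R (Q_mod R l M i))) (rho R l M)"

definition xi ::
    "('k, 'x) ring_scheme \<Rightarrow> nat \<Rightarrow> ((nat \<Rightarrow> 'k) set, 'm, 'z) module_scheme
      \<Rightarrow> (nat \<Rightarrow> 'm set) \<Rightarrow> 'm \<Rightarrow> 'm \<Rightarrow> 'm \<Rightarrow> 'm"
  where
  "xi R l M F f g = (THE \<phi>. \<phi> \<in> ker_rho R l M \<and> \<phi> f = f \<oplus>\<^bsub>M\<^esub> g
     \<and> (\<forall>h\<in>(\<Union>j\<in>{1..l}. F j). h \<noteq> f \<longrightarrow> \<phi> h = h))"


section \<open>The generators of \<open>L\<^sub>j(M)\<close>\<close>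

definition T_gen ::
    "('k, 'x) ring_scheme \<Rightarrow> nat \<Rightarrow> ((nat \<Rightarrow> 'k) set, 'm, 'z) module_scheme
      \<Rightarrow> (nat \<Rightarrow> 'm set) \<Rightarrow> nat \<Rightarrow> 'm set"
  where
  "T_gen R l M F j = (\<Union>k\<in>{j+1..l}. act_y R l M (k - j) ` F k)"

definition S_gen ::
    "('k, 'x) ring_scheme \<Rightarrow> nat \<Rightarrow> ((nat \<Rightarrow> 'k) set, 'm, 'z) module_scheme
      \<Rightarrow> (nat \<Rightarrow> 'm set) \<Rightarrow> nat \<Rightarrow> 'm set"
  where
  "S_gen R l M F j = (\<Union>k\<in>{j..l}. act_y R l M (k - j) ` F k)"

definition L_gen ::
    "('k, 'x) ring_scheme \<Rightarrow> nat \<Rightarrow> ((nat \<Rightarrow> 'k) set, 'm, 'z) module_scheme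
      \<Rightarrow> (nat \<Rightarrow> 'm set) \<Rightarrow> nat \<Rightarrow> 'm set"
  where
  "L_gen R l M F j = (\<Union>i\<in>{1..<j}. S_gen R l M F i) \<union> T_gen R l M F j"

definition L_gen_times ::
    "('k, 'x) ring_scheme \<Rightarrow> nat \<Rightarrow> ((nat \<Rightarrow> 'k) set, 'm, 'z) module_scheme
      \<Rightarrow> (nat \<Rightarrow> 'm set) \<Rightarrow> nat \<Rightarrow> 'k set \<Rightarrow> 'm set"
  where
  "L_gen_times R l M F j B = {act_const R l M g b | g b. g \<in> L_gen R l M F j \<and> b \<in> B}"

end

theory Submission
  imports Defs
begin

text \<open>
  The proof replaces the chain of quotients \<open>Q\<^sub>i(M)\<close> by one filtration of \<open>M\<close>, for which the
  elements of \<open>ker \<rho>\<close> are exactly the maps that induce the identity on the associated graded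
  module.  A module over \<open>P\<^sub>l(R)\<close> is an \<open>R\<close>-module with a nilpotent endomorphism \<open>Y\<close>, and
  \<open>K\<^sub>i\<close> and \<open>L\<^sub>i\<close> only depend on \<open>Y\<close>.

  \<^emph>\<open>The module is free.\<close>  The elements \<open>f y\<^sup>t\<close> with \<open>f \<in> \<F>\<^sub>k\<close> and \<open>t < k\<close> form a finite
  \<open>R\<close>-basis of \<open>M\<close>.  They span because \<open>K\<^sub>i\<close> is spanned modulo \<open>K\<^bsub>i-1\<^esub>\<close> by those among them
  with \<open>k - t = i\<close> (\<open>Ker_modulo_lower\<close>).  In a linear relation, the terms with the largest
  \<open>k - t\<close> and, among them, the smallest \<open>t\<close> would give a relation between generators of
  \<open>Q\<^sub>k\<close> (\<open>elt_indep_nonzero\<close>).  The basis is finite because \<open>M\<close> is a finitely generated abelian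
  group.  Hence an endomorphism of \<open>M\<close> is the same as a choice of an image in \<open>K\<^sub>k\<close> for every
  \<open>f \<in> \<F>\<^sub>k\<close> (\<open>EndY_extension\<close>, \<open>EndY_eqI\<close>); in particular the maps \<open>\<xi>\<^bsub>f,g\<^esub>\<close> exist and are
  unique.

  \<^emph>\<open>The weight filtration.\<close>  Give \<open>f y\<^sup>t\<close>, \<open>f \<in> \<F>\<^sub>k\<close>, the weight \<open>2t - k\<close>, and let \<open>W d\<close> be
  spanned by the basis elements of weight at least \<open>d\<close>.  Then \<open>y\<close> raises weights by 2, and an
  endomorphism \<open>T\<close> maps every \<open>K\<^sub>i\<close> into \<open>L\<^sub>i\<close> if and only if it raises all weights by at least 1
  (\<open>Shift_Lay\<close>, \<open>Lay_Shift\<close>).  So \<open>ker \<rho>\<close> consists of the maps \<open>1 + T\<close> with \<open>T\<close> in the set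
  \<open>Shift 1\<close> (\<open>ker_rho_eq\<close>), where \<open>Shift n\<close> denotes the endomorphisms that raise weights by at
  least \<open>n\<close>.  These sets satisfy \<open>Shift m \<circ> Shift n \<subseteq> Shift (m + n)\<close>, and \<open>Shift (2l)\<close> is zero;
  this also makes every \<open>1 + T\<close> bijective (\<open>uni_inverse\<close>).

  \<^emph>\<open>Generation.\<close>  Since \<open>(1 + S) (1 + T) = 1 + (S + T) + S T\<close>, composition of maps in
  \<open>1 + Shift n\<close> is addition modulo \<open>Shift (n + 1)\<close>.  Every element of \<open>Shift n\<close> is a finite sum of
  elements of \<open>Shift n\<close> that map one generator \<open>f\<close> to \<open>\<plusminus> b h\<close>, with \<open>b \<in> B\<close> and \<open>h\<close> a basis
  element, and all other generators to 0.  For \<open>n \<ge> 1\<close> and \<open>f \<in> \<F>\<^sub>i\<close> the basis elements \<open>h\<close> that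
  occur are in \<open>\<L>\<^sub>i\<close> (\<open>L_gen_iff\<close>), so every \<open>1 + T\<close> with \<open>T \<in> Shift n\<close> agrees modulo
  \<open>Shift (n + 1)\<close> with a product of the given generators and their inverses (\<open>Lead_all\<close>).
  Descending induction on \<open>n\<close> finishes the proof (\<open>Shift_generated\<close>).
\<close>

section \<open>Linear maps prescribed on a finite basis\<close>

context Module.module
begin

lemma add_minus_cancel:
  assumes "x \<in> carrier M" "y \<in> carrier M"
  shows "x \<oplus>\<^bsub>M\<^esub> (y \<oplus>\<^bsub>M\<^esub> \<ominus>\<^bsub>M\<^esub> x) = y"
    and "z \<in> carrier M \<Longrightarrow> x \<oplus>\<^bsub>M\<^esub> (y \<oplus>\<^bsub>M\<^esub> (z \<oplus>\<^bsub>M\<^esub> \<ominus>\<^bsub>M\<^esub> x)) = y \<oplus>\<^bsub>M\<^esub> z"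
  using assms by (simp_all add: M.a_lcomm[of x] M.r_neg)

lemma submodule_uminus:
  assumes "LinearCombinations.submodule R U M" and "x \<in> U"
  shows "\<ominus>\<^bsub>M\<^esub> x \<in> U"
proof -
  have "x \<in> carrier M"
    using assms LinearCombinations.submodule.subset by blast
  then have "\<ominus>\<^bsub>M\<^esub> x = (\<ominus> \<one>) \<odot>\<^bsub>M\<^esub> x"
    by (simp add: smult_l_minus)
  then show ?thesis
    using assms LinearCombinations.submodule.smult_closed by fastforce
qed

lemma submodule_minus:
  assumes "LinearCombinations.submodule R U M" and "x \<in> U" and "y \<in> U"
  shows "x \<ominus>\<^bsub>M\<^esub> y \<in> U"
  using assms submodule_uminus LinearCombinations.submodule.m_closed
  unfolding a_minus_def by metis

lemma submodule_finsum:
  assumes U: "LinearCombinations.submodule R U M" and f: "f \<in> A \<rightarrow> U"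
  shows "(\<Oplus>\<^bsub>M\<^esub>i\<in>A. f i) \<in> U"
proof -
  have sub: "U \<subseteq> carrier M"
    using U LinearCombinations.submodule.subset by blast
  show ?thesis
    using f
  proof (induction A rule: infinite_finite_induct)
    case (insert a A)
    then have "(\<Oplus>\<^bsub>M\<^esub>i\<in>insert a A. f i) = f a \<oplus>\<^bsub>M\<^esub> (\<Oplus>\<^bsub>M\<^esub>i\<in>A. f i)"
      using sub by (intro finsum_insert) auto
    then show ?case
      using insert U LinearCombinations.submodule.m_closed by fastforce
  qed (use U LinearCombinations.submodule.zero_closed in auto)
qed

lemma span_induct [consumes 2, case_names base zero add smult]:
  assumes m: "m \<in> span X" and X: "X \<subseteq> carrier M"
    and base: "\<And>x. x \<in> X \<Longrightarrow> Q x"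
    and zero: "Q \<zero>\<^bsub>M\<^esub>"
    and add: "\<And>x y. x \<in> carrier M \<Longrightarrow> y \<in> carrier M \<Longrightarrow> Q x \<Longrightarrow> Q y \<Longrightarrow> Q (x \<oplus>\<^bsub>M\<^esub> y)"
    and smult: "\<And>r x. r \<in> carrier R \<Longrightarrow> x \<in> carrier M \<Longrightarrow> Q x \<Longrightarrow> Q (r \<odot>\<^bsub>M\<^esub> x)"
  shows "Q m"
proof -
  have "LinearCombinations.submodule R {x \<in> carrier M. Q x} M"
    using zero add smult by unfold_locales auto
  then have "span X \<subseteq> {x \<in> carrier M. Q x}"
    using X base by (intro span_is_subset) auto
  with m show ?thesis by auto
qed

abbreviation End :: "('c \<Rightarrow> 'c) set"
  where "End \<equiv> LinearCombinations.module_hom R M M"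

lemma End_closed [simp]: "T \<in> End \<Longrightarrow> x \<in> carrier M \<Longrightarrow> T x \<in> carrier M"
  unfolding LinearCombinations.module_hom_def by auto

lemma End_add: "T \<in> End \<Longrightarrow> x \<in> carrier M \<Longrightarrow> y \<in> carrier M \<Longrightarrow> T (x \<oplus>\<^bsub>M\<^esub> y) = T x \<oplus>\<^bsub>M\<^esub> T y"
  unfolding LinearCombinations.module_hom_def by auto

lemma End_smult: "T \<in> End \<Longrightarrow> r \<in> carrier R \<Longrightarrow> x \<in> carrier M \<Longrightarrow> T (r \<odot>\<^bsub>M\<^esub> x) = r \<odot>\<^bsub>M\<^esub> T x"
  unfolding LinearCombinations.module_hom_def by auto

lemma End_zero [simp]:
  assumes "T \<in> End"
  shows "T \<zero>\<^bsub>M\<^esub> = \<zero>\<^bsub>M\<^esub>"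
  using End_smult[OF assms, of \<zero> "\<zero>\<^bsub>M\<^esub>"] assms by simp

lemma End_uminus:
  assumes "T \<in> End" "x \<in> carrier M"
  shows "T (\<ominus>\<^bsub>M\<^esub> x) = \<ominus>\<^bsub>M\<^esub> T x"
  using End_smult[OF assms(1), of "\<ominus> \<one>" x] assms by (simp add: smult_l_minus)

lemma End_finsum:
  assumes T: "T \<in> End" and f: "f \<in> A \<rightarrow> carrier M"
  shows "T (\<Oplus>\<^bsub>M\<^esub>i\<in>A. f i) = (\<Oplus>\<^bsub>M\<^esub>i\<in>A. T (f i))"
  using f
proof (induction A rule: infinite_finite_induct)
  case (insert a A)
  then have "f \<in> A \<rightarrow> carrier M" "f a \<in> carrier M" by auto
  with insert T show ?case
    by (simp add: End_add Pi_def)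
qed (use T in simp_all)

lemma EndI:
  assumes "\<And>x. x \<in> carrier M \<Longrightarrow> T x \<in> carrier M"
    and "\<And>x y. x \<in> carrier M \<Longrightarrow> y \<in> carrier M \<Longrightarrow> T (x \<oplus>\<^bsub>M\<^esub> y) = T x \<oplus>\<^bsub>M\<^esub> T y"
    and "\<And>r x. r \<in> carrier R \<Longrightarrow> x \<in> carrier M \<Longrightarrow> T (r \<odot>\<^bsub>M\<^esub> x) = r \<odot>\<^bsub>M\<^esub> T x"
  shows "T \<in> End"
  using assms unfolding LinearCombinations.module_hom_def by auto

lemma End_span:
  assumes T: "T \<in> End" and X: "X \<subseteq> carrier M" and U: "LinearCombinations.submodule R U M"
    and base: "\<And>x. x \<in> X \<Longrightarrow> T x \<in> U" and m: "m \<in> span X"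
  shows "T m \<in> U"
  using m X
proof (induction rule: span_induct)
  case zero
  show ?case using LinearCombinations.submodule.zero_closed[OF U] T by simp
next
  case (add x y)
  then show ?case using LinearCombinations.submodule.m_closed[OF U] T by (simp add: End_add)
next
  case (smult r x)
  then show ?case using LinearCombinations.submodule.smult_closed[OF U] T by (simp add: End_smult)
qed (rule base)

lemma span_mono_submodule:
  assumes "X \<subseteq> U" "LinearCombinations.submodule R U M" "m \<in> span X"
  shows "m \<in> U"
  using span_is_subset[OF assms(1,2)] assms(3) by blast

end

text \<open>The basis is a family rather than a set: its members will be indexed by triples, and that
  distinct triples give distinct elements is then a consequence of independence.\<close>

locale finite_basis = Module.module R M
  for R :: "('r, 'x) ring_scheme" (structure) and M :: "('r, 'm, 'z) module_scheme" +
  fixes I :: "'i set" and e :: "'i \<Rightarrow> 'm"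
  assumes finite_index [simp]: "finite I"
    and e_closed [simp]: "p \<in> I \<Longrightarrow> e p \<in> carrier M"
    and e_indep: "\<lbrakk>a \<in> I \<rightarrow> carrier R; (\<Oplus>\<^bsub>M\<^esub>p\<in>I. a p \<odot>\<^bsub>M\<^esub> e p) = \<zero>\<^bsub>M\<^esub>; p \<in> I\<rbrakk> \<Longrightarrow> a p = \<zero>"
    and e_span: "span (e ` I) = carrier M"
begin

definition comb :: "('i \<Rightarrow> 'r) \<Rightarrow> 'm"
  where "comb a = (\<Oplus>\<^bsub>M\<^esub>p\<in>I. a p \<odot>\<^bsub>M\<^esub> e p)"

lemma comb_closed [simp]: "a \<in> I \<rightarrow> carrier R \<Longrightarrow> comb a \<in> carrier M"
  unfolding comb_def by (intro finsum_closed) auto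

lemma comb_add:
  assumes "a \<in> I \<rightarrow> carrier R" "b \<in> I \<rightarrow> carrier R"
  shows "comb (\<lambda>p. a p \<oplus> b p) = comb a \<oplus>\<^bsub>M\<^esub> comb b"
proof -
  have "comb (\<lambda>p. a p \<oplus> b p) = (\<Oplus>\<^bsub>M\<^esub>p\<in>I. a p \<odot>\<^bsub>M\<^esub> e p \<oplus>\<^bsub>M\<^esub> b p \<odot>\<^bsub>M\<^esub> e p)"
    unfolding comb_def using assms by (intro finsum_cong') (auto simp: smult_l_distr Pi_def)
  also have "\<dots> = comb a \<oplus>\<^bsub>M\<^esub> comb b"
    unfolding comb_def using assms by (intro finsum_addf) (auto simp: Pi_def)
  finally show ?thesis .
qed

lemma comb_smult:
  assumes "a \<in> I \<rightarrow> carrier R" "r \<in> carrier R"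
  shows "comb (\<lambda>p. r \<otimes> a p) = r \<odot>\<^bsub>M\<^esub> comb a"
proof -
  have "comb (\<lambda>p. r \<otimes> a p) = (\<Oplus>\<^bsub>M\<^esub>p\<in>I. r \<odot>\<^bsub>M\<^esub> (a p \<odot>\<^bsub>M\<^esub> e p))"
    unfolding comb_def using assms by (intro finsum_cong') (auto simp: smult_assoc1 Pi_def)
  also have "\<dots> = r \<odot>\<^bsub>M\<^esub> comb a"
    unfolding comb_def using assms by (subst finsum_smult_ldistr) (auto simp: Pi_def)
  finally show ?thesis .
qed

lemma comb_inj:
  assumes a: "a \<in> I \<rightarrow> carrier R" and b: "b \<in> I \<rightarrow> carrier R" and eq: "comb a = comb b" and p: "p \<in> I"
  shows "a p = b p"
proof -
  have nb: "(\<lambda>p. \<ominus> \<one> \<otimes> b p) \<in> I \<rightarrow> carrier R" using b by auto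
  have "comb (\<lambda>p. a p \<oplus> \<ominus> \<one> \<otimes> b p) = comb a \<oplus>\<^bsub>M\<^esub> (\<ominus> \<one>) \<odot>\<^bsub>M\<^esub> comb b"
    using comb_add[OF a nb] comb_smult[OF b] by simp
  also have "\<dots> = \<zero>\<^bsub>M\<^esub>"
    using eq b by (simp add: smult_l_minus M.r_neg)
  finally have "a p \<oplus> \<ominus> \<one> \<otimes> b p = \<zero>"
    using a b p unfolding comb_def by (intro e_indep[of "\<lambda>p. a p \<oplus> \<ominus> \<one> \<otimes> b p"]) auto
  moreover have "a p \<in> carrier R" "b p \<in> carrier R" using a b p by auto
  ultimately show ?thesis
    using R.r_right_minus_eq[of "a p" "b p"] by (simp add: R.l_minus a_minus_def)
qed

lemma comb_unit:
  assumes "p \<in> I"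
  shows "comb (\<lambda>q. if q = p then \<one> else \<zero>) = e p"
proof -
  have "comb (\<lambda>q. if q = p then \<one> else \<zero>) = (\<Oplus>\<^bsub>M\<^esub>q\<in>I. if p = q then e q else \<zero>\<^bsub>M\<^esub>)"
    unfolding comb_def using assms by (intro finsum_cong') auto
  also have "\<dots> = e p"
    using assms by (intro finsum_singleton) auto
  finally show ?thesis .
qed

text \<open>The coefficients produced are supported on \<open>C\<close>, so that uniqueness of coefficients turns
  the intersection of two spans into the span of the intersection of the index sets.\<close>

lemma span_comb:
  assumes "C \<subseteq> I" "m \<in> span (e ` C)"
  shows "\<exists>a\<in>I \<rightarrow> carrier R. comb a = m \<and> (\<forall>p\<in>I - C. a p = \<zero>)"
proof -
  have "e ` C \<subseteq> carrier M" using assms(1) by auto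
  with assms(2) show ?thesis
  proof (induction rule: span_induct)
    case (base x)
    then obtain p where p: "p \<in> C" "x = e p" by auto
    then show ?case
      using assms(1) comb_unit[of p] by (intro bexI[of _ "\<lambda>q. if q = p then \<one> else \<zero>"]) auto
  next
    case zero
    show ?case
      by (intro bexI[of _ "\<lambda>q. \<zero>"]) (auto simp: comb_def intro!: finsum_all0)
  next
    case (add x y)
    obtain a where a: "a \<in> I \<rightarrow> carrier R" "comb a = x" "\<forall>p\<in>I - C. a p = \<zero>"
      using add(3) by (elim bexE conjE)
    obtain b where b: "b \<in> I \<rightarrow> carrier R" "comb b = y" "\<forall>p\<in>I - C. b p = \<zero>"
      using add(4) by (elim bexE conjE)
    show ?case
    proof (intro bexI conjI ballI)
      show "comb (\<lambda>q. a q \<oplus> b q) = x \<oplus>\<^bsub>M\<^esub> y"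
        using a b by (simp add: comb_add)
      show "(\<lambda>q. a q \<oplus> b q) \<in> I \<rightarrow> carrier R"
        using a(1) b(1) by (auto simp: Pi_def)
    qed (use a(3) b(3) in simp)
  next
    case (smult r x)
    obtain a where a: "a \<in> I \<rightarrow> carrier R" "comb a = x" "\<forall>p\<in>I - C. a p = \<zero>"
      using smult(3) by (elim bexE conjE)
    show ?case
    proof (intro bexI conjI ballI)
      show "comb (\<lambda>q. r \<otimes> a q) = r \<odot>\<^bsub>M\<^esub> x"
        using a smult by (simp add: comb_smult)
      show "(\<lambda>q. r \<otimes> a q) \<in> I \<rightarrow> carrier R"
        using a(1) smult by (auto simp: Pi_def)
    qed (use a(3) smult in simp)
  qed
qed

lemma comb_in_span:
  assumes "C \<subseteq> I" "a \<in> I \<rightarrow> carrier R" "\<And>p. p \<in> I - C \<Longrightarrow> a p = \<zero>"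
  shows "comb a \<in> span (e ` C)"
proof -
  have C: "e ` C \<subseteq> carrier M" using assms(1) by auto
  have U: "LinearCombinations.submodule R (span (e ` C)) M"
    using C by (rule span_is_submodule)
  show ?thesis
    unfolding comb_def
  proof (rule submodule_finsum[OF U], rule)
    fix p assume p: "p \<in> I"
    show "a p \<odot>\<^bsub>M\<^esub> e p \<in> span (e ` C)"
    proof (cases "p \<in> C")
      case True
      then have "e p \<in> span (e ` C)" using in_own_span[OF C] by auto
      then show ?thesis
        using LinearCombinations.submodule.smult_closed[OF U] assms(2) p by auto
    next
      case False
      then show ?thesis
        using assms(3)[of p] p LinearCombinations.submodule.zero_closed[OF U] by auto
    qed
  qed
qed

lemma span_Int:
  assumes "C \<subseteq> I" "D \<subseteq> I" "m \<in> span (e ` C)" "m \<in> span (e ` D)"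
  shows "m \<in> span (e ` (C \<inter> D))"
proof -
  obtain a b where a: "a \<in> I \<rightarrow> carrier R" "comb a = m" "\<forall>p\<in>I - C. a p = \<zero>"
    and b: "b \<in> I \<rightarrow> carrier R" "comb b = m" "\<forall>p\<in>I - D. b p = \<zero>"
    using span_comb[OF assms(1,3)] span_comb[OF assms(2,4)] by blast
  have "a p = \<zero>" if "p \<in> I - (C \<inter> D)" for p
    using that a b comb_inj[OF a(1) b(1), of p] by auto
  then show ?thesis
    using comb_in_span[of "C \<inter> D" a] a assms(1) by auto
qed

definition coord :: "'m \<Rightarrow> 'i \<Rightarrow> 'r"
  where "coord m = (SOME a. a \<in> I \<rightarrow> carrier R \<and> comb a = m)"

lemma coord:
  assumes "m \<in> carrier M"
  shows "coord m \<in> I \<rightarrow> carrier R" "comb (coord m) = m"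
proof -
  have "\<exists>a. a \<in> I \<rightarrow> carrier R \<and> comb a = m"
    using span_comb[of I m] e_span assms by auto
  from someI_ex[OF this] show "coord m \<in> I \<rightarrow> carrier R" "comb (coord m) = m"
    unfolding coord_def by auto
qed

lemma coord_comb:
  assumes "a \<in> I \<rightarrow> carrier R" "p \<in> I"
  shows "coord (comb a) p = a p"
  using coord[of "comb a"] assms comb_inj by auto

lemma linear_extension:
  assumes v: "v \<in> I \<rightarrow> carrier M"
  shows "\<exists>T\<in>LinearCombinations.module_hom R M M. \<forall>p\<in>I. T (e p) = v p"
proof -
  define T where "T m = (\<Oplus>\<^bsub>M\<^esub>p\<in>I. coord m p \<odot>\<^bsub>M\<^esub> v p)" for m
  have T_comb: "T (comb a) = (\<Oplus>\<^bsub>M\<^esub>p\<in>I. a p \<odot>\<^bsub>M\<^esub> v p)" if "a \<in> I \<rightarrow> carrier R" for a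
    unfolding T_def using that v by (intro finsum_cong') (auto simp: coord_comb Pi_def)
  have closed: "T m \<in> carrier M" if "m \<in> carrier M" for m
    unfolding T_def using coord(1)[OF that] v by (intro finsum_closed) auto
  have add: "T (m \<oplus>\<^bsub>M\<^esub> n) = T m \<oplus>\<^bsub>M\<^esub> T n" if "m \<in> carrier M" "n \<in> carrier M" for m n
  proof -
    note c = coord(1)[OF that(1)] coord(1)[OF that(2)]
    have "T (m \<oplus>\<^bsub>M\<^esub> n) = T (comb (\<lambda>p. coord m p \<oplus> coord n p))"
      using that by (simp add: comb_add[OF c] coord(2))
    also have "\<dots> = (\<Oplus>\<^bsub>M\<^esub>p\<in>I. (coord m p \<oplus> coord n p) \<odot>\<^bsub>M\<^esub> v p)"
      using c by (intro T_comb) auto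
    also have "\<dots> = (\<Oplus>\<^bsub>M\<^esub>p\<in>I. coord m p \<odot>\<^bsub>M\<^esub> v p \<oplus>\<^bsub>M\<^esub> coord n p \<odot>\<^bsub>M\<^esub> v p)"
      using c v by (intro finsum_cong') (auto simp: smult_l_distr Pi_def)
    also have "\<dots> = T m \<oplus>\<^bsub>M\<^esub> T n"
      unfolding T_def using c v by (intro finsum_addf) (auto simp: Pi_def)
    finally show ?thesis .
  qed
  have smult: "T (r \<odot>\<^bsub>M\<^esub> m) = r \<odot>\<^bsub>M\<^esub> T m" if "r \<in> carrier R" "m \<in> carrier M" for r m
  proof -
    note c = coord(1)[OF that(2)]
    have "T (r \<odot>\<^bsub>M\<^esub> m) = T (comb (\<lambda>p. r \<otimes> coord m p))"
      using that by (simp add: comb_smult[OF c] coord(2))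
    also have "\<dots> = (\<Oplus>\<^bsub>M\<^esub>p\<in>I. (r \<otimes> coord m p) \<odot>\<^bsub>M\<^esub> v p)"
      using c that by (intro T_comb) auto
    also have "\<dots> = (\<Oplus>\<^bsub>M\<^esub>p\<in>I. r \<odot>\<^bsub>M\<^esub> (coord m p \<odot>\<^bsub>M\<^esub> v p))"
      using c v that by (intro finsum_cong') (auto simp: smult_assoc1 Pi_def)
    also have "\<dots> = r \<odot>\<^bsub>M\<^esub> T m"
      unfolding T_def using c v that by (subst finsum_smult_ldistr) (auto simp: Pi_def)
    finally show ?thesis .
  qed
  have "T (e p) = v p" if "p \<in> I" for p
  proof -
    have "T (e p) = T (comb (\<lambda>q. if q = p then \<one> else \<zero>))"
      using comb_unit that by simp
    also have "\<dots> = (\<Oplus>\<^bsub>M\<^esub>q\<in>I. (if q = p then \<one> else \<zero>) \<odot>\<^bsub>M\<^esub> v q)"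
      by (intro T_comb) auto
    also have "\<dots> = (\<Oplus>\<^bsub>M\<^esub>q\<in>I. if p = q then v q else \<zero>\<^bsub>M\<^esub>)"
      using v by (intro finsum_cong') (auto simp: Pi_def)
    also have "\<dots> = v p"
      using that v by (intro finsum_singleton) auto
    finally show ?thesis .
  qed
  then show ?thesis
    using closed add smult unfolding LinearCombinations.module_hom_def by (intro bexI[of _ T]) auto
qed

end

section \<open>Modules with a nilpotent endomorphism\<close>

text \<open>This is what a module over \<open>R[y]/(y\<^sup>l)\<close> amounts to, with \<open>Y\<close> the multiplication by \<open>y\<close>.  The
  sets \<open>Ker i\<close> and \<open>Lay i\<close> defined below are \<open>K\<^sub>i(M)\<close> and \<open>L\<^sub>i(M)\<close>.\<close>

locale nilpotent_module = Module.module R M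
  for R :: "('r, 'x) ring_scheme" (structure) and M :: "('r, 'm, 'z) module_scheme" +
  fixes Y :: "'m \<Rightarrow> 'm" and l :: nat
  assumes Y_End: "Y \<in> End"
    and Y_nilpotent: "m \<in> carrier M \<Longrightarrow> (Y ^^ l) m = \<zero>\<^bsub>M\<^esub>"
begin

definition Ker :: "nat \<Rightarrow> 'm set"
  where "Ker i = {m \<in> carrier M. (Y ^^ i) m = \<zero>\<^bsub>M\<^esub>}"

definition Lay :: "nat \<Rightarrow> 'm set"
  where "Lay i = {Y a \<oplus>\<^bsub>M\<^esub> b | a b. a \<in> Ker (i + 1) \<and> b \<in> Ker (i - 1)}"

lemma Y_pow_End: "Y ^^ s \<in> End"
proof (induction s)
  case 0
  show ?case by (rule EndI) auto
next
  case (Suc s)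
  then show ?case
    using Y_End by (intro EndI) (auto simp: End_add End_smult)
qed

lemmas Y_closed [simp] = End_closed[OF Y_End]
lemmas Y_pow_closed [simp] = End_closed[OF Y_pow_End]
lemmas Y_add = End_add[OF Y_End]
lemmas Y_pow_add = End_add[OF Y_pow_End]

lemma Y_pow_pow: "(Y ^^ s) ((Y ^^ t) m) = (Y ^^ (s + t)) m"
  by (simp add: funpow_add)

lemma Y_pow_ge:
  assumes "(Y ^^ s) m = \<zero>\<^bsub>M\<^esub>" "s \<le> t"
  shows "(Y ^^ t) m = \<zero>\<^bsub>M\<^esub>"
proof -
  have "(Y ^^ t) m = (Y ^^ (t - s)) ((Y ^^ s) m)"
    using assms(2) by (simp add: Y_pow_pow)
  then show ?thesis
    using assms(1) Y_pow_End by simp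
qed

lemma Ker_closed: "m \<in> Ker i \<Longrightarrow> m \<in> carrier M"
  unfolding Ker_def by simp

lemma Ker_submodule: "LinearCombinations.submodule R (Ker i) M"
proof unfold_locales
  show "Ker i \<subseteq> carrier M" "\<zero>\<^bsub>M\<^esub> \<in> Ker i"
    using Y_pow_End by (auto simp: Ker_def)
  show "v \<oplus>\<^bsub>M\<^esub> w \<in> Ker i" if "v \<in> Ker i" "w \<in> Ker i" for v w
    using that by (simp add: Ker_def Y_pow_add)
  show "c \<odot>\<^bsub>M\<^esub> v \<in> Ker i" if "c \<in> carrier R" "v \<in> Ker i" for c v
    using that by (simp add: Ker_def End_smult[OF Y_pow_End])
qed

lemma Ker_mono: "i \<le> j \<Longrightarrow> m \<in> Ker i \<Longrightarrow> m \<in> Ker j"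
  using Y_pow_ge unfolding Ker_def by blast

lemma Ker_top: "l \<le> i \<Longrightarrow> Ker i = carrier M"
  using Y_pow_ge[OF Y_nilpotent] unfolding Ker_def by blast

lemma Ker_0: "Ker 0 = {\<zero>\<^bsub>M\<^esub>}"
  unfolding Ker_def by auto

lemma Y_pow_Ker_iff: "m \<in> carrier M \<Longrightarrow> (Y ^^ s) m \<in> Ker i \<longleftrightarrow> m \<in> Ker (i + s)"
  unfolding Ker_def by (simp add: Y_pow_pow)

lemma Y_Ker: "m \<in> Ker i \<Longrightarrow> Y m \<in> Ker (i - 1)"
  using Y_pow_Ker_iff[of m 1 "i - 1"] Ker_mono[of i "i - 1 + 1" m] Ker_closed[of m i] by simp

lemma Lay_submodule: "LinearCombinations.submodule R (Lay i) M"
proof unfold_locales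
  show "Lay i \<subseteq> carrier M"
    by (auto simp: Lay_def Ker_closed)
  have "\<zero>\<^bsub>M\<^esub> = Y \<zero>\<^bsub>M\<^esub> \<oplus>\<^bsub>M\<^esub> \<zero>\<^bsub>M\<^esub>"
    using Y_End by simp
  then show "\<zero>\<^bsub>M\<^esub> \<in> Lay i"
    unfolding Lay_def using LinearCombinations.submodule.zero_closed[OF Ker_submodule] by blast
  show "v \<oplus>\<^bsub>M\<^esub> w \<in> Lay i" if vw: "v \<in> Lay i" "w \<in> Lay i" for v w
  proof -
    obtain a b where v: "v = Y a \<oplus>\<^bsub>M\<^esub> b" "a \<in> Ker (i + 1)" "b \<in> Ker (i - 1)"
      using vw(1) by (auto simp: Lay_def)
    obtain a' b' where w: "w = Y a' \<oplus>\<^bsub>M\<^esub> b'" "a' \<in> Ker (i + 1)" "b' \<in> Ker (i - 1)"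
      using vw(2) by (auto simp: Lay_def)
    note c = v(2,3)[THEN Ker_closed] w(2,3)[THEN Ker_closed]
    have "v \<oplus>\<^bsub>M\<^esub> w = Y (a \<oplus>\<^bsub>M\<^esub> a') \<oplus>\<^bsub>M\<^esub> (b \<oplus>\<^bsub>M\<^esub> b')"
      using c by (simp add: v(1) w(1) Y_add M.a_ac)
    then show ?thesis
      unfolding Lay_def using v w LinearCombinations.submodule.m_closed[OF Ker_submodule] by blast
  qed
  show "c \<odot>\<^bsub>M\<^esub> v \<in> Lay i" if cv: "c \<in> carrier R" "v \<in> Lay i" for c v
  proof -
    obtain a b where v: "v = Y a \<oplus>\<^bsub>M\<^esub> b" "a \<in> Ker (i + 1)" "b \<in> Ker (i - 1)"
      using cv(2) by (auto simp: Lay_def)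
    have "c \<odot>\<^bsub>M\<^esub> v = Y (c \<odot>\<^bsub>M\<^esub> a) \<oplus>\<^bsub>M\<^esub> c \<odot>\<^bsub>M\<^esub> b"
      using cv(1) v(2,3)[THEN Ker_closed] by (simp add: v(1) smult_r_distr End_smult[OF Y_End])
    then show ?thesis
      unfolding Lay_def using v cv(1) LinearCombinations.submodule.smult_closed[OF Ker_submodule] by blast
  qed
qed

lemma Ker_in_Lay:
  assumes "m \<in> Ker (i - 1)"
  shows "m \<in> Lay i"
proof -
  have "m = Y \<zero>\<^bsub>M\<^esub> \<oplus>\<^bsub>M\<^esub> m"
    using Ker_closed[OF assms] Y_End by simp
  then show ?thesis
    unfolding Lay_def using assms LinearCombinations.submodule.zero_closed[OF Ker_submodule] by blast
qed

lemma Y_in_Lay: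
  assumes "m \<in> Ker (i + 1)"
  shows "Y m \<in> Lay i"
proof -
  have "Y m = Y m \<oplus>\<^bsub>M\<^esub> \<zero>\<^bsub>M\<^esub>"
    using Ker_closed[OF assms] by simp
  then show ?thesis
    unfolding Lay_def using assms LinearCombinations.submodule.zero_closed[OF Ker_submodule] by blast
qed

lemma Lay_sub_Ker:
  assumes "m \<in> Lay i"
  shows "m \<in> Ker i"
proof -
  obtain a b where m: "m = Y a \<oplus>\<^bsub>M\<^esub> b" "a \<in> Ker (i + 1)" "b \<in> Ker (i - 1)"
    using assms by (auto simp: Lay_def)
  have "Y a \<in> Ker i" "b \<in> Ker i"
    using Y_Ker[OF m(2)] Ker_mono[OF _ m(3), of i] by simp_all
  then show ?thesis
    unfolding m(1) by (rule LinearCombinations.submodule.m_closed[OF Ker_submodule])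
qed

end

section \<open>A basis of the module\<close>

text \<open>The assumptions \<open>F_gen\<close> and \<open>F_indep\<close> say that the classes of the elements of \<open>F j\<close> form a
  basis of \<open>Ker j / Lay j\<close>, in terms of representatives.\<close>

locale standard_sequence = nilpotent_module R M Y l
  for R :: "('r, 'x) ring_scheme" (structure) and M :: "('r, 'm, 'z) module_scheme"
    and Y :: "'m \<Rightarrow> 'm" and l :: nat +
  fixes F :: "nat \<Rightarrow> 'm set"
  assumes F_sub: "j \<in> {1..l} \<Longrightarrow> F j \<subseteq> Ker j"
    and F_gen: "j \<in> {1..l} \<Longrightarrow> m \<in> Ker j \<Longrightarrow> \<exists>x\<in>span (F j). m \<ominus>\<^bsub>M\<^esub> x \<in> Lay j"
    and F_indep: "\<lbrakk>j \<in> {1..l}; finite A; A \<subseteq> F j; a \<in> A \<rightarrow> carrier R; lincomb a A \<in> Lay j; f \<in> A\<rbrakk>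
      \<Longrightarrow> a f = \<zero>"
    and one_not_zero: "\<one> \<noteq> \<zero>"
    and fin_gen: "\<exists>E. finite E \<and> E \<subseteq> carrier M \<and> generate (add_monoid M) E = carrier M"
begin

text \<open>The triple \<open>(k, f, t)\<close> stands for the element \<open>f y\<^sup>t\<close>, where \<open>f \<in> F k\<close>.  Its level \<open>k - t\<close> is the
  least \<open>i\<close> with \<open>f y\<^sup>t \<in> Ker i\<close>, as independence will imply.\<close>

definition idx :: "(nat \<times> 'm \<times> nat) set"
  where "idx = {(k, f, t). k \<in> {1..l} \<and> f \<in> F k \<and> t < k}"

definition elt :: "nat \<times> 'm \<times> nat \<Rightarrow> 'm"
  where "elt = (\<lambda>(k, f, t). (Y ^^ t) f)"

definition lev :: "nat \<times> 'm \<times> nat \<Rightarrow> nat"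
  where "lev = (\<lambda>(k, f, t). k - t)"

lemma elt_simp: "elt (k, f, t) = (Y ^^ t) f"
  by (simp add: elt_def)

lemma lev_simp: "lev (k, f, t) = k - t"
  by (simp add: lev_def)

lemma idx_iff: "(k, f, t) \<in> idx \<longleftrightarrow> k \<in> {1..l} \<and> f \<in> F k \<and> t < k"
  by (simp add: idx_def)

lemma F_closed: "k \<in> {1..l} \<Longrightarrow> f \<in> F k \<Longrightarrow> f \<in> carrier M"
  using F_sub Ker_closed by blast

lemma elt_Ker: "p \<in> idx \<Longrightarrow> elt p \<in> Ker (lev p)"
proof -
  assume p: "p \<in> idx"
  obtain k f t where p_eq: "p = (k, f, t)" by (cases p)
  then have f: "f \<in> Ker k" "t < k" using p F_sub by (auto simp: idx_iff)
  then show ?thesis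
    using Y_pow_Ker_iff[of f t "k - t"] Ker_closed[OF f(1)] by (simp add: p_eq elt_simp lev_simp)
qed

lemma elt_closed [simp]: "p \<in> idx \<Longrightarrow> elt p \<in> carrier M"
  using elt_Ker Ker_closed by blast

lemma elt_image_closed: "C \<subseteq> idx \<Longrightarrow> elt ` C \<subseteq> carrier M"
  by auto

lemma span_elt_submodule: "C \<subseteq> idx \<Longrightarrow> LinearCombinations.submodule R (span (elt ` C)) M"
  by (rule span_is_submodule[OF elt_image_closed])

lemma span_elt_closed: "C \<subseteq> idx \<Longrightarrow> m \<in> span (elt ` C) \<Longrightarrow> m \<in> carrier M"
  using span_is_subset2[OF elt_image_closed] by blast

lemma elt_in_span: "C \<subseteq> idx \<Longrightarrow> p \<in> C \<Longrightarrow> elt p \<in> span (elt ` C)"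
  using in_own_span[OF elt_image_closed] by blast

lemma Y_elt:
  assumes "(k, f, t) \<in> idx"
  shows "Y (elt (k, f, t)) = (if t + 1 < k then elt (k, f, t + 1) else \<zero>\<^bsub>M\<^esub>)"
proof (cases "t + 1 < k")
  case False
  then have "t + 1 = k" using assms by (simp add: idx_iff)
  then have "Y (elt (k, f, t)) = (Y ^^ k) f" by (auto simp: elt_simp)
  then show ?thesis using False assms F_sub[of k] by (auto simp: idx_iff Ker_def)
qed (simp add: elt_simp)

lemma span_elt_mono: "C \<subseteq> D \<Longrightarrow> m \<in> span (elt ` C) \<Longrightarrow> m \<in> span (elt ` D)"
  using span_is_monotone[OF image_mono] by blast

text \<open>By downward induction on \<open>i\<close>: modulo \<open>Ker (i - 1)\<close>, an element of \<open>Ker i\<close> is a combination of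
  \<open>F i\<close> plus \<open>Y a\<close> with \<open>a \<in> Ker (i + 1)\<close>, and \<open>Y\<close> maps the elements of level \<open>i + 1\<close> to
  elements of level \<open>i\<close>.\<close>

lemma Ker_modulo_lower:
  assumes "i \<le> l + 1"
  shows "i \<ge> 1 \<Longrightarrow> m \<in> Ker i \<Longrightarrow> \<exists>x\<in>span (elt ` {p \<in> idx. lev p = i}). m \<ominus>\<^bsub>M\<^esub> x \<in> Ker (i - 1)"
  using assms
proof (induction i arbitrary: m rule: inc_induct)
  \<comment> \<open>Starting at \<open>l + 1\<close> makes the start trivial, as no element has level \<open>l + 1\<close> and
    \<open>Ker (l + 1) = Ker l\<close>.\<close>
  case base
  have "m \<ominus>\<^bsub>M\<^esub> \<zero>\<^bsub>M\<^esub> \<in> Ker l"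
    using Ker_closed[OF base(2)] by (simp add: Ker_top a_minus_def)
  then show ?case
    using LinearCombinations.submodule.zero_closed[OF span_elt_submodule, of "{p \<in> idx. lev p = l + 1}"]
    by auto
next
  case (step i)
  let ?E = "{p \<in> idx. lev p = i}"
  have U: "LinearCombinations.submodule R (span (elt ` ?E)) M"
    by (rule span_elt_submodule) auto
  have i: "i \<in> {1..l}" using step by simp
  obtain x where x: "x \<in> span (F i)" "m \<ominus>\<^bsub>M\<^esub> x \<in> Lay i"
    using F_gen[OF i step.prems(2)] by auto
  obtain a b where ab: "m \<ominus>\<^bsub>M\<^esub> x = Y a \<oplus>\<^bsub>M\<^esub> b" "a \<in> Ker (Suc i)" "b \<in> Ker (i - 1)"
    using x(2) by (auto simp: Lay_def)
  obtain x' where x': "x' \<in> span (elt ` {p \<in> idx. lev p = Suc i})" "a \<ominus>\<^bsub>M\<^esub> x' \<in> Ker i"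
    using step.IH[OF _ ab(2)] by auto
  have "F i \<subseteq> span (elt ` ?E)"
  proof
    fix f assume "f \<in> F i"
    then have "(i, f, 0) \<in> ?E" using i by (auto simp: idx_iff lev_simp)
    then show "f \<in> span (elt ` ?E)" using elt_in_span[of ?E "(i, f, 0)"] by (auto simp: elt_simp)
  qed
  then have xE: "x \<in> span (elt ` ?E)"
    using U x(1) by (rule span_mono_submodule)
  have Yx'E: "Y x' \<in> span (elt ` ?E)"
  proof (rule End_span[OF Y_End _ U _ x'(1)])
    show "elt ` {p \<in> idx. lev p = Suc i} \<subseteq> carrier M" by auto
    fix z assume "z \<in> elt ` {p \<in> idx. lev p = Suc i}"
    then obtain k f t where z: "z = elt (k, f, t)" "(k, f, t) \<in> idx" "k - t = Suc i"
      by (force simp: lev_simp)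
    then have "t + 1 < k" "(k, f, t + 1) \<in> ?E"
      using i by (auto simp: idx_iff lev_simp)
    then show "Y z \<in> span (elt ` ?E)"
      using Y_elt[OF z(2)] elt_in_span[of ?E "(k, f, t + 1)"] by (auto simp: z(1))
  qed
  have c: "m \<in> carrier M" "a \<in> carrier M" "b \<in> carrier M" "x \<in> carrier M" "x' \<in> carrier M"
    using Ker_closed step.prems(2) ab(2,3) span_elt_closed[OF _ xE] span_elt_closed[OF _ x'(1)] by blast+
  have "m \<ominus>\<^bsub>M\<^esub> (x \<oplus>\<^bsub>M\<^esub> Y x') = (m \<ominus>\<^bsub>M\<^esub> x) \<ominus>\<^bsub>M\<^esub> Y x'"
    using c by (simp add: a_minus_def M.minus_add M.a_ac)
  also have "\<dots> = Y (a \<ominus>\<^bsub>M\<^esub> x') \<oplus>\<^bsub>M\<^esub> b"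
    unfolding ab(1) using c by (simp add: a_minus_def End_add[OF Y_End] End_uminus[OF Y_End] M.a_ac)
  also have "\<dots> \<in> Ker (i - 1)"
    using Y_Ker[OF x'(2)] ab(3) by (intro LinearCombinations.submodule.m_closed[OF Ker_submodule])
  finally show ?case
    using LinearCombinations.submodule.m_closed[OF U xE Yx'E] by blast
qed

lemma Ker_spanned:
  assumes "j \<le> l" "m \<in> Ker j"
  shows "m \<in> span (elt ` {p \<in> idx. lev p \<le> j})"
  using assms
proof (induction j arbitrary: m)
  case 0
  then show ?case
    using LinearCombinations.submodule.zero_closed[OF span_elt_submodule, of "{p \<in> idx. lev p \<le> 0}"]
    by (simp add: Ker_0)
next
  case (Suc j)
  let ?E = "{p \<in> idx. lev p \<le> Suc j}"
  have U: "LinearCombinations.submodule R (span (elt ` ?E)) M"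
    by (rule span_elt_submodule) auto
  obtain x where x: "x \<in> span (elt ` {p \<in> idx. lev p = Suc j})" "m \<ominus>\<^bsub>M\<^esub> x \<in> Ker j"
    using Ker_modulo_lower[of "Suc j" m] Suc.prems by auto
  have "x \<in> span (elt ` ?E)"
    using x(1) by (rule span_elt_mono[rotated]) auto
  moreover have "m \<ominus>\<^bsub>M\<^esub> x \<in> span (elt ` ?E)"
    using Suc.IH[OF _ x(2)] Suc.prems(1) by (intro span_elt_mono[of "{p \<in> idx. lev p \<le> j}" ?E]) auto
  ultimately have "x \<oplus>\<^bsub>M\<^esub> (m \<ominus>\<^bsub>M\<^esub> x) \<in> span (elt ` ?E)"
    by (rule LinearCombinations.submodule.m_closed[OF U])
  moreover have "x \<in> carrier M" "m \<in> carrier M"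
    using \<open>x \<in> span (elt ` ?E)\<close> LinearCombinations.submodule.subset[OF U] Ker_closed[OF Suc.prems(2)] by auto
  ultimately show ?case
    by (simp add: a_minus_def M.a_lcomm M.r_neg)
qed

text \<open>Let \<open>j\<close> be the largest level in the relation and \<open>t\<^sub>0\<close> the least exponent at this level.  The terms
  of lower level lie in \<open>Ker (j - 1)\<close>, so the terms of level \<open>j\<close> add up to an element of
  \<open>Ker (j - 1)\<close>.  Cancelling the common factor \<open>y\<^bsup>t\<^sub>0\<^esup>\<close> gives an element \<open>w\<close> of \<open>Ker (k\<^sub>0 - 1)\<close> for
  \<open>k\<^sub>0 = j + t\<^sub>0\<close>.  The terms of \<open>w\<close> that are still divisible by \<open>y\<close> lie in \<open>Y (Ker (k\<^sub>0 + 1))\<close>, and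
  what remains is a combination of \<open>F k\<^sub>0\<close> in \<open>Lay k\<^sub>0\<close>.\<close>

lemma elt_indep_nonzero:
  assumes A: "finite A" "A \<subseteq> idx" and a: "a \<in> A \<rightarrow> carrier R"
    and nz: "\<And>p. p \<in> A \<Longrightarrow> a p \<noteq> \<zero>" and sum: "(\<Oplus>\<^bsub>M\<^esub>p\<in>A. a p \<odot>\<^bsub>M\<^esub> elt p) = \<zero>\<^bsub>M\<^esub>"
  shows "A = {}"
proof (rule ccontr)
  assume ne: "A \<noteq> {}"
  define j where "j = Max (lev ` A)"
  define B where "B = {p \<in> A. lev p = j}"
  define t0 where "t0 = Min ((snd \<circ> snd) ` B)"
  define A0 where "A0 = {p \<in> B. snd (snd p) = t0}"
  define k0 where "k0 = j + t0"
  have fin: "finite B" "finite A0" "finite (B - A0)" "finite (A - B)"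
    using A(1) by (auto simp: B_def A0_def)
  have "j \<in> lev ` A" unfolding j_def using A(1) ne by (intro Max_in) auto
  then have "B \<noteq> {}" unfolding B_def by blast
  then have "t0 \<in> (snd \<circ> snd) ` B" unfolding t0_def using fin by (intro Min_in) auto
  then obtain p0 where p0: "p0 \<in> A0" by (auto simp: A0_def)
  have lev_le: "lev p \<le> j" if "p \<in> A" for p
    unfolding j_def using A(1) that by (intro Max_ge) auto
  have t0_le: "t0 \<le> snd (snd p)" if "p \<in> B" for p
    unfolding t0_def using fin(1) that by (intro Min_le) auto
  have B: "k \<in> {1..l} \<and> f \<in> F k \<and> k = j + t \<and> t0 \<le> t \<and> j \<ge> 1" if "(k, f, t) \<in> B" for k f t
  proof -
    have "(k, f, t) \<in> idx" "k - t = j" using that A(2) by (auto simp: B_def lev_simp)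
    then show ?thesis using t0_le[OF that] by (auto simp: idx_iff)
  qed
  \<comment> \<open>\<open>e'\<close> is \<open>elt\<close> with the common factor \<open>Y ^^ t0\<close> cancelled; on \<open>A0\<close> it is a generator in \<open>F k0\<close>.\<close>
  define e' :: "nat \<times> 'm \<times> nat \<Rightarrow> 'm" where "e' = (\<lambda>(k, f, t). (Y ^^ (t - t0)) f)"
  have e'_simp: "e' (k, f, t) = (Y ^^ (t - t0)) f" for k f t by (simp add: e'_def)
  have e'_closed: "e' p \<in> carrier M" if "p \<in> B" for p
  proof -
    obtain k f t where p_eq: "p = (k, f, t)" by (cases p)
    then have "f \<in> carrier M" using that B[of k f t] F_closed by blast
    then show ?thesis by (simp add: p_eq e'_simp)
  qed
  have e'_elt: "(Y ^^ t0) (e' p) = elt p" if "p \<in> B" for p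
    using that B by (cases p) (auto simp: e'_simp Y_pow_pow elt_simp)
  have BA: "B \<subseteq> A" "A0 \<subseteq> B" by (auto simp: B_def A0_def)
  have aB: "a \<in> B \<rightarrow> carrier R" "a \<in> A0 \<rightarrow> carrier R" "a \<in> B - A0 \<rightarrow> carrier R" "a \<in> A - B \<rightarrow> carrier R"
    using a BA by auto
  have elt_term: "a p \<odot>\<^bsub>M\<^esub> elt p \<in> carrier M" if "p \<in> A" for p
    using that a A(2) by (intro smult_closed elt_closed) auto
  let ?w = "\<Oplus>\<^bsub>M\<^esub>p\<in>B. a p \<odot>\<^bsub>M\<^esub> e' p"
  let ?x = "\<Oplus>\<^bsub>M\<^esub>p\<in>A0. a p \<odot>\<^bsub>M\<^esub> e' p"
  let ?z = "\<Oplus>\<^bsub>M\<^esub>p\<in>B - A0. a p \<odot>\<^bsub>M\<^esub> e' p"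
  have term_closed: "a p \<odot>\<^bsub>M\<^esub> e' p \<in> carrier M" if "p \<in> B" for p
    using that by (intro smult_closed e'_closed funcset_mem[OF aB(1)])
  have closed: "?w \<in> carrier M" "?x \<in> carrier M" "?z \<in> carrier M"
    by (rule finsum_closed, rule Pi_I, rule term_closed, use BA in blast)+
  have k0: "k0 \<in> {1..l}" and p0_eq: "\<exists>f. p0 = (k0, f, t0)"
    using B p0 unfolding A0_def k0_def by (cases p0, force)+
  have w_Lay: "?w \<in> Lay k0"
  proof -
    have "(Y ^^ t0) ?w = (\<Oplus>\<^bsub>M\<^esub>p\<in>B. (Y ^^ t0) (a p \<odot>\<^bsub>M\<^esub> e' p))"
      using aB e'_closed by (intro End_finsum[OF Y_pow_End]) auto
    also have "\<dots> = (\<Oplus>\<^bsub>M\<^esub>p\<in>B. a p \<odot>\<^bsub>M\<^esub> elt p)"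
      using aB e'_closed e'_elt A(2) BA by (intro finsum_cong') (auto simp: End_smult[OF Y_pow_End] Pi_def)
    finally have Yw: "(Y ^^ t0) ?w = (\<Oplus>\<^bsub>M\<^esub>p\<in>B. a p \<odot>\<^bsub>M\<^esub> elt p)" .
    have low: "(\<Oplus>\<^bsub>M\<^esub>p\<in>A - B. a p \<odot>\<^bsub>M\<^esub> elt p) \<in> Ker (j - 1)"
    proof (rule submodule_finsum[OF Ker_submodule], rule)
      fix p assume p: "p \<in> A - B"
      then have "lev p \<le> j - 1" using lev_le[of p] by (auto simp: B_def)
      then have "elt p \<in> Ker (j - 1)" using p A(2) elt_Ker[of p] Ker_mono by blast
      then show "a p \<odot>\<^bsub>M\<^esub> elt p \<in> Ker (j - 1)"
        using LinearCombinations.submodule.smult_closed[OF Ker_submodule] aB(4) p by auto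
    qed
    have BAA: "B \<union> (A - B) = A" using BA by auto
    have "(\<Oplus>\<^bsub>M\<^esub>p\<in>B \<union> (A - B). a p \<odot>\<^bsub>M\<^esub> elt p)
        = (Y ^^ t0) ?w \<oplus>\<^bsub>M\<^esub> (\<Oplus>\<^bsub>M\<^esub>p\<in>A - B. a p \<odot>\<^bsub>M\<^esub> elt p)"
      unfolding Yw
    proof (rule finsum_Un_disjoint[OF fin(1,4)])
      show "(\<lambda>p. a p \<odot>\<^bsub>M\<^esub> elt p) \<in> B \<rightarrow> carrier M" "(\<lambda>p. a p \<odot>\<^bsub>M\<^esub> elt p) \<in> A - B \<rightarrow> carrier M"
        by (rule Pi_I, rule elt_term, use BA in blast)+
    qed blast
    from trans[OF this[unfolded BAA, symmetric] sum]
    have "(Y ^^ t0) ?w \<oplus>\<^bsub>M\<^esub> (\<Oplus>\<^bsub>M\<^esub>p\<in>A - B. a p \<odot>\<^bsub>M\<^esub> elt p) = \<zero>\<^bsub>M\<^esub>" .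
    then have "(Y ^^ t0) ?w = \<ominus>\<^bsub>M\<^esub> (\<Oplus>\<^bsub>M\<^esub>p\<in>A - B. a p \<odot>\<^bsub>M\<^esub> elt p)"
      using closed(1) Ker_closed[OF low] by (simp add: M.minus_equality)
    then have "(Y ^^ t0) ?w \<in> Ker (j - 1)"
      using submodule_uminus[OF Ker_submodule low] by simp
    then have "?w \<in> Ker (j - 1 + t0)"
      using Y_pow_Ker_iff closed(1) by blast
    moreover have "j - 1 + t0 = k0 - 1"
      using B p0 p0_eq BA unfolding k0_def by fastforce
    ultimately show ?thesis
      using Ker_in_Lay by simp
  qed
  have z_Lay: "?z \<in> Lay k0"
  proof (rule submodule_finsum[OF Lay_submodule], rule)
    fix p assume p: "p \<in> B - A0"
    obtain k f t where p_eq: "p = (k, f, t)" by (cases p)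
    have kft: "k \<in> {1..l}" "f \<in> F k" "k = j + t" "t0 \<le> t" "t \<noteq> t0"
      using B[of k f t] p by (auto simp: p_eq A0_def)
    have f: "f \<in> carrier M" "f \<in> Ker k" using F_closed[OF kft(1,2)] F_sub[OF kft(1)] kft(2) by blast+
    have "(Y ^^ (t - t0 - 1)) f \<in> Ker (k0 + 1)"
      using f kft Y_pow_Ker_iff[of f "t - t0 - 1" "k0 + 1"] by (simp add: k0_def)
    then have "Y ((Y ^^ (t - t0 - 1)) f) \<in> Lay k0" by (rule Y_in_Lay)
    moreover have "Y ((Y ^^ (t - t0 - 1)) f) = e' p"
    proof -
      have "e' p = (Y ^^ Suc (t - t0 - 1)) f"
        using kft(4,5) by (simp add: p_eq e'_simp Suc_diff_Suc del: funpow.simps)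
      then show ?thesis by simp
    qed
    ultimately show "a p \<odot>\<^bsub>M\<^esub> e' p \<in> Lay k0"
      using LinearCombinations.submodule.smult_closed[OF Lay_submodule] aB(3) p by auto
  qed
  have "?w = ?x \<oplus>\<^bsub>M\<^esub> ?z"
  proof -
    have A0B: "A0 \<union> (B - A0) = B" using BA by auto
    have "(\<Oplus>\<^bsub>M\<^esub>p\<in>A0 \<union> (B - A0). a p \<odot>\<^bsub>M\<^esub> e' p) = ?x \<oplus>\<^bsub>M\<^esub> ?z"
    proof (rule finsum_Un_disjoint[OF fin(2,3)])
      show "(\<lambda>p. a p \<odot>\<^bsub>M\<^esub> e' p) \<in> A0 \<rightarrow> carrier M" "(\<lambda>p. a p \<odot>\<^bsub>M\<^esub> e' p) \<in> B - A0 \<rightarrow> carrier M"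
        by (rule Pi_I, rule term_closed, use BA in blast)+
    qed blast
    then show ?thesis unfolding A0B .
  qed
  then have "?x = ?w \<ominus>\<^bsub>M\<^esub> ?z"
    using closed by (simp add: a_minus_def M.a_assoc M.r_neg)
  then have x_Lay: "?x \<in> Lay k0"
    using submodule_minus[OF Lay_submodule w_Lay z_Lay] by simp
  define G where "G = {f. (k0, f, t0) \<in> A0}"
  have "\<exists>f. p = (k0, f, t0)" if p: "p \<in> A0" for p
  proof -
    obtain k f t where p_eq: "p = (k, f, t)" by (cases p)
    then have t: "t = t0" and kft: "(k, f, t) \<in> B" using p by (auto simp: A0_def)
    show ?thesis using B[OF kft] by (simp add: p_eq k0_def t)
  qed
  then have A0_G: "A0 = (\<lambda>f. (k0, f, t0)) ` G"
    unfolding G_def by fast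
  have inj: "inj_on (\<lambda>f. (k0, f, t0)) G" by (simp add: inj_on_def)
  have G_B: "(k0, f, t0) \<in> B" if "f \<in> G" for f
    using that BA(2) by (auto simp: G_def)
  have G: "finite G" "G \<subseteq> F k0" "(\<lambda>f. a (k0, f, t0)) \<in> G \<rightarrow> carrier R"
    using finite_imageD[OF _ inj] fin(2) B G_B funcset_mem[OF aB(1)] unfolding A0_G by auto
  have "lincomb (\<lambda>f. a (k0, f, t0)) G = (\<Oplus>\<^bsub>M\<^esub>f\<in>G. a (k0, f, t0) \<odot>\<^bsub>M\<^esub> e' (k0, f, t0))"
    unfolding lincomb_def by (simp add: e'_simp)
  also have "\<dots> = (\<Oplus>\<^bsub>M\<^esub>p\<in>(\<lambda>f. (k0, f, t0)) ` G. a p \<odot>\<^bsub>M\<^esub> e' p)"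
    by (rule finsum_reindex[symmetric, OF _ inj]) (auto intro: term_closed G_B)
  also have "\<dots> = ?x" unfolding A0_G ..
  finally have "lincomb (\<lambda>f. a (k0, f, t0)) G \<in> Lay k0" using x_Lay by simp
  moreover obtain f0 where f0: "p0 = (k0, f0, t0)" "f0 \<in> G"
    using p0 A0_G by blast
  ultimately have "a p0 = \<zero>"
    using F_indep[OF k0 G] by simp
  then show False
    using nz[of p0] p0 BA by blast
qed

lemma elt_indep:
  assumes A: "finite A" "A \<subseteq> idx" and a: "a \<in> A \<rightarrow> carrier R"
    and sum: "(\<Oplus>\<^bsub>M\<^esub>p\<in>A. a p \<odot>\<^bsub>M\<^esub> elt p) = \<zero>\<^bsub>M\<^esub>" and p: "p \<in> A"
  shows "a p = \<zero>"
proof -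
  let ?A = "{p \<in> A. a p \<noteq> \<zero>}"
  have closed: "a q \<odot>\<^bsub>M\<^esub> elt q \<in> carrier M" if "q \<in> A" for q
    using that a A(2) by (intro smult_closed elt_closed) auto
  have "(\<Oplus>\<^bsub>M\<^esub>q\<in>?A. a q \<odot>\<^bsub>M\<^esub> elt q) = (\<Oplus>\<^bsub>M\<^esub>q\<in>A. a q \<odot>\<^bsub>M\<^esub> elt q)"
  proof (rule M.add.finprod_mono_neutral_cong_left[OF A(1)])
    fix q assume q: "q \<in> A - ?A"
    then have "elt q \<in> carrier M" using A(2) by (intro elt_closed) blast
    with q show "a q \<odot>\<^bsub>M\<^esub> elt q = \<zero>\<^bsub>M\<^esub>" by simp
  qed (use closed in auto)
  then have "?A = {}"
    using A a sum by (intro elt_indep_nonzero[of _ a]) auto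
  with p show ?thesis by blast
qed

text \<open>Finitely many group generators of \<open>M\<close> involve only finitely many basis elements, and these then
  span \<open>M\<close>; a further basis element would depend on them.\<close>

lemma idx_finite: "finite idx"
proof -
  obtain E where E: "finite E" "E \<subseteq> carrier M" "generate (add_monoid M) E = carrier M"
    using fin_gen by auto
  have "\<exists>C. finite C \<and> C \<subseteq> idx \<and> m \<in> span (elt ` C)" if "m \<in> carrier M" for m
  proof -
    have "m \<in> span (elt ` {p \<in> idx. lev p \<le> l})"
      using that by (intro Ker_spanned) (auto simp: Ker_top)
    then obtain A a where A: "finite A" "A \<subseteq> elt ` {p \<in> idx. lev p \<le> l}"
      "a \<in> A \<rightarrow> carrier R" "m = lincomb a A"
      unfolding span_def by auto
    then obtain C where "C \<subseteq> {p \<in> idx. lev p \<le> l}" "finite C" "A = elt ` C"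
      by (meson finite_subset_image)
    then show ?thesis using A unfolding span_def by blast
  qed
  then obtain C where C: "\<And>m. m \<in> carrier M \<Longrightarrow> finite (C m) \<and> C m \<subseteq> idx \<and> m \<in> span (elt ` C m)"
    by metis
  define D where "D = \<Union> (C ` E)"
  have D: "finite D" "D \<subseteq> idx" using E C by (auto simp: D_def)
  have U: "LinearCombinations.submodule R (span (elt ` D)) M"
    using D(2) by (rule span_elt_submodule)
  have "E \<subseteq> span (elt ` D)"
  proof
    fix m assume "m \<in> E"
    then have "m \<in> span (elt ` C m)" "C m \<subseteq> D"
      using C E(2) by (auto simp: D_def)
    then show "m \<in> span (elt ` D)" using span_elt_mono by blast
  qed
  moreover have "subgroup (span (elt ` D)) (add_monoid M)"
  proof (rule M.add.subgroupI)
    show "span (elt ` D) \<subseteq> carrier M" "span (elt ` D) \<noteq> {}"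
      using LinearCombinations.submodule.subset[OF U] LinearCombinations.submodule.zero_closed[OF U] by auto
  qed (use submodule_uminus[OF U] LinearCombinations.submodule.m_closed[OF U] in auto)
  ultimately have all: "carrier M \<subseteq> span (elt ` D)"
    using M.add.generate_subgroup_incl E(3) by blast
  have "idx \<subseteq> D"
  proof (rule ccontr)
    assume "\<not> idx \<subseteq> D"
    then obtain p where p: "p \<in> idx" "p \<notin> D" by auto
    have "elt p \<in> span (elt ` D)" using all p by auto
    then obtain A a where A: "finite A" "A \<subseteq> elt ` D" "a \<in> A \<rightarrow> carrier R" "elt p = lincomb a A"
      unfolding span_def by auto
    obtain C' where C': "C' \<subseteq> D" "inj_on elt C'" "A = elt ` C'"
      using A(2) by (meson subset_image_inj)
    then have fin: "finite C'" using D finite_subset by blast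
    have closed: "a (elt q) \<in> carrier R" "elt q \<in> carrier M" if q: "q \<in> C'" for q
    proof -
      show "a (elt q) \<in> carrier R"
        using A(3) unfolding C'(3) by (rule funcset_mem) (rule imageI[OF q])
      show "elt q \<in> carrier M"
        using q C'(1) D(2) by (intro elt_closed) blast
    qed
    have "elt p = (\<Oplus>\<^bsub>M\<^esub>q\<in>C'. a (elt q) \<odot>\<^bsub>M\<^esub> elt q)"
      unfolding A(4) lincomb_def C'(3) using closed C'(2) by (subst finsum_reindex) auto
    moreover have "(\<Oplus>\<^bsub>M\<^esub>q\<in>C'. (if q = p then \<ominus> \<one> else a (elt q)) \<odot>\<^bsub>M\<^esub> elt q)
        = (\<Oplus>\<^bsub>M\<^esub>q\<in>C'. a (elt q) \<odot>\<^bsub>M\<^esub> elt q)"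
      using closed C'(1) p by (intro finsum_cong') auto
    moreover have "p \<notin> C'" using p C' by auto
    ultimately have "(\<Oplus>\<^bsub>M\<^esub>q\<in>insert p C'. (if q = p then \<ominus> \<one> else a (elt q)) \<odot>\<^bsub>M\<^esub> elt q)
        = (\<ominus> \<one>) \<odot>\<^bsub>M\<^esub> elt p \<oplus>\<^bsub>M\<^esub> elt p"
      using fin closed p by (subst finsum_insert) auto
    also have "\<dots> = \<zero>\<^bsub>M\<^esub>"
      using p by (simp add: smult_l_minus M.l_neg)
    finally have "(if p = p then \<ominus> \<one> else a (elt p)) = \<zero>"
      using fin closed C'(1) D(2) p(1) by (intro elt_indep[of "insert p C'" "\<lambda>q. if q = p then \<ominus> \<one> else a (elt q)"]) auto
    then show False using one_not_zero by (simp add: R.add.inv_eq_1_iff)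
  qed
  then show ?thesis using D finite_subset by blast
qed

lemma finite_basis: "finite_basis R M idx elt"
proof unfold_locales
  show "span (elt ` idx) = carrier M"
  proof
    show "span (elt ` idx) \<subseteq> carrier M" by (rule span_is_subset2) auto
    show "carrier M \<subseteq> span (elt ` idx)"
    proof
      fix m assume "m \<in> carrier M"
      then have "m \<in> span (elt ` {p \<in> idx. lev p \<le> l})"
        by (intro Ker_spanned) (auto simp: Ker_top)
      then show "m \<in> span (elt ` idx)"
        by (rule span_elt_mono[rotated]) auto
    qed
  qed
qed (use idx_finite elt_indep in auto)

lemma elt_inj:
  assumes p: "p \<in> idx" "q \<in> idx" and eq: "elt p = elt q"
  shows "p = q"
proof (rule ccontr)
  assume ne: "p \<noteq> q"
  have "(\<Oplus>\<^bsub>M\<^esub>r\<in>{p, q}. (if r = p then \<one> else \<ominus> \<one>) \<odot>\<^bsub>M\<^esub> elt r) = elt p \<oplus>\<^bsub>M\<^esub> (\<ominus> \<one>) \<odot>\<^bsub>M\<^esub> elt q"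
    using ne p by (subst finsum_insert) auto
  also have "\<dots> = \<zero>\<^bsub>M\<^esub>"
    using p eq by (simp add: smult_l_minus M.r_neg)
  finally have "(if p = p then \<one> else \<ominus> \<one>) = \<zero>"
    using p by (intro elt_indep[of "{p, q}" "\<lambda>r. if r = p then \<one> else \<ominus> \<one>"]) auto
  then show False using one_not_zero by simp
qed

text \<open>Consequently the condition \<open>h \<noteq> f\<close> in the definition of \<open>\<xi>\<^bsub>f,g\<^esub>\<close> determines the image of every
  member of the generating sequence, whatever the index it occurs under.\<close>

lemma F_disjoint:
  assumes "k \<in> {1..l}" "k' \<in> {1..l}" "f \<in> F k" "f \<in> F k'"
  shows "k = k'"
  using elt_inj[of "(k, f, 0)" "(k', f, 0)"] assms by (auto simp: idx_iff elt_simp)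

end

sublocale standard_sequence \<subseteq> finite_basis R M idx elt
  by (rule finite_basis)

context standard_sequence
begin

section \<open>Endomorphisms commuting with the nilpotent endomorphism\<close>

text \<open>Nothing is required outside of the carrier, so that these sets are closed under pointwise
  operations; extensional maps are only formed by \<open>uni\<close> below.\<close>

definition EndY :: "('m \<Rightarrow> 'm) set"
  where "EndY = {T \<in> End. \<forall>m\<in>carrier M. T (Y m) = Y (T m)}"

lemma EndY_End: "T \<in> EndY \<Longrightarrow> T \<in> End"
  unfolding EndY_def by simp

lemma EndY_closed [simp]: "T \<in> EndY \<Longrightarrow> m \<in> carrier M \<Longrightarrow> T m \<in> carrier M"
  using EndY_End by simp

lemmas EndY_hom_add = End_add[OF EndY_End]
lemmas EndY_hom_uminus = End_uminus[OF EndY_End]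

lemma EndY_Y_pow:
  assumes "T \<in> EndY" "m \<in> carrier M"
  shows "T ((Y ^^ s) m) = (Y ^^ s) (T m)"
proof (induction s)
  case (Suc s)
  then show ?case using assms by (simp add: EndY_def)
qed simp

lemma EndY_zero: "(\<lambda>m. \<zero>\<^bsub>M\<^esub>) \<in> EndY"
  unfolding EndY_def using Y_End by (auto intro!: EndI)

lemma EndY_add: "S \<in> EndY \<Longrightarrow> T \<in> EndY \<Longrightarrow> (\<lambda>m. S m \<oplus>\<^bsub>M\<^esub> T m) \<in> EndY"
  unfolding EndY_def
  by (auto intro!: EndI simp: End_add End_smult smult_r_distr M.a_ac Y_add)

lemma EndY_uminus: "S \<in> EndY \<Longrightarrow> (\<lambda>m. \<ominus>\<^bsub>M\<^esub> S m) \<in> EndY"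
  unfolding EndY_def
  by (auto intro!: EndI simp: End_add End_smult smult_r_minus M.minus_add End_uminus[OF Y_End])

lemma EndY_comp: "S \<in> EndY \<Longrightarrow> T \<in> EndY \<Longrightarrow> (\<lambda>m. S (T m)) \<in> EndY"
  unfolding EndY_def by (auto intro!: EndI simp: End_add End_smult)

lemma EndY_Ker:
  assumes "T \<in> EndY" "m \<in> Ker i"
  shows "T m \<in> Ker i"
proof -
  have "(Y ^^ i) (T m) = T ((Y ^^ i) m)" "m \<in> carrier M"
    using EndY_Y_pow[OF assms(1)] Ker_closed[OF assms(2)] by auto
  then show ?thesis
    using assms by (simp add: Ker_def EndY_End)
qed

lemma carrier_spanned: "m \<in> carrier M \<Longrightarrow> m \<in> span (elt ` idx)"
  using e_span by simp

lemma EndY_eqI: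
  assumes S: "S \<in> EndY" and T: "T \<in> EndY"
    and eq: "\<And>k f. k \<in> {1..l} \<Longrightarrow> f \<in> F k \<Longrightarrow> S f = T f" and m: "m \<in> carrier M"
  shows "S m = T m"
  using carrier_spanned[OF m] elt_image_closed[OF subset_refl]
proof (induction rule: span_induct)
  case (base x)
  then obtain k f t where "x = elt (k, f, t)" "(k, f, t) \<in> idx"
    by auto
  then have x: "x = (Y ^^ t) f" "k \<in> {1..l}" "f \<in> F k"
    by (auto simp: elt_simp idx_iff)
  then show ?case
    using F_closed[OF x(2,3)] eq[OF x(2,3)] S T by (simp add: EndY_Y_pow)
qed (use S T in \<open>auto simp: EndY_End End_add End_smult\<close>)

text \<open>The linear map with \<open>f y\<^sup>t \<mapsto> (v k f) y\<^sup>t\<close> commutes with \<open>Y\<close>: the only case where this is not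
  immediate is \<open>t = k - 1\<close>, where \<open>f\<close> and \<open>v k f\<close> are both killed by \<open>y\<^bsup>t+1\<^esup>\<close>.\<close>

lemma EndY_extension:
  assumes v: "\<And>k f. k \<in> {1..l} \<Longrightarrow> f \<in> F k \<Longrightarrow> v k f \<in> Ker k"
  shows "\<exists>T\<in>EndY. \<forall>k\<in>{1..l}. \<forall>f\<in>F k. T f = v k f"
proof -
  define v' where "v' = (\<lambda>(k, f, t). (Y ^^ t) (v k f))"
  have v'_simp: "v' (k, f, t) = (Y ^^ t) (v k f)" for k f t by (simp add: v'_def)
  have "v' \<in> idx \<rightarrow> carrier M"
    using v[THEN Ker_closed] by (auto simp: v'_simp idx_iff)
  then obtain T where T: "T \<in> End" "\<And>p. p \<in> idx \<Longrightarrow> T (elt p) = v' p"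
    using linear_extension by blast
  have "T (Y m) = Y (T m)" if "m \<in> carrier M" for m
    using carrier_spanned[OF that] elt_image_closed[OF subset_refl]
  proof (induction rule: span_induct)
    case (base x)
    then obtain k f t where x: "x = elt (k, f, t)" and p: "(k, f, t) \<in> idx"
      by auto
    have TY: "Y (T x) = (Y ^^ (t + 1)) (v k f)"
      using T(2)[OF p] by (simp add: x v'_simp)
    show ?case
    proof (cases "t + 1 < k")
      case True
      then have "(k, f, t + 1) \<in> idx" using p by (simp add: idx_iff)
      then show ?thesis
        using True TY T(2)[of "(k, f, t + 1)"] Y_elt[OF p] by (simp add: x v'_simp)
    next
      case False
      then have k: "t + 1 = k" "v k f \<in> Ker k" using p v by (auto simp: idx_iff)
      then have "Y (T x) = \<zero>\<^bsub>M\<^esub>" unfolding TY k(1) by (simp add: Ker_def)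
      moreover have "T (Y x) = \<zero>\<^bsub>M\<^esub>"
        using Y_elt[OF p] False T(1) by (simp add: x)
      ultimately show ?thesis by simp
    qed
  qed (use T(1) Y_End in \<open>auto simp: End_add End_smult\<close>)
  then have "T \<in> EndY" using T(1) by (simp add: EndY_def)
  moreover have "T f = v k f" if "k \<in> {1..l}" "f \<in> F k" for k f
    using T(2)[of "(k, f, 0)"] that by (simp add: idx_iff elt_simp v'_simp)
  ultimately show ?thesis by blast
qed

lemma EndY_single:
  assumes "k \<in> {1..l}" "f \<in> F k" "g \<in> Ker k"
  shows "\<exists>T\<in>EndY. T f = g \<and> (\<forall>k'\<in>{1..l}. \<forall>f'\<in>F k'. f' \<noteq> f \<longrightarrow> T f' = \<zero>\<^bsub>M\<^esub>)"
proof -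
  have "(if f' = f then g else \<zero>\<^bsub>M\<^esub>) \<in> Ker k'" if "k' \<in> {1..l}" "f' \<in> F k'" for k' f'
    using that assms F_disjoint[OF that(1) assms(1), of f] LinearCombinations.submodule.zero_closed[OF Ker_submodule]
    by auto
  from EndY_extension[of "\<lambda>k' f'. if f' = f then g else \<zero>\<^bsub>M\<^esub>", OF this]
  obtain T where "T \<in> EndY" "\<forall>k'\<in>{1..l}. \<forall>f'\<in>F k'. T f' = (if f' = f then g else \<zero>\<^bsub>M\<^esub>)"
    by auto
  then show ?thesis using assms(1,2) by (intro bexI[of _ T]) auto
qed

section \<open>The weight filtration\<close>

text \<open>The spans of the elements of weight at least \<open>d\<close> form the weight filtration of the nilpotent
  endomorphism \<open>Y\<close>: a Jordan block of size \<open>k\<close> carries the weights \<open>-k, -k + 2, \<dots>, k - 2\<close>.\<close>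

definition wt :: "nat \<times> 'm \<times> nat \<Rightarrow> int"
  where "wt = (\<lambda>(k, f, t). 2 * int t - int k)"

lemma wt_simp: "wt (k, f, t) = 2 * int t - int k"
  by (simp add: wt_def)

definition W :: "int \<Rightarrow> 'm set"
  where "W d = span (elt ` {p \<in> idx. d \<le> wt p})"

lemma W_submodule: "LinearCombinations.submodule R (W d) M"
  unfolding W_def by (rule span_elt_submodule) auto

lemmas W_add = LinearCombinations.submodule.m_closed[OF W_submodule]
lemmas W_zero = LinearCombinations.submodule.zero_closed[OF W_submodule]
lemmas W_uminus = submodule_uminus[OF W_submodule]

lemma W_antimono: "d \<le> d' \<Longrightarrow> m \<in> W d' \<Longrightarrow> m \<in> W d"
  unfolding W_def by (erule span_elt_mono[rotated]) auto

lemma elt_W: "p \<in> idx \<Longrightarrow> d \<le> wt p \<Longrightarrow> elt p \<in> W d"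
  unfolding W_def by (rule elt_in_span) auto

lemma Y_W:
  assumes "m \<in> W d"
  shows "Y m \<in> W (d + 2)"
proof (rule End_span[OF Y_End _ W_submodule _ assms[unfolded W_def]])
  show "elt ` {p \<in> idx. d \<le> wt p} \<subseteq> carrier M"
    by (rule elt_image_closed) auto
  fix x assume "x \<in> elt ` {p \<in> idx. d \<le> wt p}"
  then obtain k f t where x: "x = elt (k, f, t)" and p: "(k, f, t) \<in> idx" and d: "d \<le> wt (k, f, t)"
    by auto
  show "Y x \<in> W (d + 2)"
  proof (cases "t + 1 < k")
    case True
    then have "(k, f, t + 1) \<in> idx" "d + 2 \<le> wt (k, f, t + 1)"
      using p d by (auto simp: idx_iff wt_simp)
    then show ?thesis using True Y_elt[OF p] elt_W by (simp add: x)
  next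
    case False
    then show ?thesis using Y_elt[OF p] W_zero by (simp add: x)
  qed
qed

lemma Y_pow_W: "m \<in> W d \<Longrightarrow> (Y ^^ s) m \<in> W (d + 2 * int s)"
proof (induction s)
  case (Suc s)
  then show ?case using Y_W[of "(Y ^^ s) m" "d + 2 * int s"] by (simp add: algebra_simps)
qed simp

lemma W_high:
  assumes "int l \<le> d"
  shows "W d = {\<zero>\<^bsub>M\<^esub>}"
proof -
  \<comment> \<open>The largest weight in a block of size \<open>k\<close> is \<open>2 * (k - 1) - k = k - 2\<close>.\<close>
  have "d > wt p" if "p \<in> idx" for p
    using that assms by (cases p) (auto simp: idx_iff wt_simp)
  then have E: "{p \<in> idx. d \<le> wt p} = {}" by fastforce
  have "span (elt ` {p \<in> idx. d \<le> wt p}) \<subseteq> Ker 0"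
    unfolding E using span_is_subset[OF _ Ker_submodule, of "{}" 0] by simp
  then show ?thesis
    using W_zero[of d] by (auto simp: W_def Ker_0)
qed

text \<open>The weight of an element is its exponent minus its level.\<close>

lemma Ker_W:
  assumes "j \<le> l" "m \<in> Ker j"
  shows "m \<in> W (- int j)"
proof -
  have "- int j \<le> wt p" if "lev p \<le> j" for p
    using that by (cases p) (auto simp: lev_simp wt_simp)
  then have "{p \<in> idx. lev p \<le> j} \<subseteq> {p \<in> idx. - int j \<le> wt p}" by blast
  from span_elt_mono[OF this Ker_spanned[OF assms]] show ?thesis
    unfolding W_def .
qed

text \<open>Both parts of \<open>Lay j\<close> gain at least 1 over the weight \<open>-j\<close> of \<open>Ker j\<close>: passing to
  \<open>Ker (j - 1)\<close> gains 1, and in \<open>Y (Ker (j + 1))\<close> a loss of 1 is followed by a gain of 2.\<close>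

lemma Lay_W:
  assumes j: "j \<in> {1..l}" and m: "m \<in> Lay j"
  shows "m \<in> W (1 - int j)"
proof -
  obtain a b where ab: "m = Y a \<oplus>\<^bsub>M\<^esub> b" "a \<in> Ker (j + 1)" "b \<in> Ker (j - 1)"
    using m by (auto simp: Lay_def)
  have "a \<in> W (- int (j + 1))"
  proof (cases "j = l")
    case True
    \<comment> \<open>\<open>Ker_W\<close> does not apply to \<open>l + 1\<close>, but \<open>Ker (l + 1) = Ker l\<close>.\<close>
    then have "a \<in> Ker l" using Ker_closed[OF ab(2)] by (simp add: Ker_top)
    then show ?thesis using Ker_W[of l a] W_antimono[of "- int (j + 1)" "- int l" a] True by simp
  next
    case False
    then show ?thesis using Ker_W[OF _ ab(2)] j by simp
  qed
  then have "Y a \<in> W (1 - int j)" using Y_W[of a "- int (j + 1)"] by simp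
  moreover have "b \<in> W (1 - int j)"
  proof -
    have "j - 1 \<le> l" "- int (j - 1) = 1 - int j" using j by auto
    then show ?thesis using Ker_W[OF _ ab(3)] by simp
  qed
  ultimately show ?thesis unfolding ab(1) by (rule W_add)
qed

text \<open>Both sets are spanned by basis elements.\<close>

lemma Ker_Int_W:
  assumes "j \<le> l" "m \<in> Ker j" "m \<in> W d"
  shows "m \<in> span (elt ` {p \<in> idx. lev p \<le> j \<and> d \<le> wt p})"
proof -
  have "m \<in> span (elt ` ({p \<in> idx. lev p \<le> j} \<inter> {p \<in> idx. d \<le> wt p}))"
    by (rule span_Int[OF _ _ Ker_spanned[OF assms(1,2)] assms(3)[unfolded W_def]]) auto
  then show ?thesis
    by (rule span_elt_mono[rotated]) auto
qed

text \<open>An element of level \<open>j\<close> and weight at least \<open>1 - j\<close> has a positive exponent, so it is \<open>Y\<close> of an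
  element of level \<open>j + 1\<close>.\<close>

lemma elt_Lay:
  assumes p: "p \<in> idx" "lev p \<le> j" "1 - int j \<le> wt p"
  shows "elt p \<in> Lay j"
proof -
  obtain k f t where p_eq: "p = (k, f, t)" by (cases p)
  show ?thesis
  proof (cases "lev p \<le> j - 1")
    case True
    then show ?thesis using Ker_in_Lay Ker_mono[OF _ elt_Ker[OF p(1)]] by blast
  next
    case False
    then have t: "t \<ge> 1" "(k, f, t - 1) \<in> idx" "lev (k, f, t - 1) = j + 1"
      using p by (auto simp: p_eq idx_iff lev_simp wt_simp)
    then have "Y (elt (k, f, t - 1)) \<in> Lay j"
      using elt_Ker[OF t(2)] by (intro Y_in_Lay) simp
    moreover have "Y (elt (k, f, t - 1)) = elt p"
      using Y_elt[OF t(2)] p(1) t(1) by (simp add: p_eq idx_iff)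
    ultimately show ?thesis by simp
  qed
qed

text \<open>By \<open>Shift_W\<close> these endomorphisms raise all weights by at least \<open>n\<close>; a generator in \<open>F k\<close> has
  weight \<open>-k\<close>.\<close>

definition Shift :: "int \<Rightarrow> ('m \<Rightarrow> 'm) set"
  where "Shift n = {T \<in> EndY. \<forall>k\<in>{1..l}. \<forall>f\<in>F k. T f \<in> W (n - int k)}"

lemma Shift_EndY: "T \<in> Shift n \<Longrightarrow> T \<in> EndY"
  unfolding Shift_def by simp

lemma ShiftI:
  "T \<in> EndY \<Longrightarrow> (\<And>k f. k \<in> {1..l} \<Longrightarrow> f \<in> F k \<Longrightarrow> T f \<in> W (n - int k)) \<Longrightarrow> T \<in> Shift n"
  unfolding Shift_def by simp

lemma Shift_F: "T \<in> Shift n \<Longrightarrow> k \<in> {1..l} \<Longrightarrow> f \<in> F k \<Longrightarrow> T f \<in> W (n - int k)"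
  unfolding Shift_def by simp

lemma Shift_W:
  assumes T: "T \<in> Shift n" and m: "m \<in> W d"
  shows "T m \<in> W (d + n)"
proof (rule End_span[OF EndY_End[OF Shift_EndY[OF T]] _ W_submodule _ m[unfolded W_def]])
  show "elt ` {p \<in> idx. d \<le> wt p} \<subseteq> carrier M"
    by (rule elt_image_closed) auto
  fix x assume "x \<in> elt ` {p \<in> idx. d \<le> wt p}"
  then obtain k f t where x: "x = elt (k, f, t)" and p: "(k, f, t) \<in> idx" and d: "d \<le> wt (k, f, t)"
    by auto
  have kf: "k \<in> {1..l}" "f \<in> F k" using p by (auto simp: idx_iff)
  have "T x = (Y ^^ t) (T f)"
    unfolding x elt_simp by (rule EndY_Y_pow[OF Shift_EndY[OF T] F_closed[OF kf]])
  also have "\<dots> \<in> W (n - int k + 2 * int t)"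
    by (rule Y_pow_W[OF Shift_F[OF T kf]])
  finally show "T x \<in> W (d + n)"
    using d by (elim W_antimono[rotated]) (simp add: wt_simp)
qed

lemma Shift_antimono: "n \<le> n' \<Longrightarrow> T \<in> Shift n' \<Longrightarrow> T \<in> Shift n"
  by (rule ShiftI[OF Shift_EndY W_antimono[OF _ Shift_F]]) auto

lemma Shift_zero: "(\<lambda>m. \<zero>\<^bsub>M\<^esub>) \<in> Shift n"
  by (auto intro: ShiftI EndY_zero W_zero)

lemma Shift_add: "S \<in> Shift n \<Longrightarrow> T \<in> Shift n \<Longrightarrow> (\<lambda>m. S m \<oplus>\<^bsub>M\<^esub> T m) \<in> Shift n"
  by (auto intro: ShiftI EndY_add Shift_EndY W_add Shift_F)

lemma Shift_uminus: "S \<in> Shift n \<Longrightarrow> (\<lambda>m. \<ominus>\<^bsub>M\<^esub> S m) \<in> Shift n"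
  by (auto intro: ShiftI EndY_uminus Shift_EndY W_uminus Shift_F)

lemma Shift_comp:
  assumes S: "S \<in> Shift n" and T: "T \<in> Shift n'"
  shows "(\<lambda>m. S (T m)) \<in> Shift (n + n')"
proof (rule ShiftI[OF EndY_comp[OF Shift_EndY[OF S] Shift_EndY[OF T]]])
  fix k f assume "k \<in> {1..l}" "f \<in> F k"
  then show "S (T f) \<in> W (n + n' - int k)"
    using Shift_W[OF S Shift_F[OF T]] by (simp add: algebra_simps)
qed

lemma Shift_comp_Suc:
  assumes "1 \<le> n" "S \<in> Shift n" "T \<in> Shift n"
  shows "(\<lambda>m. S (T m)) \<in> Shift (n + 1)"
  by (rule Shift_antimono[OF _ Shift_comp[OF assms(2,3)]]) (use assms(1) in simp)

lemma Shift_cong: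
  assumes T: "T \<in> Shift n" and eq: "\<And>m. m \<in> carrier M \<Longrightarrow> S m = T m"
  shows "S \<in> Shift n"
proof (rule ShiftI)
  show "S \<in> EndY"
    using Shift_EndY[OF T] eq unfolding EndY_def
    by (auto intro!: EndI simp: End_add End_smult)
qed (use eq F_closed Shift_F[OF T] in auto)

text \<open>The weights lie between \<open>-l\<close> and \<open>l - 2\<close>.\<close>

lemma Shift_high:
  assumes T: "T \<in> Shift n" and n: "2 * int l \<le> n" and m: "m \<in> carrier M"
  shows "T m = \<zero>\<^bsub>M\<^esub>"
proof (rule EndY_eqI[OF Shift_EndY[OF T] EndY_zero _ m])
  fix k f assume kf: "k \<in> {1..l}" "f \<in> F k"
  then show "T f = \<zero>\<^bsub>M\<^esub>"
    using Shift_F[OF T kf] W_high[of "n - int k"] n by simp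
qed

lemma Shift_Lay:
  assumes T: "T \<in> Shift 1" and j: "j \<in> {1..l}" and m: "m \<in> Ker j"
  shows "T m \<in> Lay j"
proof -
  have "m \<in> W (- int j)" using j m by (intro Ker_W) auto
  then have "T m \<in> W (1 - int j)" using Shift_W[OF T] by fastforce
  moreover have "T m \<in> Ker j" using EndY_Ker[OF Shift_EndY[OF T] m] .
  ultimately have "T m \<in> span (elt ` {p \<in> idx. lev p \<le> j \<and> 1 - int j \<le> wt p})"
    using j by (intro Ker_Int_W) auto
  then show ?thesis
    by (rule span_mono_submodule[OF _ Lay_submodule, rotated]) (auto intro: elt_Lay)
qed

lemma Lay_Shift:
  assumes "T \<in> EndY" "\<And>j f. j \<in> {1..l} \<Longrightarrow> f \<in> F j \<Longrightarrow> T f \<in> Lay j"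
  shows "T \<in> Shift 1"
  using assms by (intro ShiftI Lay_W) auto

section \<open>Unipotent automorphisms\<close>

text \<open>The automorphism \<open>1 + T\<close>, as an extensional map.\<close>

definition uni :: "('m \<Rightarrow> 'm) \<Rightarrow> 'm \<Rightarrow> 'm"
  where "uni T = (\<lambda>m\<in>carrier M. m \<oplus>\<^bsub>M\<^esub> T m)"

text \<open>The operation that turns \<open>T \<mapsto> 1 + T\<close> into a homomorphism; see \<open>compose_uni\<close>.\<close>

definition circ :: "('m \<Rightarrow> 'm) \<Rightarrow> ('m \<Rightarrow> 'm) \<Rightarrow> 'm \<Rightarrow> 'm"
  where "circ S T = (\<lambda>m. (S m \<oplus>\<^bsub>M\<^esub> T m) \<oplus>\<^bsub>M\<^esub> S (T m))"

definition idM :: "'m \<Rightarrow> 'm"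
  where "idM = (\<lambda>m\<in>carrier M. m)"

lemma uni_cong: "(\<And>m. m \<in> carrier M \<Longrightarrow> S m = T m) \<Longrightarrow> uni S = uni T"
  unfolding uni_def by (rule restrict_ext) simp

lemma uni_zero: "(\<And>m. m \<in> carrier M \<Longrightarrow> S m = \<zero>\<^bsub>M\<^esub>) \<Longrightarrow> uni S = idM"
  unfolding uni_def idM_def by (rule restrict_ext) simp

lemma uni_funcset: "T \<in> EndY \<Longrightarrow> uni T \<in> carrier M \<rightarrow> carrier M"
  unfolding uni_def by auto

lemma uni_extensional: "uni T \<in> extensional (carrier M)"
  unfolding uni_def by simp

lemma uni_apply [simp]: "m \<in> carrier M \<Longrightarrow> uni T m = m \<oplus>\<^bsub>M\<^esub> T m"
  unfolding uni_def by simp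

lemma compose_uni:
  assumes "S \<in> EndY" "T \<in> EndY"
  shows "compose (carrier M) (uni S) (uni T) = uni (circ S T)"
proof (rule extensionalityI[OF compose_extensional uni_extensional])
  fix m assume m: "m \<in> carrier M"
  then show "compose (carrier M) (uni S) (uni T) m = uni (circ S T) m"
    using assms by (simp add: compose_eq circ_def EndY_hom_add M.a_ac)
qed

lemma compose_idM [simp]:
  "T \<in> EndY \<Longrightarrow> compose (carrier M) idM (uni T) = uni T"
  "T \<in> EndY \<Longrightarrow> compose (carrier M) (uni T) idM = uni T"
  unfolding idM_def uni_def compose_def by (auto intro!: restrict_ext)

lemma compose_uni_assoc:
  assumes "S \<in> EndY" "T \<in> EndY" "U \<in> EndY"
  shows "compose (carrier M) (uni S) (compose (carrier M) (uni T) (uni U))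
    = compose (carrier M) (compose (carrier M) (uni S) (uni T)) (uni U)"
  using uni_funcset[OF assms(3)] by (rule compose_assoc)

lemma Shift_circ:
  assumes "S \<in> Shift n" "T \<in> Shift n" "1 \<le> n"
  shows "circ S T \<in> Shift n"
proof -
  have "(\<lambda>m. S (T m)) \<in> Shift n"
    by (rule Shift_antimono[OF _ Shift_comp_Suc[OF assms(3,1,2)]]) simp
  from Shift_add[OF Shift_add[OF assms(1,2)] this] show ?thesis
    unfolding circ_def .
qed

text \<open>As \<open>(1 + S) (1 - S) = 1 - S\<^sup>2\<close> with \<open>S\<^sup>2 \<in> Shift (n + 1)\<close>, a right inverse of \<open>1 - S\<^sup>2\<close> gives one
  of \<open>1 + S\<close>; the induction ends because \<open>Shift (2 * l)\<close> is zero.\<close>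

lemma uni_right_inverse:
  assumes "1 \<le> n" "S \<in> Shift n"
  shows "\<exists>S'\<in>Shift n. compose (carrier M) (uni S) (uni S') = idM"
  using assms
proof (induction "nat (2 * int l - n)" arbitrary: n S rule: less_induct)
  case less
  have S: "S \<in> EndY" by (rule Shift_EndY[OF less.prems(2)])
  show ?case
  proof (cases "2 * int l \<le> n")
    case True
    then have id: "uni S = idM"
      using Shift_high[OF less.prems(2)] by (intro uni_zero) auto
    have "compose (carrier M) (uni S) (uni S) = idM"
      using compose_idM(1)[OF S] id by simp
    then show ?thesis using less.prems(2) by blast
  next
    case False
    let ?N = "\<lambda>m. \<ominus>\<^bsub>M\<^esub> S m" and ?S2 = "\<lambda>m. \<ominus>\<^bsub>M\<^esub> S (S m)"
    have N: "?N \<in> Shift n" by (rule Shift_uminus[OF less.prems(2)])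
    have "?S2 \<in> Shift (n + 1)"
      by (rule Shift_uminus[OF Shift_comp_Suc[OF less.prems(1,2,2)]])
    then obtain S' where S': "S' \<in> Shift (n + 1)" "compose (carrier M) (uni ?S2) (uni S') = idM"
      using less.hyps[of "n + 1" ?S2] less.prems(1) False by auto
    have eq: "uni (circ S ?N) = uni ?S2"
    proof (rule uni_cong)
      fix m assume "m \<in> carrier M"
      then show "circ S ?N m = ?S2 m"
        using S by (simp add: circ_def EndY_hom_uminus M.r_neg)
    qed
    have S'n: "S' \<in> Shift n" using S'(1) by (rule Shift_antimono[rotated]) simp
    note E = S Shift_EndY[OF N] Shift_EndY[OF S'(1)]
    have "compose (carrier M) (uni S) (uni (circ ?N S')) = idM"
      using S'(2) by (simp add: compose_uni[OF E(2,3), symmetric] compose_uni_assoc[OF E]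
          compose_uni[OF E(1,2)] eq)
    then show ?thesis using Shift_circ[OF N S'n less.prems(1)] by blast
  qed
qed

text \<open>A right inverse that itself has a right inverse is a two-sided inverse.\<close>

lemma uni_inverse:
  assumes "1 \<le> n" "S \<in> Shift n"
  shows "\<exists>S'\<in>Shift n. compose (carrier M) (uni S) (uni S') = idM \<and> compose (carrier M) (uni S') (uni S) = idM"
proof -
  obtain S' where S': "S' \<in> Shift n" "compose (carrier M) (uni S) (uni S') = idM"
    using uni_right_inverse[OF assms] by auto
  obtain S'' where S'': "S'' \<in> Shift n" "compose (carrier M) (uni S') (uni S'') = idM"
    using uni_right_inverse[OF assms(1) S'(1)] by auto
  note E = Shift_EndY[OF assms(2)] Shift_EndY[OF S'(1)] Shift_EndY[OF S''(1)]
  have "uni S = uni S''"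
    using compose_uni_assoc[OF E] E S'(2) S''(2) by simp
  then show ?thesis using S' S''(2) by auto
qed

end

section \<open>Generators of the unipotent group\<close>

text \<open>The assumptions on \<open>G\<close> hold for the subgroup generated by the automorphisms
  \<open>\<xi>\<^bsub>f,g\<^esub> = 1 + T\<close> of the theorem, but they do not mention the ambient group.  The pairs \<open>f\<close>,
  \<open>elt p\<close> allowed in \<open>G_elementary\<close> are those where \<open>f \<in> F k\<close> and \<open>elt p \<in> \<L>\<^sub>k\<close>.\<close>

locale unipotent_generators = standard_sequence R M Y l F
  for R :: "('r, 'x) ring_scheme" (structure) and M :: "('r, 'm, 'z) module_scheme"
    and Y :: "'m \<Rightarrow> 'm" and l :: nat and F :: "nat \<Rightarrow> 'm set" +
  fixes B :: "'r set" and G :: "('m \<Rightarrow> 'm) set"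
  assumes B_closed: "B \<subseteq> carrier R"
    and B_generates: "subgroup U (add_monoid R) \<Longrightarrow> B \<subseteq> U \<Longrightarrow> carrier R \<subseteq> U"
    and G_id: "idM \<in> G"
    and G_compose: "g \<in> G \<Longrightarrow> h \<in> G \<Longrightarrow> compose (carrier M) g h \<in> G"
    and G_inverse: "\<lbrakk>S \<in> Shift 1; S' \<in> Shift 1; uni S \<in> G;
      compose (carrier M) (uni S) (uni S') = idM; compose (carrier M) (uni S') (uni S) = idM\<rbrakk> \<Longrightarrow> uni S' \<in> G"
    and G_elementary: "\<lbrakk>k \<in> {1..l}; f \<in> F k; p \<in> idx; lev p \<le> k; 1 - int k \<le> wt p; b \<in> B; T \<in> EndY;
      T f = b \<odot>\<^bsub>M\<^esub> elt p; \<And>k' f'. k' \<in> {1..l} \<Longrightarrow> f' \<in> F k' \<Longrightarrow> f' \<noteq> f \<Longrightarrow> T f' = \<zero>\<^bsub>M\<^esub>\<rbrakk> \<Longrightarrow> uni T \<in> G"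
begin

text \<open>The endomorphisms in \<open>Shift n\<close> that are the leading term of an element of \<open>G\<close>, that is, those
  whose class modulo \<open>Shift (n + 1)\<close> is the class of some \<open>S\<close> with \<open>1 + S \<in> G\<close>.\<close>

definition Lead :: "int \<Rightarrow> ('m \<Rightarrow> 'm) set"
  where "Lead n = {T \<in> Shift n. \<exists>S\<in>Shift n. uni S \<in> G \<and> (\<lambda>m. S m \<ominus>\<^bsub>M\<^esub> T m) \<in> Shift (n + 1)}"

lemma Lead_of_uni:
  assumes "T \<in> Shift n" "uni T \<in> G"
  shows "T \<in> Lead n"
proof -
  have "(\<lambda>m. T m \<ominus>\<^bsub>M\<^esub> T m) \<in> Shift (n + 1)"
    using Shift_EndY[OF assms(1)] by (intro Shift_cong[OF Shift_zero]) (simp add: a_minus_def M.r_neg)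
  then show ?thesis using assms unfolding Lead_def by blast
qed

lemma Lead_cong:
  assumes "T \<in> Lead n" and eq: "\<And>m. m \<in> carrier M \<Longrightarrow> T' m = T m"
  shows "T' \<in> Lead n"
proof -
  obtain S where S: "T \<in> Shift n" "S \<in> Shift n" "uni S \<in> G" "(\<lambda>m. S m \<ominus>\<^bsub>M\<^esub> T m) \<in> Shift (n + 1)"
    using assms(1) unfolding Lead_def by auto
  have "T' \<in> Shift n" by (rule Shift_cong[OF S(1) eq])
  moreover have "(\<lambda>m. S m \<ominus>\<^bsub>M\<^esub> T' m) \<in> Shift (n + 1)"
    by (rule Shift_cong[OF S(4)]) (simp add: eq)
  ultimately show ?thesis using S(2,3) unfolding Lead_def by blast
qed

lemma Lead_zero: "(\<lambda>m. \<zero>\<^bsub>M\<^esub>) \<in> Lead n"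
  using Lead_of_uni[OF Shift_zero] uni_zero[of "\<lambda>m. \<zero>\<^bsub>M\<^esub>"] G_id by simp

text \<open>\<open>(1 + S) (1 + S') = 1 + (S + S') + S S'\<close>, and \<open>S S'\<close> is in \<open>Shift (n + 1)\<close>.\<close>

lemma Lead_add:
  assumes n: "1 \<le> n" and T: "T \<in> Lead n" "T' \<in> Lead n"
  shows "(\<lambda>m. T m \<oplus>\<^bsub>M\<^esub> T' m) \<in> Lead n"
proof -
  obtain S where S: "T \<in> Shift n" "S \<in> Shift n" "uni S \<in> G" "(\<lambda>m. S m \<ominus>\<^bsub>M\<^esub> T m) \<in> Shift (n + 1)"
    using T(1) unfolding Lead_def by auto
  obtain S' where S': "T' \<in> Shift n" "S' \<in> Shift n" "uni S' \<in> G" "(\<lambda>m. S' m \<ominus>\<^bsub>M\<^esub> T' m) \<in> Shift (n + 1)"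
    using T(2) unfolding Lead_def by auto
  note E = S(1,2)[THEN Shift_EndY] S'(1,2)[THEN Shift_EndY]
  have "uni (circ S S') \<in> G"
    using compose_uni[OF E(2,4)] G_compose[OF S(3) S'(3)] by simp
  moreover have "circ S S' \<in> Shift n" by (rule Shift_circ[OF S(2) S'(2) n])
  moreover have "(\<lambda>m. circ S S' m \<ominus>\<^bsub>M\<^esub> (T m \<oplus>\<^bsub>M\<^esub> T' m)) \<in> Shift (n + 1)"
  proof (rule Shift_cong)
    show "(\<lambda>m. ((S m \<ominus>\<^bsub>M\<^esub> T m) \<oplus>\<^bsub>M\<^esub> (S' m \<ominus>\<^bsub>M\<^esub> T' m)) \<oplus>\<^bsub>M\<^esub> S (S' m)) \<in> Shift (n + 1)"
      by (rule Shift_add[OF Shift_add[OF S(4) S'(4)] Shift_comp_Suc[OF n S(2) S'(2)]])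
    fix m assume "m \<in> carrier M"
    then show "circ S S' m \<ominus>\<^bsub>M\<^esub> (T m \<oplus>\<^bsub>M\<^esub> T' m)
        = ((S m \<ominus>\<^bsub>M\<^esub> T m) \<oplus>\<^bsub>M\<^esub> (S' m \<ominus>\<^bsub>M\<^esub> T' m)) \<oplus>\<^bsub>M\<^esub> S (S' m)"
      using E by (simp add: circ_def a_minus_def M.minus_add M.a_ac)
  qed
  ultimately show ?thesis
    using Shift_add[OF S(1) S'(1)] unfolding Lead_def by blast
qed

text \<open>If \<open>(1 + S') (1 + S) = 1\<close>, then \<open>S' + S = - S' S\<close>.  So \<open>1 + S \<mapsto> 1 + S'\<close> is negation modulo
  \<open>Shift (n + 1)\<close>.\<close>

lemma uni_inverse_diff:
  assumes n: "1 \<le> n" and S: "S \<in> Shift n" and S': "S' \<in> Shift n"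
    and inv: "compose (carrier M) (uni S') (uni S) = idM"
  shows "(\<lambda>m. S' m \<oplus>\<^bsub>M\<^esub> S m) \<in> Shift (n + 1)"
proof (rule Shift_cong)
  note E = Shift_EndY[OF S] Shift_EndY[OF S']
  show "(\<lambda>m. \<ominus>\<^bsub>M\<^esub> S' (S m)) \<in> Shift (n + 1)"
    by (rule Shift_uminus[OF Shift_comp_Suc[OF n S' S]])
  fix m assume m: "m \<in> carrier M"
  have "m \<oplus>\<^bsub>M\<^esub> circ S' S m = m"
    using fun_cong[OF inv[unfolded compose_uni[OF E(2,1)]], of m] m by (simp add: idM_def)
  moreover have c: "circ S' S m \<in> carrier M" using m E by (simp add: circ_def)
  ultimately have "circ S' S m = \<zero>\<^bsub>M\<^esub>"
    using m by simp
  then show "S' m \<oplus>\<^bsub>M\<^esub> S m = \<ominus>\<^bsub>M\<^esub> S' (S m)"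
    using m E unfolding circ_def by (simp add: M.minus_equality)
qed

lemma Lead_uminus:
  assumes n: "1 \<le> n" and T: "T \<in> Lead n"
  shows "(\<lambda>m. \<ominus>\<^bsub>M\<^esub> T m) \<in> Lead n"
proof -
  obtain S where S: "T \<in> Shift n" "S \<in> Shift n" "uni S \<in> G" "(\<lambda>m. S m \<ominus>\<^bsub>M\<^esub> T m) \<in> Shift (n + 1)"
    using T unfolding Lead_def by auto
  obtain S' where S': "S' \<in> Shift n" "compose (carrier M) (uni S) (uni S') = idM"
    "compose (carrier M) (uni S') (uni S) = idM"
    using uni_inverse[OF n S(2)] by auto
  note E = S(1,2)[THEN Shift_EndY] Shift_EndY[OF S'(1)]
  have "uni S' \<in> G"
    using G_inverse[OF _ _ S(3) S'(2,3)] Shift_antimono[OF n S(2)] Shift_antimono[OF n S'(1)] by simp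
  moreover have "(\<lambda>m. S' m \<ominus>\<^bsub>M\<^esub> (\<ominus>\<^bsub>M\<^esub> T m)) \<in> Shift (n + 1)"
  proof (rule Shift_cong)
    show "(\<lambda>m. (S' m \<oplus>\<^bsub>M\<^esub> S m) \<oplus>\<^bsub>M\<^esub> (\<ominus>\<^bsub>M\<^esub> (S m \<ominus>\<^bsub>M\<^esub> T m))) \<in> Shift (n + 1)"
      by (rule Shift_add[OF uni_inverse_diff[OF n S(2) S'(1,3)] Shift_uminus[OF S(4)]])
    fix m assume "m \<in> carrier M"
    then show "S' m \<ominus>\<^bsub>M\<^esub> (\<ominus>\<^bsub>M\<^esub> T m) = (S' m \<oplus>\<^bsub>M\<^esub> S m) \<oplus>\<^bsub>M\<^esub> (\<ominus>\<^bsub>M\<^esub> (S m \<ominus>\<^bsub>M\<^esub> T m))"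
      using E by (simp add: a_minus_def M.minus_add M.a_ac M.r_neg2 add_minus_cancel)
  qed
  ultimately show ?thesis
    using Shift_uminus[OF S(1)] S'(1) unfolding Lead_def by blast
qed

text \<open>The images of \<open>f\<close> under the members of \<open>Lead n\<close> that vanish at all other generators form an
  additive group \<open>V\<close>.  It contains \<open>b h\<close> for \<open>b \<in> B\<close> and every basis element \<open>h\<close> in
  \<open>Ker k \<inter> W (n - k)\<close>, hence \<open>r h\<close> for all \<open>r \<in> R\<close>, hence all of \<open>Ker k \<inter> W (n - k)\<close>.\<close>

lemma Lead_single:
  assumes n: "1 \<le> n" and kf: "k \<in> {1..l}" "f \<in> F k" and T: "T \<in> Shift n"
    and other: "\<And>k' f'. k' \<in> {1..l} \<Longrightarrow> f' \<in> F k' \<Longrightarrow> f' \<noteq> f \<Longrightarrow> T f' = \<zero>\<^bsub>M\<^esub>"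
  shows "T \<in> Lead n"
proof -
  define C where "C = {p \<in> idx. lev p \<le> k \<and> n - int k \<le> wt p}"
  define single where "single T g \<longleftrightarrow> T \<in> EndY \<and> T f = g
    \<and> (\<forall>k'\<in>{1..l}. \<forall>f'\<in>F k'. f' \<noteq> f \<longrightarrow> T f' = \<zero>\<^bsub>M\<^esub>)" for T g
  have single_ex: "\<exists>T. single T g" if "g \<in> Ker k" for g
    using EndY_single[OF kf that] unfolding single_def by blast
  have single_eq: "T m = T' m" if "single T g" "single T' g" "m \<in> carrier M" for T T' g m
    using that unfolding single_def by (intro EndY_eqI[of T T' m]) metis+
  define V where "V = {g \<in> Ker k. \<exists>T\<in>Lead n. single T g}"
  have V_all: "T \<in> Lead n" if g: "g \<in> V" and T: "single T g" for T g
  proof -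
    obtain T' where T': "T' \<in> Lead n" "single T' g" using g unfolding V_def by auto
    show ?thesis by (rule Lead_cong[OF T'(1) single_eq[OF T T'(2)]])
  qed
  have V_closed: "V \<subseteq> carrier M" unfolding V_def using Ker_closed by auto
  have V_zero: "\<zero>\<^bsub>M\<^esub> \<in> V"
  proof -
    have "single (\<lambda>m. \<zero>\<^bsub>M\<^esub>) \<zero>\<^bsub>M\<^esub>"
      unfolding single_def using EndY_zero by simp
    then show ?thesis
      using Lead_zero LinearCombinations.submodule.zero_closed[OF Ker_submodule] unfolding V_def by blast
  qed
  have V_add: "g \<oplus>\<^bsub>M\<^esub> h \<in> V" if gh: "g \<in> V" "h \<in> V" for g h
  proof -
    obtain T where T: "T \<in> Lead n" "single T g" using gh(1) unfolding V_def by auto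
    obtain T' where T': "T' \<in> Lead n" "single T' h" using gh(2) unfolding V_def by auto
    have "single (\<lambda>m. T m \<oplus>\<^bsub>M\<^esub> T' m) (g \<oplus>\<^bsub>M\<^esub> h)"
      using T(2) T'(2) EndY_add unfolding single_def by simp
    moreover have "g \<oplus>\<^bsub>M\<^esub> h \<in> Ker k"
      using gh LinearCombinations.submodule.m_closed[OF Ker_submodule] unfolding V_def by blast
    ultimately show ?thesis using Lead_add[OF n T(1) T'(1)] unfolding V_def by blast
  qed
  have V_uminus: "\<ominus>\<^bsub>M\<^esub> g \<in> V" if g: "g \<in> V" for g
  proof -
    obtain T where T: "T \<in> Lead n" "single T g" using g unfolding V_def by auto
    have "single (\<lambda>m. \<ominus>\<^bsub>M\<^esub> T m) (\<ominus>\<^bsub>M\<^esub> g)"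
      using T(2) EndY_uminus unfolding single_def by simp
    moreover have "\<ominus>\<^bsub>M\<^esub> g \<in> Ker k"
      using g submodule_uminus[OF Ker_submodule] unfolding V_def by blast
    ultimately show ?thesis using Lead_uminus[OF n T(1)] unfolding V_def by blast
  qed
  have V_elt: "r \<odot>\<^bsub>M\<^esub> elt p \<in> V" if p: "p \<in> C" and r: "r \<in> carrier R" for p r
  proof -
    have pC: "p \<in> idx" "lev p \<le> k" "n - int k \<le> wt p" using p unfolding C_def by auto
    have pK: "elt p \<in> Ker k" using Ker_mono[OF pC(2) elt_Ker[OF pC(1)]] .
    have pc: "elt p \<in> carrier M" using pC(1) by (rule elt_closed)
    define U where "U = {r \<in> carrier R. r \<odot>\<^bsub>M\<^esub> elt p \<in> V}"
    have "b \<in> U" if b: "b \<in> B" for b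
    proof -
      have bR: "b \<in> carrier R" using b B_closed by auto
      have bK: "b \<odot>\<^bsub>M\<^esub> elt p \<in> Ker k"
        using LinearCombinations.submodule.smult_closed[OF Ker_submodule bR pK] .
      obtain T where T: "single T (b \<odot>\<^bsub>M\<^esub> elt p)" using single_ex[OF bK] by auto
      have TE: "T \<in> EndY" "T f = b \<odot>\<^bsub>M\<^esub> elt p"
        and T0: "\<And>k' f'. k' \<in> {1..l} \<Longrightarrow> f' \<in> F k' \<Longrightarrow> f' \<noteq> f \<Longrightarrow> T f' = \<zero>\<^bsub>M\<^esub>"
        using T unfolding single_def by auto
      have "T \<in> Shift n"
      proof (rule ShiftI[OF TE(1)])
        fix k' f' assume kf': "k' \<in> {1..l}" "f' \<in> F k'"
        show "T f' \<in> W (n - int k')"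
        proof (cases "f' = f")
          case True
          then have "k' = k" using F_disjoint kf kf' by blast
          moreover have "b \<odot>\<^bsub>M\<^esub> elt p \<in> W (n - int k)"
            using elt_W[OF pC(1,3)] bR LinearCombinations.submodule.smult_closed[OF W_submodule] by blast
          ultimately show ?thesis using TE(2) True by simp
        next
          case False
          then show ?thesis using T0 kf' W_zero by simp
        qed
      qed
      moreover have "uni T \<in> G"
        using G_elementary[OF kf pC(1,2) _ b TE T0] n pC(3) by auto
      ultimately have "T \<in> Lead n" by (rule Lead_of_uni)
      then show ?thesis using T bK bR unfolding U_def V_def by auto
    qed
    moreover have "subgroup U (add_monoid R)"
    proof (rule R.add.subgroupI)
      show "U \<noteq> {}" using V_zero pc unfolding U_def by (auto intro!: exI[of _ \<zero>])
      show "\<ominus> a \<in> U" if "a \<in> U" for a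
        using that V_uminus pc unfolding U_def by (simp add: smult_l_minus)
      show "a \<oplus> b \<in> U" if "a \<in> U" "b \<in> U" for a b
        using that V_add pc unfolding U_def by (simp add: smult_l_distr)
    qed (auto simp: U_def)
    ultimately have "carrier R \<subseteq> U" by (intro B_generates) auto
    then show ?thesis using r unfolding U_def by auto
  qed
  have C_idx: "C \<subseteq> idx" by (auto simp: C_def)
  have "T f \<in> V"
  proof -
    have "T f \<in> Ker k"
      using EndY_Ker[OF Shift_EndY[OF T]] kf F_sub by blast
    moreover have "T f \<in> W (n - int k)" by (rule Shift_F[OF T kf])
    ultimately have "T f \<in> span (elt ` C)"
      unfolding C_def using kf(1) by (intro Ker_Int_W) auto
    then obtain a where a: "a \<in> idx \<rightarrow> carrier R" "comb a = T f" "\<forall>p\<in>idx - C. a p = \<zero>"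
      using span_comb[OF C_idx, of "T f"] by (elim meta_impE bexE conjE)
    have terms: "a p \<odot>\<^bsub>M\<^esub> elt p \<in> V" if p: "p \<in> idx" for p
    proof (cases "p \<in> C")
      case True
      then show ?thesis using V_elt funcset_mem[OF a(1) p] by blast
    next
      case False
      then show ?thesis using a(3) p V_zero elt_closed[OF p] by simp
    qed
    have "(\<Oplus>\<^bsub>M\<^esub>p\<in>A. a p \<odot>\<^bsub>M\<^esub> elt p) \<in> V" if "finite A" "A \<subseteq> idx" for A
      using that
    proof (induction A rule: finite_induct)
      case (insert p A)
      have "(\<Oplus>\<^bsub>M\<^esub>p\<in>insert p A. a p \<odot>\<^bsub>M\<^esub> elt p) = a p \<odot>\<^bsub>M\<^esub> elt p \<oplus>\<^bsub>M\<^esub> (\<Oplus>\<^bsub>M\<^esub>p\<in>A. a p \<odot>\<^bsub>M\<^esub> elt p)"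
      proof (rule finsum_insert[OF insert.hyps])
        show "(\<lambda>p. a p \<odot>\<^bsub>M\<^esub> elt p) \<in> A \<rightarrow> carrier M" "a p \<odot>\<^bsub>M\<^esub> elt p \<in> carrier M"
          using insert.prems V_closed terms by blast+
      qed
      then show ?case using insert V_add terms by simp
    qed (simp add: V_zero)
    from this[OF finite_index subset_refl] show ?thesis
      using a(2) unfolding comb_def by simp
  qed
  moreover have "single T (T f)"
    unfolding single_def using Shift_EndY[OF T] other by blast
  ultimately show ?thesis by (rule V_all)
qed

text \<open>Induction on a set of generators outside of which \<open>T\<close> vanishes.\<close>

lemma Lead_all:
  assumes n: "1 \<le> n" and T: "T \<in> Shift n"
  shows "T \<in> Lead n"
proof -
  define E where "E = (\<Union>k\<in>{1..l}. F k)"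
  have "E = (fst \<circ> snd) ` {p \<in> idx. snd (snd p) = 0}"
    unfolding E_def by (force simp: idx_iff image_iff)
  then have fin: "finite E" using finite_index by simp
  have "T \<in> Lead n" if "D \<subseteq> E" "T \<in> Shift n" "\<And>f. f \<in> E - D \<Longrightarrow> T f = \<zero>\<^bsub>M\<^esub>" for D T
    using finite_subset[OF that(1) fin] that
  proof (induction D arbitrary: T rule: finite_induct)
    case empty
    have "T m = \<zero>\<^bsub>M\<^esub>" if "m \<in> carrier M" for m
    proof (rule EndY_eqI[OF Shift_EndY[OF empty.prems(2)] EndY_zero _ that])
      fix k f assume "k \<in> {1..l}" "f \<in> F k"
      then have "f \<in> E - {}" by (auto simp: E_def)
      then show "T f = \<zero>\<^bsub>M\<^esub>" by (rule empty.prems(3))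
    qed
    then show ?case by (rule Lead_cong[OF Lead_zero])
  next
    case (insert f D)
    obtain k where kf: "k \<in> {1..l}" "f \<in> F k" using insert.prems(1) by (auto simp: E_def)
    have TE: "T \<in> EndY" by (rule Shift_EndY[OF insert.prems(2)])
    have "T f \<in> Ker k" using EndY_Ker[OF TE] kf F_sub by blast
    then obtain S where S: "S \<in> EndY" "S f = T f"
      and S0: "\<And>k' f'. k' \<in> {1..l} \<Longrightarrow> f' \<in> F k' \<Longrightarrow> f' \<noteq> f \<Longrightarrow> S f' = \<zero>\<^bsub>M\<^esub>"
      using EndY_single[OF kf] by metis
    have S_Shift: "S \<in> Shift n"
    proof (rule ShiftI[OF S(1)])
      fix k' f' assume kf': "k' \<in> {1..l}" "f' \<in> F k'"
      show "S f' \<in> W (n - int k')"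
        using Shift_F[OF insert.prems(2) kf'] S(2) S0[OF kf'] W_zero by (cases "f' = f") auto
    qed
    have S_Lead: "S \<in> Lead n" by (rule Lead_single[OF n kf S_Shift S0])
    have D_Lead: "(\<lambda>m. T m \<oplus>\<^bsub>M\<^esub> (\<ominus>\<^bsub>M\<^esub> S m)) \<in> Lead n"
    proof (rule insert.IH)
      show "D \<subseteq> E" using insert.prems(1) by simp
      show "(\<lambda>m. T m \<oplus>\<^bsub>M\<^esub> (\<ominus>\<^bsub>M\<^esub> S m)) \<in> Shift n"
        by (rule Shift_add[OF insert.prems(2) Shift_uminus[OF S_Shift]])
      fix f' assume f': "f' \<in> E - D"
      then obtain k' where kf': "k' \<in> {1..l}" "f' \<in> F k'" by (auto simp: E_def)
      show "T f' \<oplus>\<^bsub>M\<^esub> (\<ominus>\<^bsub>M\<^esub> S f') = \<zero>\<^bsub>M\<^esub>"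
        using S(2) S0[OF kf'] insert.prems(3)[of f'] f' F_closed[OF kf'] TE
        by (cases "f' = f") (auto simp: M.r_neg)
    qed
    show ?case
      by (rule Lead_cong[OF Lead_add[OF n S_Lead D_Lead]])
        (use TE S(1) in \<open>simp add: add_minus_cancel\<close>)
  qed
  from this[OF subset_refl T] show ?thesis by simp
qed

text \<open>If \<open>1 + S \<in> G\<close> has the same leading term as \<open>1 + T\<close>, then \<open>(1 + S)\<^sup>-\<^sup>1 (1 + T)\<close> is in
  \<open>1 + Shift (n + 1)\<close>, so it is in \<open>G\<close> by induction.\<close>

theorem Shift_generated:
  assumes "1 \<le> n" "T \<in> Shift n"
  shows "uni T \<in> G"
  using assms
proof (induction "nat (2 * int l - n)" arbitrary: n T rule: less_induct)
  case less
  note n = less.prems(1) and T = less.prems(2)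
  show ?case
  proof (cases "2 * int l \<le> n")
    case True
    then show ?thesis using uni_zero[of T] Shift_high[OF T] G_id by simp
  next
    case False
    obtain S where S: "S \<in> Shift n" "uni S \<in> G" "(\<lambda>m. S m \<ominus>\<^bsub>M\<^esub> T m) \<in> Shift (n + 1)"
      using Lead_all[OF n T] unfolding Lead_def by auto
    obtain S' where S': "S' \<in> Shift n" "compose (carrier M) (uni S) (uni S') = idM"
      "compose (carrier M) (uni S') (uni S) = idM"
      using uni_inverse[OF n S(1)] by auto
    note E = Shift_EndY[OF T] Shift_EndY[OF S(1)] Shift_EndY[OF S'(1)]
    have "circ S' T \<in> Shift (n + 1)"
    proof (rule Shift_cong)
      show "(\<lambda>m. ((S' m \<oplus>\<^bsub>M\<^esub> S m) \<oplus>\<^bsub>M\<^esub> (\<ominus>\<^bsub>M\<^esub> (S m \<ominus>\<^bsub>M\<^esub> T m))) \<oplus>\<^bsub>M\<^esub> S' (T m)) \<in> Shift (n + 1)"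
        by (rule Shift_add[OF Shift_add[OF uni_inverse_diff[OF n S(1) S'(1,3)] Shift_uminus[OF S(3)]]
              Shift_comp_Suc[OF n S'(1) T]])
      fix m assume "m \<in> carrier M"
      then show "circ S' T m = ((S' m \<oplus>\<^bsub>M\<^esub> S m) \<oplus>\<^bsub>M\<^esub> (\<ominus>\<^bsub>M\<^esub> (S m \<ominus>\<^bsub>M\<^esub> T m))) \<oplus>\<^bsub>M\<^esub> S' (T m)"
        using E by (simp add: circ_def a_minus_def M.minus_add M.a_ac M.r_neg2 add_minus_cancel)
    qed
    then have "uni (circ S' T) \<in> G"
      using less.hyps[of "n + 1"] n False by simp
    then have "compose (carrier M) (uni S) (compose (carrier M) (uni S') (uni T)) \<in> G"
      using G_compose[OF S(2)] compose_uni[OF E(3,1)] by simp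
    then show ?thesis
      using compose_uni_assoc[OF E(2,3,1)] S'(2) E by simp
  qed
qed

end

section \<open>Truncated polynomial rings\<close>

lemma trunc_hom:
  assumes "cring R"
  shows "ring_hom_cring (UP R) (trunc_poly R l) (\<lambda>p. trunc_ideal R l +>\<^bsub>UP R\<^esub> p)"
proof -
  interpret UP_cring R "UP R" by (rule UP_cring.intro) (rule assms)
  have "ideal (trunc_ideal R l) (UP R)"
    unfolding trunc_ideal_def by (rule P.cgenideal_ideal) simp
  from ideal.rcos_ring_hom_cring[OF this P.is_cring] show ?thesis
    unfolding trunc_poly_def .
qed

lemma trunc_const_hom:
  assumes "cring R"
  shows "trunc_const R l \<in> ring_hom R (trunc_poly R l)"
proof -
  interpret UP_cring R "UP R" by (rule UP_cring.intro) (rule assms)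
  interpret q: ring_hom_cring "UP R" "trunc_poly R l" "\<lambda>p. trunc_ideal R l +>\<^bsub>UP R\<^esub> p"
    by (rule trunc_hom[OF assms])
  have "(\<lambda>p. trunc_ideal R l +>\<^bsub>UP R\<^esub> p) \<circ> (\<lambda>c. monom (UP R) c 0) \<in> ring_hom R (trunc_poly R l)"
    by (rule ring_hom_trans[OF const_ring_hom q.homh])
  moreover have "trunc_const R l = (\<lambda>p. trunc_ideal R l +>\<^bsub>UP R\<^esub> p) \<circ> (\<lambda>c. monom (UP R) c 0)"
    by (rule ext) (simp add: trunc_const_def)
  ultimately show ?thesis by simp
qed

lemma trunc_var_pow:
  assumes "cring R"
  shows "trunc_var R l [^]\<^bsub>trunc_poly R l\<^esub> i = trunc_ideal R l +>\<^bsub>UP R\<^esub> monom (UP R) \<one>\<^bsub>R\<^esub> i"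
proof -
  interpret UP_cring R "UP R" by (rule UP_cring.intro) (rule assms)
  interpret q: ring_hom_cring "UP R" "trunc_poly R l" "\<lambda>p. trunc_ideal R l +>\<^bsub>UP R\<^esub> p"
    by (rule trunc_hom[OF assms])
  have "trunc_var R l [^]\<^bsub>trunc_poly R l\<^esub> i
      = trunc_ideal R l +>\<^bsub>UP R\<^esub> (monom (UP R) \<one>\<^bsub>R\<^esub> 1 [^]\<^bsub>UP R\<^esub> i)"
    unfolding trunc_var_def by (rule q.hom_pow[symmetric]) simp
  then show ?thesis by (simp add: monom_pow)
qed

lemma trunc_var_closed:
  assumes "cring R"
  shows "trunc_var R l \<in> carrier (trunc_poly R l)"
proof -
  interpret UP_cring R "UP R" by (rule UP_cring.intro) (rule assms)
  interpret q: ring_hom_cring "UP R" "trunc_poly R l" "\<lambda>p. trunc_ideal R l +>\<^bsub>UP R\<^esub> p"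
    by (rule trunc_hom[OF assms])
  show ?thesis unfolding trunc_var_def by (rule q.hom_closed) simp
qed

lemma trunc_var_nilpotent:
  assumes "cring R"
  shows "trunc_var R l [^]\<^bsub>trunc_poly R l\<^esub> l = \<zero>\<^bsub>trunc_poly R l\<^esub>"
proof -
  interpret UP_cring R "UP R" by (rule UP_cring.intro) (rule assms)
  have I: "ideal (trunc_ideal R l) (UP R)"
    unfolding trunc_ideal_def by (rule P.cgenideal_ideal) simp
  have "monom (UP R) \<one>\<^bsub>R\<^esub> l \<in> trunc_ideal R l"
    unfolding trunc_ideal_def by (rule P.cgenideal_self) simp
  then have "trunc_ideal R l +>\<^bsub>UP R\<^esub> monom (UP R) \<one>\<^bsub>R\<^esub> l = trunc_ideal R l"
    using ideal.axioms(1)[OF I] by (intro P.a_coset_join2) (auto simp: additive_subgroup_def)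
  then show ?thesis
    unfolding trunc_var_pow[OF assms] by (simp add: trunc_poly_def FactRing_def)
qed

text \<open>Every residue class is a sum of monomials; so a map that commutes with the constants and with
  \<open>y\<close> commutes with all of \<open>P\<^sub>l(R)\<close>.\<close>

lemma trunc_poly_induct [consumes 2, case_names monomial add]:
  assumes R: "cring R" and z: "z \<in> carrier (trunc_poly R l)"
    and monomial: "\<And>c i. c \<in> carrier R \<Longrightarrow>
      Q (trunc_const R l c \<otimes>\<^bsub>trunc_poly R l\<^esub> (trunc_var R l [^]\<^bsub>trunc_poly R l\<^esub> (i::nat)))"
    and add: "\<And>x y. x \<in> carrier (trunc_poly R l) \<Longrightarrow> y \<in> carrier (trunc_poly R l)
      \<Longrightarrow> Q x \<Longrightarrow> Q y \<Longrightarrow> Q (x \<oplus>\<^bsub>trunc_poly R l\<^esub> y)"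
  shows "Q z"
proof -
  interpret UP_cring R "UP R" by (rule UP_cring.intro) (rule R)
  let ?q = "\<lambda>p. trunc_ideal R l +>\<^bsub>UP R\<^esub> p"
  interpret q: ring_hom_cring "UP R" "trunc_poly R l" ?q
    by (rule trunc_hom[OF R])
  have "carrier (trunc_poly R l) = ?q ` carrier (UP R)"
    unfolding trunc_poly_def FactRing_def A_RCOSETS_def' by auto
  then obtain p where p: "p \<in> carrier (UP R)" "z = ?q p" using z by auto
  have mon: "Q (?q (monom (UP R) c i))" if c: "c \<in> carrier R" for c i
  proof -
    have "monom (UP R) c i = monom (UP R) c 0 \<otimes>\<^bsub>UP R\<^esub> monom (UP R) \<one>\<^bsub>R\<^esub> i"
      using monom_mult[OF c R.one_closed, of 0 i] c by simp
    then have "?q (monom (UP R) c i) = ?q (monom (UP R) c 0) \<otimes>\<^bsub>trunc_poly R l\<^esub> ?q (monom (UP R) \<one>\<^bsub>R\<^esub> i)"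
      using c q.hom_mult by simp
    then show ?thesis
      using monomial[OF c, of i] unfolding trunc_var_pow[OF R] trunc_const_def by simp
  qed
  have "Q (?q (\<Oplus>\<^bsub>UP R\<^esub>i\<in>{..n}. monom (UP R) (coeff (UP R) p i) i))" for n
  proof (induction n)
    case 0
    then show ?case using mon[of "coeff (UP R) p 0" 0] p(1) by simp
  next
    case (Suc n)
    have c: "coeff (UP R) p i \<in> carrier R" for i using p(1) by (rule coeff_closed)
    have "(\<Oplus>\<^bsub>UP R\<^esub>i\<in>{..Suc n}. monom (UP R) (coeff (UP R) p i) i)
        = monom (UP R) (coeff (UP R) p (Suc n)) (Suc n)
          \<oplus>\<^bsub>UP R\<^esub> (\<Oplus>\<^bsub>UP R\<^esub>i\<in>{..n}. monom (UP R) (coeff (UP R) p i) i)"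
      using c by (intro P.finsum_Suc) auto
    moreover have "(\<Oplus>\<^bsub>UP R\<^esub>i\<in>{..n}. monom (UP R) (coeff (UP R) p i) i) \<in> carrier (UP R)"
      using c by (intro P.finsum_closed) auto
    ultimately show ?case
      using add[OF _ _ mon[OF c] Suc.IH] c q.hom_add q.hom_closed by simp
  qed
  from this[of "UnivPoly.deg R p"] show ?thesis using up_repr[OF p(1)] p(2) by simp
qed

section \<open>Modules over truncated polynomial rings\<close>

locale truncated_module =
  fixes R :: "('k, 'x) ring_scheme" and l :: nat
    and M :: "((nat \<Rightarrow> 'k) set, 'm, 'z) module_scheme"
  assumes R_cring: "cring R" and M_module: "Module.module (trunc_poly R l) M"
begin

abbreviation PR :: "(nat \<Rightarrow> 'k) set ring" where "PR \<equiv> trunc_poly R l"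

abbreviation N :: "('k, 'm) module" where "N \<equiv> restrict_scalars R l M"

abbreviation Y :: "'m \<Rightarrow> 'm" where "Y \<equiv> act_y R l M 1"

sublocale M: Module.module PR M by (rule M_module)

lemma N_simps [simp]:
  "carrier N = carrier M" "add N = add M" "zero N = zero M"
  "smult N c m = trunc_const R l c \<odot>\<^bsub>M\<^esub> m"
  by (simp_all add: restrict_scalars_def act_const_def)

lemma const_closed: "c \<in> carrier R \<Longrightarrow> trunc_const R l c \<in> carrier PR"
  using trunc_const_hom[OF R_cring] by (rule ring_hom_closed)

lemma var_closed: "trunc_var R l \<in> carrier PR"
  by (rule trunc_var_closed[OF R_cring])

lemma N_module: "Module.module R N"
proof (rule moduleI[OF R_cring])
  show "abelian_group N"
    by (rule abelian_groupI) (auto simp: M.M.a_ac intro: M.M.l_neg bexI[of _ "\<ominus>\<^bsub>M\<^esub> _"])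
  note h = trunc_const_hom[OF R_cring, of l]
  show "a \<odot>\<^bsub>N\<^esub> x \<in> carrier N" if "a \<in> carrier R" "x \<in> carrier N" for a x
    using that const_closed by simp
  show "(a \<oplus>\<^bsub>R\<^esub> b) \<odot>\<^bsub>N\<^esub> x = (a \<odot>\<^bsub>N\<^esub> x) \<oplus>\<^bsub>N\<^esub> (b \<odot>\<^bsub>N\<^esub> x)"
    if "a \<in> carrier R" "b \<in> carrier R" "x \<in> carrier N" for a b x
    using that const_closed by (simp add: ring_hom_add[OF h] M.smult_l_distr)
  show "a \<odot>\<^bsub>N\<^esub> (x \<oplus>\<^bsub>N\<^esub> y) = (a \<odot>\<^bsub>N\<^esub> x) \<oplus>\<^bsub>N\<^esub> (a \<odot>\<^bsub>N\<^esub> y)"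
    if "a \<in> carrier R" "x \<in> carrier N" "y \<in> carrier N" for a x y
    using that const_closed by (simp add: M.smult_r_distr)
  show "(a \<otimes>\<^bsub>R\<^esub> b) \<odot>\<^bsub>N\<^esub> x = a \<odot>\<^bsub>N\<^esub> (b \<odot>\<^bsub>N\<^esub> x)"
    if "a \<in> carrier R" "b \<in> carrier R" "x \<in> carrier N" for a b x
    using that const_closed by (simp add: ring_hom_mult[OF h] M.smult_assoc1)
  show "\<one>\<^bsub>R\<^esub> \<odot>\<^bsub>N\<^esub> x = x" if "x \<in> carrier N" for x
    using that by (simp add: ring_hom_one[OF h])
qed

lemma Y_eq: "Y m = trunc_var R l \<odot>\<^bsub>M\<^esub> m" if "m \<in> carrier M"
  using var_closed by (simp add: act_y_def)

lemma Y_pow_smult: "m \<in> carrier M \<Longrightarrow> (Y ^^ i) m = (trunc_var R l [^]\<^bsub>PR\<^esub> i) \<odot>\<^bsub>M\<^esub> m"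
proof (induction i)
  case (Suc i)
  have v: "trunc_var R l [^]\<^bsub>PR\<^esub> i \<in> carrier PR" using var_closed by simp
  have "(Y ^^ Suc i) m = Y ((trunc_var R l [^]\<^bsub>PR\<^esub> i) \<odot>\<^bsub>M\<^esub> m)"
    using Suc by simp
  also have "\<dots> = trunc_var R l \<odot>\<^bsub>M\<^esub> ((trunc_var R l [^]\<^bsub>PR\<^esub> i) \<odot>\<^bsub>M\<^esub> m)"
    using Suc.prems v by (intro Y_eq) simp
  also have "\<dots> = (trunc_var R l [^]\<^bsub>PR\<^esub> Suc i) \<odot>\<^bsub>M\<^esub> m"
    using Suc.prems v var_closed by (simp add: M.smult_assoc1[symmetric] M.R.m_comm)
  finally show ?case .
qed simp

lemma Y_pow: "m \<in> carrier M \<Longrightarrow> (Y ^^ i) m = act_y R l M i m"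
  unfolding Y_pow_smult by (simp add: act_y_def)

lemma nilpotent_module: "nilpotent_module R N Y l"
proof (intro nilpotent_module.intro nilpotent_module_axioms.intro N_module)
  interpret N: Module.module R N by (rule N_module)
  show "Y \<in> LinearCombinations.module_hom R N N"
  proof (rule N.EndI)
    fix r x assume rx: "r \<in> carrier R" "x \<in> carrier N"
    then show "Y (r \<odot>\<^bsub>N\<^esub> x) = r \<odot>\<^bsub>N\<^esub> Y x"
      using const_closed var_closed Y_eq by (simp add: M.smult_assoc1[symmetric] M.R.m_comm)
  qed (use var_closed Y_eq in \<open>simp_all add: M.smult_r_distr\<close>)
  show "(Y ^^ l) m = \<zero>\<^bsub>N\<^esub>" if "m \<in> carrier N" for m
    using that Y_pow[of m l] by (simp add: act_y_def trunc_var_nilpotent[OF R_cring])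
qed

text \<open>So the endomorphisms of \<open>M\<close> over \<open>P\<^sub>l(R)\<close> are the members of \<open>EndY\<close>.\<close>

lemma hom_iff_commutes:
  "T \<in> LinearCombinations.module_hom PR M M \<longleftrightarrow>
    T \<in> LinearCombinations.module_hom R N N \<and> (\<forall>m\<in>carrier M. T (Y m) = Y (T m))"
proof
  assume T: "T \<in> LinearCombinations.module_hom PR M M"
  show "T \<in> LinearCombinations.module_hom R N N \<and> (\<forall>m\<in>carrier M. T (Y m) = Y (T m))"
  proof (rule conjI, goal_cases)
    case 1
    show ?case
      using T const_closed unfolding LinearCombinations.module_hom_def by auto
  next
    case 2
    have closed: "T m \<in> carrier M" if "m \<in> carrier M" for m
      using T that unfolding LinearCombinations.module_hom_def by auto
    have "T (Y m) = Y (T m)" if m: "m \<in> carrier M" for m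
      using T m closed[OF m] var_closed unfolding Y_eq[OF m] Y_eq[OF closed[OF m]]
      unfolding LinearCombinations.module_hom_def by blast
    then show ?case by (rule ballI)
  qed
next
  assume T: "T \<in> LinearCombinations.module_hom R N N \<and> (\<forall>m\<in>carrier M. T (Y m) = Y (T m))"
  have closed: "T m \<in> carrier M" if "m \<in> carrier M" for m
    using T that unfolding LinearCombinations.module_hom_def by auto
  have add: "T (m \<oplus>\<^bsub>M\<^esub> n) = T m \<oplus>\<^bsub>M\<^esub> T n" if "m \<in> carrier M" "n \<in> carrier M" for m n
    using T that unfolding LinearCombinations.module_hom_def by auto
  have const: "T (trunc_const R l c \<odot>\<^bsub>M\<^esub> m) = trunc_const R l c \<odot>\<^bsub>M\<^esub> T m"
    if "c \<in> carrier R" "m \<in> carrier M" for c m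
    using T that unfolding LinearCombinations.module_hom_def by auto
  have pow: "T (act_y R l M i m) = act_y R l M i (T m)" if m: "m \<in> carrier M" for i m
  proof -
    have "(Y ^^ i) m \<in> carrier M \<and> T ((Y ^^ i) m) = (Y ^^ i) (T m)"
    proof (induction i)
      case (Suc i)
      then show ?case using T Y_eq[of "(Y ^^ i) m"] var_closed by auto
    qed (use m in simp)
    then show ?thesis using Y_pow m closed by simp
  qed
  have "T (z \<odot>\<^bsub>M\<^esub> m) = z \<odot>\<^bsub>M\<^esub> T m" if z: "z \<in> carrier PR" and m: "m \<in> carrier M" for z m
    using R_cring z
  proof (induction rule: trunc_poly_induct)
    case (monomial c i)
    have v: "trunc_var R l [^]\<^bsub>PR\<^esub> i \<in> carrier PR" using var_closed by simp
    show ?case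
      using const[OF monomial, of "(trunc_var R l [^]\<^bsub>PR\<^esub> i) \<odot>\<^bsub>M\<^esub> m"] pow[OF m, of i]
        v const_closed[OF monomial] m closed
      by (simp add: M.smult_assoc1 act_y_def)
  next
    case (add x y)
    then show ?case using m closed \<open>\<And>m n. _ \<Longrightarrow> _ \<Longrightarrow> T (m \<oplus>\<^bsub>M\<^esub> n) = _\<close>
      by (simp add: M.smult_l_distr)
  qed
  then show "T \<in> LinearCombinations.module_hom PR M M"
    using closed add unfolding LinearCombinations.module_hom_def by auto
qed

sublocale Nil: nilpotent_module R N Y l by (rule nilpotent_module)

lemma K_sub_eq: "K_sub R l M i = Nil.Ker i"
  unfolding K_sub_def Nil.Ker_def using Y_pow by auto

lemma L_sub_eq: "L_sub R l M i = Nil.Lay i"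
  unfolding L_sub_def Nil.Lay_def K_sub_eq set_add_def set_mult_def by auto

end

section \<open>Bases of quotient modules\<close>

context Module.module
begin

text \<open>For submodules \<open>U \<subseteq> S\<close> of \<open>M\<close>, the aim is to express that a set \<open>F \<subseteq> S\<close> maps to a
  basis of \<open>S / U\<close> without mentioning cosets.\<close>

context
  fixes S U :: "'c set"
  assumes S: "LinearCombinations.submodule R S M" and U: "LinearCombinations.submodule R U M"
    and US: "U \<subseteq> S"
begin

lemma U_abelian_subgroup: "abelian_subgroup U M"
proof (rule abelian_subgroupI3)
  show "additive_subgroup U M"
  proof (rule additive_subgroup.intro, rule M.add.subgroupI)
    show "U \<subseteq> carrier M" "U \<noteq> {}"
      using LinearCombinations.submodule.subset[OF U] LinearCombinations.submodule.zero_closed[OF U] by auto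
  qed (use submodule_uminus[OF U] LinearCombinations.submodule.m_closed[OF U] in auto)
qed (rule M.abelian_group_axioms)

interpretation U: abelian_subgroup U M by (rule U_abelian_subgroup)

lemma S_closed: "x \<in> S \<Longrightarrow> x \<in> carrier M"
  using LinearCombinations.submodule.subset[OF S] by auto

lemma coset_eq_iff:
  assumes "x \<in> carrier M" "y \<in> carrier M"
  shows "U +>\<^bsub>M\<^esub> x = U +>\<^bsub>M\<^esub> y \<longleftrightarrow> x \<ominus>\<^bsub>M\<^esub> y \<in> U"
proof
  assume "U +>\<^bsub>M\<^esub> x = U +>\<^bsub>M\<^esub> y"
  then have "x \<in> U +>\<^bsub>M\<^esub> y" using U.a_rcos_self[OF assms(1)] by simp
  then show "x \<ominus>\<^bsub>M\<^esub> y \<in> U"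
    using U.a_rcos_module[OF assms(2,1)] by (simp add: a_minus_def)
next
  assume "x \<ominus>\<^bsub>M\<^esub> y \<in> U"
  then have "x \<in> U +>\<^bsub>M\<^esub> y"
    using U.a_rcos_module[OF assms(2,1)] by (simp add: a_minus_def)
  then show "U +>\<^bsub>M\<^esub> x = U +>\<^bsub>M\<^esub> y"
    using U.a_repr_independence'[OF _ assms(2)] by simp
qed

abbreviation Q :: "('a, 'c set) module" where "Q \<equiv> quotient_module M S U"

lemma quotient_add: "x \<in> carrier M \<Longrightarrow> y \<in> carrier M \<Longrightarrow>
    (U +>\<^bsub>M\<^esub> x) \<oplus>\<^bsub>Q\<^esub> (U +>\<^bsub>M\<^esub> y) = U +>\<^bsub>M\<^esub> (x \<oplus>\<^bsub>M\<^esub> y)"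
  by (simp add: quotient_module_def U.a_rcos_sum)

lemma quotient_zero: "\<zero>\<^bsub>Q\<^esub> = U +>\<^bsub>M\<^esub> \<zero>\<^bsub>M\<^esub>"
  using U.a_subset by (simp add: quotient_module_def)

lemma quotient_smult:
  assumes c: "c \<in> carrier R" and x: "x \<in> carrier M"
  shows "c \<odot>\<^bsub>Q\<^esub> (U +>\<^bsub>M\<^esub> x) = U +>\<^bsub>M\<^esub> (c \<odot>\<^bsub>M\<^esub> x)"
proof -
  have const: "U +>\<^bsub>M\<^esub> (c \<odot>\<^bsub>M\<^esub> y) = U +>\<^bsub>M\<^esub> (c \<odot>\<^bsub>M\<^esub> x)" if y: "y \<in> U +>\<^bsub>M\<^esub> x" for y
  proof -
    have yc: "y \<in> carrier M" using U.a_elemrcos_carrier[OF x y] .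
    have "y \<ominus>\<^bsub>M\<^esub> x \<in> U"
      using U.a_rcos_module[OF x yc] y by (simp add: a_minus_def)
    then have "c \<odot>\<^bsub>M\<^esub> (y \<ominus>\<^bsub>M\<^esub> x) \<in> U"
      by (rule LinearCombinations.submodule.smult_closed[OF U c])
    then have "c \<odot>\<^bsub>M\<^esub> y \<ominus>\<^bsub>M\<^esub> c \<odot>\<^bsub>M\<^esub> x \<in> U"
      using c x yc by (simp add: a_minus_def smult_r_distr smult_r_minus)
    then show ?thesis using coset_eq_iff c x yc by simp
  qed
  have "c \<odot>\<^bsub>Q\<^esub> (U +>\<^bsub>M\<^esub> x) = (\<Union>y\<in>U +>\<^bsub>M\<^esub> x. U +>\<^bsub>M\<^esub> (c \<odot>\<^bsub>M\<^esub> y))"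
    by (simp add: quotient_module_def)
  also have "\<dots> = (\<Union>y\<in>U +>\<^bsub>M\<^esub> x. U +>\<^bsub>M\<^esub> (c \<odot>\<^bsub>M\<^esub> x))"
    by (rule SUP_cong[OF refl const])
  also have "\<dots> = U +>\<^bsub>M\<^esub> (c \<odot>\<^bsub>M\<^esub> x)"
    using U.a_rcos_self[OF x] by blast
  finally show ?thesis .
qed

lemma quotient_carrier: "carrier Q = (\<lambda>m. U +>\<^bsub>M\<^esub> m) ` S"
  by (simp add: quotient_module_def)

lemma quotient_closed: "m \<in> S \<Longrightarrow> U +>\<^bsub>M\<^esub> m \<in> carrier Q"
  unfolding quotient_carrier by simp

lemma quotient_module: "Module.module R Q"
proof (rule moduleI[OF R.is_cring])
  note add = LinearCombinations.submodule.m_closed[OF S]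
  note sm = LinearCombinations.submodule.smult_closed[OF S]
  show "abelian_group Q"
  proof (rule abelian_groupI)
    fix x y assume "x \<in> carrier Q" "y \<in> carrier Q"
    then obtain a b where ab: "a \<in> S" "b \<in> S" "x = U +>\<^bsub>M\<^esub> a" "y = U +>\<^bsub>M\<^esub> b"
      unfolding quotient_carrier by auto
    then show "x \<oplus>\<^bsub>Q\<^esub> y \<in> carrier Q"
      using quotient_add quotient_closed add S_closed by simp
    show "x \<oplus>\<^bsub>Q\<^esub> y = y \<oplus>\<^bsub>Q\<^esub> x"
      using ab quotient_add S_closed M.a_comm by simp
    fix z assume "z \<in> carrier Q"
    then obtain c where "c \<in> S" "z = U +>\<^bsub>M\<^esub> c"
      unfolding quotient_carrier by auto
    then show "(x \<oplus>\<^bsub>Q\<^esub> y) \<oplus>\<^bsub>Q\<^esub> z = x \<oplus>\<^bsub>Q\<^esub> (y \<oplus>\<^bsub>Q\<^esub> z)"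
      using ab quotient_add S_closed M.a_assoc by simp
  next
    show "\<zero>\<^bsub>Q\<^esub> \<in> carrier Q"
      unfolding quotient_zero using quotient_closed LinearCombinations.submodule.zero_closed[OF S] by simp
    fix x assume "x \<in> carrier Q"
    then obtain a where a: "a \<in> S" "x = U +>\<^bsub>M\<^esub> a"
      unfolding quotient_carrier by auto
    then show "\<zero>\<^bsub>Q\<^esub> \<oplus>\<^bsub>Q\<^esub> x = x"
      unfolding quotient_zero using quotient_add S_closed by simp
    show "\<exists>y\<in>carrier Q. y \<oplus>\<^bsub>Q\<^esub> x = \<zero>\<^bsub>Q\<^esub>"
      unfolding quotient_zero
      using a quotient_add S_closed quotient_closed[OF submodule_uminus[OF S a(1)]] M.l_neg
      by (intro bexI[of _ "U +>\<^bsub>M\<^esub> (\<ominus>\<^bsub>M\<^esub> a)"]) simp_all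
  qed
  fix a x assume a: "a \<in> carrier R" and "x \<in> carrier Q"
  then obtain m where m: "m \<in> S" "x = U +>\<^bsub>M\<^esub> m" unfolding quotient_carrier by auto
  then show "a \<odot>\<^bsub>Q\<^esub> x \<in> carrier Q"
    using a quotient_smult quotient_closed sm S_closed by simp
  fix b assume b: "b \<in> carrier R"
  show "(a \<oplus> b) \<odot>\<^bsub>Q\<^esub> x = (a \<odot>\<^bsub>Q\<^esub> x) \<oplus>\<^bsub>Q\<^esub> (b \<odot>\<^bsub>Q\<^esub> x)"
    using a b m quotient_smult quotient_add S_closed smult_l_distr by simp
  show "(a \<otimes> b) \<odot>\<^bsub>Q\<^esub> x = a \<odot>\<^bsub>Q\<^esub> (b \<odot>\<^bsub>Q\<^esub> x)"
    using a b m quotient_smult S_closed smult_assoc1 by simp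
next
  fix a x y assume a: "a \<in> carrier R" and "x \<in> carrier Q" "y \<in> carrier Q"
  then obtain m n where "m \<in> S" "x = U +>\<^bsub>M\<^esub> m" "n \<in> S" "y = U +>\<^bsub>M\<^esub> n"
    unfolding quotient_carrier by auto
  then show "a \<odot>\<^bsub>Q\<^esub> (x \<oplus>\<^bsub>Q\<^esub> y) = (a \<odot>\<^bsub>Q\<^esub> x) \<oplus>\<^bsub>Q\<^esub> (a \<odot>\<^bsub>Q\<^esub> y)"
    using a quotient_smult quotient_add S_closed smult_r_distr by simp
next
  fix x assume "x \<in> carrier Q"
  then show "\<one> \<odot>\<^bsub>Q\<^esub> x = x"
    unfolding quotient_carrier using quotient_smult S_closed by auto
qed

interpretation Q: Module.module R Q by (rule quotient_module)

lemma quotient_lincomb: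
  assumes A: "finite A" "A \<subseteq> S" and inj: "inj_on (\<lambda>m. U +>\<^bsub>M\<^esub> m) A" and a: "a \<in> A \<rightarrow> carrier R"
    and b: "\<And>x. x \<in> A \<Longrightarrow> b (U +>\<^bsub>M\<^esub> x) = a x"
  shows "Q.lincomb b ((\<lambda>m. U +>\<^bsub>M\<^esub> m) ` A) = U +>\<^bsub>M\<^esub> lincomb a A"
proof -
  have term_closed: "a x \<odot>\<^bsub>M\<^esub> x \<in> S" if "x \<in> A" for x
    using that A(2) a LinearCombinations.submodule.smult_closed[OF S] by blast
  have sum: "(\<Oplus>\<^bsub>Q\<^esub>x\<in>A'. U +>\<^bsub>M\<^esub> (a x \<odot>\<^bsub>M\<^esub> x)) = U +>\<^bsub>M\<^esub> (\<Oplus>\<^bsub>M\<^esub>x\<in>A'. a x \<odot>\<^bsub>M\<^esub> x)"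
    if "finite A'" "A' \<subseteq> A" for A'
    using that
  proof (induction A' rule: finite_induct)
    case empty
    then show ?case by (simp add: quotient_zero)
  next
    case (insert x A')
    have cl: "(\<Oplus>\<^bsub>M\<^esub>x\<in>A'. a x \<odot>\<^bsub>M\<^esub> x) \<in> carrier M"
      using insert.prems term_closed S_closed by (intro finsum_closed) blast
    have "(\<Oplus>\<^bsub>Q\<^esub>x\<in>insert x A'. U +>\<^bsub>M\<^esub> (a x \<odot>\<^bsub>M\<^esub> x))
        = (U +>\<^bsub>M\<^esub> (a x \<odot>\<^bsub>M\<^esub> x)) \<oplus>\<^bsub>Q\<^esub> (\<Oplus>\<^bsub>Q\<^esub>x\<in>A'. U +>\<^bsub>M\<^esub> (a x \<odot>\<^bsub>M\<^esub> x))"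
      using insert.prems term_closed quotient_closed by (intro Q.finsum_insert[OF insert.hyps]) blast+
    also have "\<dots> = U +>\<^bsub>M\<^esub> (a x \<odot>\<^bsub>M\<^esub> x \<oplus>\<^bsub>M\<^esub> (\<Oplus>\<^bsub>M\<^esub>x\<in>A'. a x \<odot>\<^bsub>M\<^esub> x))"
      using insert cl term_closed S_closed quotient_add by simp
    also have "a x \<odot>\<^bsub>M\<^esub> x \<oplus>\<^bsub>M\<^esub> (\<Oplus>\<^bsub>M\<^esub>x\<in>A'. a x \<odot>\<^bsub>M\<^esub> x) = (\<Oplus>\<^bsub>M\<^esub>x\<in>insert x A'. a x \<odot>\<^bsub>M\<^esub> x)"
      using insert.prems term_closed S_closed by (intro finsum_insert[OF insert.hyps, symmetric]) blast+
    finally show ?case .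
  qed
  have eq: "b (U +>\<^bsub>M\<^esub> x) \<odot>\<^bsub>Q\<^esub> (U +>\<^bsub>M\<^esub> x) = U +>\<^bsub>M\<^esub> (a x \<odot>\<^bsub>M\<^esub> x)" if "x \<in> A" for x
    using that b A(2) S_closed quotient_smult[OF funcset_mem[OF a that]] by auto
  have cl: "(\<lambda>x. U +>\<^bsub>M\<^esub> (a x \<odot>\<^bsub>M\<^esub> x)) \<in> A \<rightarrow> carrier Q"
    using term_closed quotient_closed by blast
  have "Q.lincomb b ((\<lambda>m. U +>\<^bsub>M\<^esub> m) ` A) = (\<Oplus>\<^bsub>Q\<^esub>x\<in>A. b (U +>\<^bsub>M\<^esub> x) \<odot>\<^bsub>Q\<^esub> (U +>\<^bsub>M\<^esub> x))"
    unfolding Q.lincomb_def using eq cl by (intro Q.finsum_reindex[OF _ inj]) auto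
  also have "\<dots> = (\<Oplus>\<^bsub>Q\<^esub>x\<in>A. U +>\<^bsub>M\<^esub> (a x \<odot>\<^bsub>M\<^esub> x))"
    using eq cl by (intro Q.finsum_cong') auto
  finally show ?thesis
    using sum[OF A(1) subset_refl] unfolding lincomb_def by simp
qed

lemma quotient_basis_spans:
  assumes F: "F \<subseteq> S" and inj: "inj_on (\<lambda>m. U +>\<^bsub>M\<^esub> m) F"
    and free: "free_generating_set R Q ((\<lambda>m. U +>\<^bsub>M\<^esub> m) ` F)" and m: "m \<in> S"
  shows "\<exists>x\<in>span F. m \<ominus>\<^bsub>M\<^esub> x \<in> U"
proof -
  have "U +>\<^bsub>M\<^esub> m \<in> Q.span ((\<lambda>m. U +>\<^bsub>M\<^esub> m) ` F)"
    using free quotient_closed[OF m] unfolding free_generating_set_def by simp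
  then obtain b A' where A': "finite A'" "A' \<subseteq> (\<lambda>m. U +>\<^bsub>M\<^esub> m) ` F" "b \<in> A' \<rightarrow> carrier R"
    "U +>\<^bsub>M\<^esub> m = Q.lincomb b A'"
    unfolding Q.span_def by auto
  then obtain A where A: "A \<subseteq> F" "finite A" "A' = (\<lambda>m. U +>\<^bsub>M\<^esub> m) ` A"
    by (meson finite_subset_image)
  have a: "(\<lambda>x. b (U +>\<^bsub>M\<^esub> x)) \<in> A \<rightarrow> carrier R"
    using A'(3) unfolding A(3) by auto
  have "U +>\<^bsub>M\<^esub> m = U +>\<^bsub>M\<^esub> lincomb (\<lambda>x. b (U +>\<^bsub>M\<^esub> x)) A"
    unfolding A'(4) A(3) using A F inj_on_subset[OF inj] by (intro quotient_lincomb a) auto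
  moreover have "lincomb (\<lambda>x. b (U +>\<^bsub>M\<^esub> x)) A \<in> carrier M"
    using A(1) F S_closed a by (intro lincomb_closed) auto
  ultimately have "m \<ominus>\<^bsub>M\<^esub> lincomb (\<lambda>x. b (U +>\<^bsub>M\<^esub> x)) A \<in> U"
    using coset_eq_iff S_closed[OF m] by simp
  moreover have "lincomb (\<lambda>x. b (U +>\<^bsub>M\<^esub> x)) A \<in> span F"
    unfolding span_def using A a by blast
  ultimately show ?thesis by blast
qed

lemma quotient_basis_indep:
  assumes F: "F \<subseteq> S" and inj: "inj_on (\<lambda>m. U +>\<^bsub>M\<^esub> m) F"
    and free: "free_generating_set R Q ((\<lambda>m. U +>\<^bsub>M\<^esub> m) ` F)"
    and A: "finite A" "A \<subseteq> F" and a: "a \<in> A \<rightarrow> carrier R" and sum: "lincomb a A \<in> U" and f: "f \<in> A"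
  shows "a f = \<zero>"
proof -
  let ?q = "\<lambda>m. U +>\<^bsub>M\<^esub> m"
  have injA: "inj_on ?q A" using inj_on_subset[OF inj A(2)] .
  define b where "b X = a (the_inv_into A ?q X)" for X
  have b: "b (?q x) = a x" if "x \<in> A" for x
    unfolding b_def using the_inv_into_f_f[OF injA that] by simp
  have "Q.lincomb b (?q ` A) = ?q (lincomb a A)"
    using A F by (intro quotient_lincomb injA a b) auto
  also have "\<dots> = \<zero>\<^bsub>Q\<^esub>"
    unfolding quotient_zero using sum U.a_subset coset_eq_iff[of "lincomb a A" "\<zero>\<^bsub>M\<^esub>"]
    by (auto simp: a_minus_def)
  finally have "Q.lincomb b (?q ` A) = \<zero>\<^bsub>Q\<^esub>" .
  moreover have "b \<in> ?q ` A \<rightarrow> carrier R" using a b by auto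
  ultimately have "Q.lin_dep (?q ` F)" if "b (?q f) \<noteq> \<zero>"
    using that A f by (intro Q.lin_dep_crit[of "?q ` A" _ b "?q f"]) auto
  then show ?thesis using free b[OF f] unfolding free_generating_set_def by auto
qed

end

end

section \<open>Finite generation\<close>

text \<open>Induction on the number \<open>m\<close> of leading coordinates that may be nonzero; in each step, the last of
  them is split off.\<close>

lemma product_integer_group_generated:
  fixes n :: nat
  defines "G \<equiv> product_group {..<n} (\<lambda>_. integer_group)"
  assumes T: "subgroup T G" and units: "\<And>j. j < n \<Longrightarrow> (\<lambda>i\<in>{..<n}. if i = j then 1 else 0) \<in> T"
  shows "carrier G \<subseteq> T"
proof -
  interpret T: subgroup T G by (rule T)
  have G: "group G" unfolding G_def by simp
  define u where "u j z = (\<lambda>i\<in>{..<n}. if i = j then z else (0::int))" for j z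
  have one: "\<one>\<^bsub>G\<^esub> = u j 0" for j
    by (auto simp: G_def u_def fun_eq_iff)
  have mult: "x \<otimes>\<^bsub>G\<^esub> y = (\<lambda>i\<in>{..<n}. x i + y i)" for x y
    by (simp add: G_def)
  have unit: "u j 1 \<in> T" "u j (- 1) \<in> T" if "j < n" for j
  proof -
    show u1: "u j 1 \<in> T" using units[OF that] by (simp add: u_def)
    have "inv\<^bsub>G\<^esub> (u j 1) = (\<lambda>i\<in>{..<n}. - u j 1 i)"
      unfolding G_def by (subst inv_product_group) (auto simp: u_def)
    also have "\<dots> = u j (- 1)" by (auto simp: u_def fun_eq_iff)
    finally show "u j (- 1) \<in> T" using T.m_inv_closed[OF u1] by simp
  qed
  have uT: "u j z \<in> T" if j: "j < n" for j z
  proof (induction z rule: int_induct[where k = 0])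
    case base
    then show ?case using T.one_closed one[of j] by simp
  next
    case (step1 z)
    have "u j z \<otimes>\<^bsub>G\<^esub> u j 1 = u j (z + 1)" by (auto simp: mult u_def fun_eq_iff)
    then show ?case using T.m_closed[OF step1(2) unit(1)[OF j]] by simp
  next
    case (step2 z)
    have "u j z \<otimes>\<^bsub>G\<^esub> u j (- 1) = u j (z - 1)" by (auto simp: mult u_def fun_eq_iff)
    then show ?case using T.m_closed[OF step2(2) unit(2)[OF j]] by simp
  qed
  have "x \<in> T" if "x \<in> carrier G" "\<And>i. m \<le> i \<Longrightarrow> i < n \<Longrightarrow> x i = 0" "m \<le> n" for m x
    using that
  proof (induction m arbitrary: x)
    case 0
    then have "x = \<one>\<^bsub>G\<^esub>"
      by (auto simp: G_def fun_eq_iff PiE_def extensional_def)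
    then show ?case by simp
  next
    case (Suc m)
    define x' where "x' = (\<lambda>i\<in>{..<n}. if i = m then 0 else x i)"
    have "x' \<in> T"
    proof (rule Suc.IH)
      show "x' i = 0" if "m \<le> i" "i < n" for i
        using that Suc.prems(2)[of i] by (auto simp: x'_def)
    qed (use Suc.prems in \<open>auto simp: x'_def G_def\<close>)
    moreover have "x' \<otimes>\<^bsub>G\<^esub> u m (x m) = x"
      using Suc.prems by (auto simp: mult x'_def u_def G_def fun_eq_iff PiE_def extensional_def)
    ultimately show ?case using T.m_closed[OF _ uT[of m "x m"]] Suc.prems(3) by fastforce
  qed
  from this[of _ n] show ?thesis by auto
qed

text \<open>The images of the unit vectors under an isomorphism with \<open>\<int>\<^sup>n\<close> generate the group.\<close>

lemma integral_module_fin_gen: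
  assumes M: "abelian_group M" and int: "integral_module M"
  shows "\<exists>E. finite E \<and> E \<subseteq> carrier M \<and> generate (add_monoid M) E = carrier M"
proof -
  interpret M: abelian_group M by (rule M)
  obtain n :: nat where "add_monoid M \<cong> product_group {..<n} (\<lambda>_. integer_group)"
    using int unfolding integral_module_def by auto
  moreover define G where "G = product_group {..<n} (\<lambda>_. integer_group)"
  ultimately have iso: "add_monoid M \<cong> G" by simp
  have G: "group G" unfolding G_def by simp
  obtain h where h: "h \<in> iso G (add_monoid M)"
    using group.iso_sym[OF M.add.is_group iso] unfolding is_iso_def by auto
  have hom: "h \<in> hom G (add_monoid M)" and surj: "h ` carrier G = carrier M"
    using h unfolding iso_def bij_betw_def by auto
  interpret h: group_hom G "add_monoid M" h
    by (intro group_hom.intro G M.add.is_group group_hom_axioms.intro hom)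
  define u where "u j = (\<lambda>i\<in>{..<n}. if i = j then 1 else (0::int))" for j
  have u: "u j \<in> carrier G" for j by (auto simp: u_def G_def)
  define E where "E = (\<lambda>j. h (u j)) ` {..<n}"
  have E: "finite E" "E \<subseteq> carrier M" unfolding E_def using u h.hom_closed by auto
  have gen: "subgroup (generate (add_monoid M) E) (add_monoid M)"
    using E(2) by (intro M.add.generate_is_subgroup) simp
  interpret gen: subgroup "generate (add_monoid M) E" "add_monoid M" by (rule gen)
  define T where "T = {x \<in> carrier G. h x \<in> generate (add_monoid M) E}"
  have "subgroup T G"
  proof (rule group.subgroupI[OF G])
    show "T \<noteq> {}" using gen.one_closed h.hom_one unfolding T_def by force
    show "inv\<^bsub>G\<^esub> a \<in> T" if "a \<in> T" for a
      using that gen.m_inv_closed h.hom_inv group.inv_closed[OF G] unfolding T_def by simp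
    show "a \<otimes>\<^bsub>G\<^esub> b \<in> T" if "a \<in> T" "b \<in> T" for a b
      using that gen.m_closed h.hom_mult h.G.m_closed unfolding T_def by simp
  qed (simp add: T_def)
  moreover have "u j \<in> T" if "j < n" for j
    using that u unfolding T_def E_def by (auto intro: generate.incl)
  ultimately have "carrier G \<subseteq> T"
    unfolding G_def u_def by (rule product_integer_group_generated)
  then have "carrier M \<subseteq> generate (add_monoid M) E"
    unfolding surj[symmetric] T_def by auto
  then show ?thesis using E gen.subset by auto
qed

lemma int_module_module:
  assumes "abelian_group A"
  shows "Module.module \<Z> (int_module A)"
proof -
  interpret A: abelian_group A by (rule assms)
  have cr: "carrier (int_module A) = carrier A" "zero (int_module A) = zero A"
    "add (int_module A) = add A" "smult (int_module A) z a = [z] \<cdot>\<^bsub>A\<^esub> a" for z a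
    by (simp_all add: int_module_def)
  show ?thesis
  proof (rule moduleI[OF int_is_cring])
    show "abelian_group (int_module A)"
      by (rule abelian_groupI) (auto simp: cr A.a_ac intro: A.l_neg bexI[of _ "\<ominus>\<^bsub>A\<^esub> _"])
  qed (auto simp: cr A.add.int_pow_mult A.add.int_pow_distrib A.add.int_pow_pow mult.commute)
qed

lemma int_basis_generates:
  assumes A: "abelian_group A" and B: "free_generating_set \<Z> (int_module A) B"
  shows "B \<subseteq> carrier A" and "subgroup U (add_monoid A) \<Longrightarrow> B \<subseteq> U \<Longrightarrow> carrier A \<subseteq> U"
proof -
  interpret A: abelian_group A by (rule A)
  interpret I: Module.module \<Z> "int_module A" by (rule int_module_module[OF A])
  show "B \<subseteq> carrier A"
    using B unfolding free_generating_set_def by (simp add: int_module_def)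
  assume U: "subgroup U (add_monoid A)" and BU: "B \<subseteq> U"
  interpret U: subgroup U "add_monoid A" by (rule U)
  have "LinearCombinations.submodule \<Z> U (int_module A)"
  proof (intro LinearCombinations.submodule.intro I.module_axioms)
    show "c \<odot>\<^bsub>int_module A\<^esub> v \<in> U" if "v \<in> U" for c v
      using A.add.subgroup_int_pow_closed[OF U that, of c] by (simp add: int_module_def)
  qed (use U.subset U.m_closed U.one_closed in \<open>simp_all add: int_module_def\<close>)
  then have "I.span B \<subseteq> U" by (rule I.span_is_subset[OF BU])
  then show "carrier A \<subseteq> U"
    using B unfolding free_generating_set_def by (simp add: int_module_def)
qed

section \<open>Automorphism groups of modules\<close>

context Module.module
begin

lemma inv_into_End:
  assumes f: "f \<in> End" "f \<in> Bij (carrier M)"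
  shows "restrict (inv_into (carrier M) f) (carrier M) \<in> End"
proof -
  have bij: "bij_betw f (carrier M) (carrier M)" using f(2) by (simp add: Bij_def)
  define g where "g = inv_into (carrier M) f"
  have g: "g y \<in> carrier M" "f (g y) = y" if "y \<in> carrier M" for y
    using that bij unfolding g_def by (auto simp: bij_betw_def inv_into_into f_inv_into_f)
  have gf: "g (f x) = x" if "x \<in> carrier M" for x
    using that bij unfolding g_def by (auto simp: bij_betw_def)
  have "g (x \<oplus>\<^bsub>M\<^esub> y) = g x \<oplus>\<^bsub>M\<^esub> g y" if "x \<in> carrier M" "y \<in> carrier M" for x y
    using gf[of "g x \<oplus>\<^bsub>M\<^esub> g y"] End_add[OF f(1), of "g x" "g y"] g that by simp
  moreover have "g (r \<odot>\<^bsub>M\<^esub> x) = r \<odot>\<^bsub>M\<^esub> g x" if "r \<in> carrier R" "x \<in> carrier M" for r x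
    using gf[of "r \<odot>\<^bsub>M\<^esub> g x"] End_smult[OF f(1), of r "g x"] g that by simp
  ultimately show ?thesis
    using g unfolding g_def by (intro EndI) auto
qed

lemma module_Aut_subgroup: "subgroup (End \<inter> Bij (carrier M)) (BijGroup (carrier M))"
proof (rule group.subgroupI[OF group_BijGroup])
  show "End \<inter> Bij (carrier M) \<subseteq> carrier (BijGroup (carrier M))"
    by (auto simp: BijGroup_def)
  have "(\<lambda>x\<in>carrier M. x) \<in> End" by (rule EndI) auto
  then show "End \<inter> Bij (carrier M) \<noteq> {}" using id_Bij by blast
  fix f assume f: "f \<in> End \<inter> Bij (carrier M)"
  then show "inv\<^bsub>BijGroup (carrier M)\<^esub> f \<in> End \<inter> Bij (carrier M)"
    using inv_into_End[of f] by (simp add: inv_BijGroup restrict_inv_into_Bij del: restrict_apply)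
  fix g assume g: "g \<in> End \<inter> Bij (carrier M)"
  have "compose (carrier M) f g \<in> End"
    using f g by (intro EndI) (auto simp: compose_eq End_add End_smult)
  then show "f \<otimes>\<^bsub>BijGroup (carrier M)\<^esub> g \<in> End \<inter> Bij (carrier M)"
    using f g by (simp add: BijGroup_def compose_Bij)
qed

lemma module_Aut_group: "group (module_Aut R M)"
  unfolding module_Aut_def
  by (rule subgroup.subgroup_is_group[OF module_Aut_subgroup group_BijGroup])

lemma module_Aut_carrier: "carrier (module_Aut R M) = End \<inter> Bij (carrier M)"
  by (simp add: module_Aut_def)

lemma module_Aut_mult:
  "f \<in> carrier (module_Aut R M) \<Longrightarrow> g \<in> carrier (module_Aut R M) \<Longrightarrow>
    f \<otimes>\<^bsub>module_Aut R M\<^esub> g = compose (carrier M) f g"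
  by (simp add: module_Aut_def BijGroup_def)

end

lemma module_Aut_one: "\<one>\<^bsub>module_Aut R M\<^esub> = (\<lambda>x\<in>carrier M. x)"
  by (simp add: module_Aut_def BijGroup_def)

section \<open>The kernel of the action on the quotients\<close>

lemma restrict_eq_iff: "restrict f A = restrict g A \<longleftrightarrow> (\<forall>x\<in>A. f x = g x)"
  by (metis restrict_apply' restrict_ext)

locale standard_truncated_module = truncated_module R l M
  for R :: "('k, 'x) ring_scheme" and l :: nat
    and M :: "((nat \<Rightarrow> 'k) set, 'm, 'z) module_scheme" +
  fixes F :: "nat \<Rightarrow> 'm set"
  assumes R_nontrivial: "\<one>\<^bsub>R\<^esub> \<noteq> \<zero>\<^bsub>R\<^esub>"
    and M_integral: "integral_module M"
    and F_standard: "standard_generating_sequence R l M F"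
begin

lemma coset_N: "U +>\<^bsub>N\<^esub> m = U +>\<^bsub>M\<^esub> m"
  by (simp add: a_r_coset_def r_coset_def)

lemma standard_sequence: "standard_sequence R N Y l F"
proof (intro standard_sequence.intro standard_sequence_axioms.intro nilpotent_module)
  have F: "F j \<subseteq> Nil.Ker j"
    and inj: "inj_on (\<lambda>m. Nil.Lay j +>\<^bsub>N\<^esub> m) (F j)"
    and free: "free_generating_set R (quotient_module N (Nil.Ker j) (Nil.Lay j))
      ((\<lambda>m. Nil.Lay j +>\<^bsub>N\<^esub> m) ` F j)" if "j \<in> {1..l}" for j
    using F_standard that
    unfolding standard_generating_sequence_def Q_mod_def K_sub_eq L_sub_eq coset_N by auto
  have sub: "Nil.Lay j \<subseteq> Nil.Ker j" for j using Nil.Lay_sub_Ker by auto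
  show "F j \<subseteq> Nil.Ker j" if "j \<in> {1..l}" for j by (rule F[OF that])
  show "\<exists>x\<in>Nil.span (F j). m \<ominus>\<^bsub>N\<^esub> x \<in> Nil.Lay j" if "j \<in> {1..l}" "m \<in> Nil.Ker j" for j m
    by (rule Nil.quotient_basis_spans[OF Nil.Ker_submodule Nil.Lay_submodule sub
          F[OF that(1)] inj[OF that(1)] free[OF that(1)] that(2)])
  show "a f = \<zero>\<^bsub>R\<^esub>" if "j \<in> {1..l}" "finite A" "A \<subseteq> F j" "a \<in> A \<rightarrow> carrier R"
    "Nil.lincomb a A \<in> Nil.Lay j" "f \<in> A" for j A a f
    by (rule Nil.quotient_basis_indep[OF Nil.Ker_submodule Nil.Lay_submodule sub
          F[OF that(1)] inj[OF that(1)] free[OF that(1)] that(2-6)])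
  show "\<one>\<^bsub>R\<^esub> \<noteq> \<zero>\<^bsub>R\<^esub>" by (rule R_nontrivial)
  have "integral_module N"
    using M_integral unfolding integral_module_def is_iso_def iso_def hom_def by simp
  then show "\<exists>E. finite E \<and> E \<subseteq> carrier N \<and> generate (add_monoid N) E = carrier N"
    by (rule integral_module_fin_gen[OF Nil.M.abelian_group_axioms])
qed

sublocale S: standard_sequence R N Y l F by (rule standard_sequence)

lemma EndY_eq: "T \<in> S.EndY \<longleftrightarrow> T \<in> M.End"
  unfolding S.EndY_def hom_iff_commutes by simp

text \<open>Equality, and not only inclusion, matters: \<open>rho\<close> is defined by images of cosets, and
  \<open>\<phi> ` (L\<^sub>i(M) + m)\<close> is the coset \<open>L\<^sub>i(M) + \<phi> m\<close> only because \<open>\<phi> ` L\<^sub>i(M) = L\<^sub>i(M)\<close>.\<close>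

lemma Aut_Ker_image:
  assumes \<phi>: "\<phi> \<in> M.End" "\<phi> \<in> Bij (carrier M)"
  shows "\<phi> ` Nil.Ker i = Nil.Ker i"
proof
  have E: "\<phi> \<in> S.EndY" using \<phi>(1) EndY_eq by simp
  have bij: "bij_betw \<phi> (carrier M) (carrier M)" using \<phi>(2) by (simp add: Bij_def)
  show "\<phi> ` Nil.Ker i \<subseteq> Nil.Ker i" using S.EndY_Ker[OF E] by auto
  show "Nil.Ker i \<subseteq> \<phi> ` Nil.Ker i"
  proof
    fix x assume x: "x \<in> Nil.Ker i"
    then have "x \<in> \<phi> ` carrier M" using bij Nil.Ker_closed[OF x] by (simp add: bij_betw_def)
    then obtain z where z: "z \<in> carrier M" "x = \<phi> z" by auto
    have "\<phi> ((Y ^^ i) z) = \<phi> \<zero>\<^bsub>M\<^esub>"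
      using S.EndY_Y_pow[OF E, of z i] x z \<phi>(1) unfolding Nil.Ker_def by simp
    then have "(Y ^^ i) z = \<zero>\<^bsub>M\<^esub>"
      using inj_onD[OF bij_betw_imp_inj_on[OF bij]] Nil.Y_pow_closed[of z i] z(1) by simp
    then show "x \<in> \<phi> ` Nil.Ker i" using z unfolding Nil.Ker_def by auto
  qed
qed

lemma Aut_Lay_image:
  assumes \<phi>: "\<phi> \<in> M.End" "\<phi> \<in> Bij (carrier M)"
  shows "\<phi> ` Nil.Lay i = Nil.Lay i"
proof -
  have E: "\<phi> \<in> S.EndY" using \<phi>(1) EndY_eq by simp
  have eq: "\<phi> (Y a \<oplus>\<^bsub>N\<^esub> b) = Y (\<phi> a) \<oplus>\<^bsub>N\<^esub> \<phi> b" if "a \<in> Nil.Ker (i + 1)" "b \<in> Nil.Ker (i - 1)" for a b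
    using S.EndY_hom_add[OF E] S.EndY_Y_pow[OF E, of a 1] that[THEN Nil.Ker_closed] Nil.Y_closed by simp
  have "\<phi> ` Nil.Lay i = {Y (\<phi> a) \<oplus>\<^bsub>N\<^esub> \<phi> b | a b. a \<in> Nil.Ker (i + 1) \<and> b \<in> Nil.Ker (i - 1)}"
    unfolding Nil.Lay_def using eq by (auto simp: image_iff) metis+
  also have "\<dots> = {Y a \<oplus>\<^bsub>N\<^esub> b | a b. a \<in> \<phi> ` Nil.Ker (i + 1) \<and> b \<in> \<phi> ` Nil.Ker (i - 1)}"
    by blast
  finally show ?thesis unfolding Aut_Ker_image[OF \<phi>] Nil.Lay_def .
qed

lemma ker_rho_iff:
  "\<phi> \<in> ker_rho R l M \<longleftrightarrow> \<phi> \<in> M.End \<inter> Bij (carrier M)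
    \<and> (\<forall>i\<in>{1..l}. \<forall>m\<in>Nil.Ker i. \<phi> m \<ominus>\<^bsub>N\<^esub> m \<in> Nil.Lay i)"
proof -
  have "(\<lambda>X\<in>carrier (Q_mod R l M i). \<phi> ` X) = \<one>\<^bsub>module_Aut R (Q_mod R l M i)\<^esub>
      \<longleftrightarrow> (\<forall>m\<in>Nil.Ker i. \<phi> m \<ominus>\<^bsub>N\<^esub> m \<in> Nil.Lay i)"
    if \<phi>: "\<phi> \<in> M.End" "\<phi> \<in> Bij (carrier M)" for i
  proof -
    have sub: "Nil.Lay i \<subseteq> Nil.Ker i" using Nil.Lay_sub_Ker by auto
    have E: "\<phi> \<in> S.EndY" using \<phi>(1) EndY_eq by simp
    have img: "\<phi> ` (Nil.Lay i +>\<^bsub>N\<^esub> m) = Nil.Lay i +>\<^bsub>N\<^esub> \<phi> m" if m: "m \<in> Nil.Ker i" for m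
    proof -
      have "\<phi> ` (Nil.Lay i +>\<^bsub>N\<^esub> m) = (\<lambda>x. \<phi> (x \<oplus>\<^bsub>N\<^esub> m)) ` Nil.Lay i"
        unfolding a_r_coset_def' by auto
      also have "\<dots> = (\<lambda>x. \<phi> x \<oplus>\<^bsub>N\<^esub> \<phi> m) ` Nil.Lay i"
        using S.EndY_hom_add[OF E] Nil.Ker_closed m sub by (intro image_cong) auto
      also have "\<dots> = (\<lambda>x. x \<oplus>\<^bsub>N\<^esub> \<phi> m) ` (\<phi> ` Nil.Lay i)"
        by auto
      also have "\<dots> = Nil.Lay i +>\<^bsub>N\<^esub> \<phi> m"
        unfolding Aut_Lay_image[OF \<phi>] a_r_coset_def' by auto
      finally show ?thesis .
    qed
    have C: "carrier (Q_mod R l M i) = (\<lambda>m. Nil.Lay i +>\<^bsub>N\<^esub> m) ` Nil.Ker i"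
      unfolding Q_mod_def quotient_module_def K_sub_eq L_sub_eq by simp
    have "(\<lambda>X\<in>carrier (Q_mod R l M i). \<phi> ` X) = \<one>\<^bsub>module_Aut R (Q_mod R l M i)\<^esub>
        \<longleftrightarrow> (\<forall>X\<in>carrier (Q_mod R l M i). \<phi> ` X = X)"
      unfolding module_Aut_one by (rule restrict_eq_iff)
    also have "\<dots> \<longleftrightarrow> (\<forall>m\<in>Nil.Ker i. Nil.Lay i +>\<^bsub>N\<^esub> \<phi> m = Nil.Lay i +>\<^bsub>N\<^esub> m)"
      unfolding C ball_simps using img by (intro ball_cong) simp_all
    also have "\<dots> \<longleftrightarrow> (\<forall>m\<in>Nil.Ker i. \<phi> m \<ominus>\<^bsub>N\<^esub> m \<in> Nil.Lay i)"
      using Nil.coset_eq_iff[OF Nil.Ker_submodule Nil.Lay_submodule sub]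
        S.EndY_closed[OF E] Nil.Ker_closed by (intro ball_cong) auto
    finally show ?thesis .
  qed
  then have "rho R l M \<phi> = \<one>\<^bsub>product_group {1..l} (\<lambda>i. module_Aut R (Q_mod R l M i))\<^esub>
      \<longleftrightarrow> (\<forall>i\<in>{1..l}. \<forall>m\<in>Nil.Ker i. \<phi> m \<ominus>\<^bsub>N\<^esub> m \<in> Nil.Lay i)"
    if "\<phi> \<in> M.End" "\<phi> \<in> Bij (carrier M)"
    using that unfolding rho_def one_product_group restrict_eq_iff by simp
  then show ?thesis
    unfolding ker_rho_def kernel_def M.module_Aut_carrier by auto
qed

lemma uni_Aut:
  assumes T: "T \<in> S.Shift 1"
  shows "S.uni T \<in> M.End \<inter> Bij (carrier M)"
proof
  have E: "T \<in> S.EndY" by (rule S.Shift_EndY[OF T])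
  have "(\<lambda>m. m) \<in> S.EndY" unfolding EndY_eq by (rule M.EndI) auto
  from S.EndY_add[OF this E] have "(\<lambda>m. m \<oplus>\<^bsub>N\<^esub> T m) \<in> M.End"
    unfolding EndY_eq .
  then show "S.uni T \<in> M.End"
    unfolding LinearCombinations.module_hom_def S.uni_def by auto
  obtain T' where T': "T' \<in> S.Shift 1" "compose (carrier N) (S.uni T) (S.uni T') = S.idM"
    "compose (carrier N) (S.uni T') (S.uni T) = S.idM"
    using S.uni_inverse[OF _ T] by auto
  have inv: "S.uni T (S.uni T' a) = a" "S.uni T' (S.uni T a) = a" if "a \<in> carrier M" for a
    using fun_cong[OF T'(2), of a] fun_cong[OF T'(3), of a] that
    by (simp_all add: S.idM_def compose_eq del: S.uni_apply)
  have "bij_betw (S.uni T) (carrier M) (carrier M)"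
  proof (rule bij_betw_byWitness[where f' = "S.uni T'"])
    show "\<forall>a\<in>carrier M. S.uni T' (S.uni T a) = a" "\<forall>a\<in>carrier M. S.uni T (S.uni T' a) = a"
      using inv by blast+
    show "S.uni T ` carrier M \<subseteq> carrier M" "S.uni T' ` carrier M \<subseteq> carrier M"
      using S.uni_funcset[OF E] S.uni_funcset[OF S.Shift_EndY[OF T'(1)]]
      by (simp_all only: N_simps image_subset_iff_funcset)
  qed
  then show "S.uni T \<in> Bij (carrier M)"
    using S.uni_extensional[of T] by (simp add: Bij_def)
qed

lemma ker_rho_eq: "ker_rho R l M = S.uni ` S.Shift 1"
proof (intro equalityI subsetI)
  fix \<phi> assume "\<phi> \<in> S.uni ` S.Shift 1"
  then obtain T where T: "T \<in> S.Shift 1" "\<phi> = S.uni T" by auto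
  have "S.uni T m \<ominus>\<^bsub>N\<^esub> m \<in> Nil.Lay i" if i: "i \<in> {1..l}" and m: "m \<in> Nil.Ker i" for i m
  proof -
    have mc: "m \<in> carrier N" "T m \<in> carrier N"
      using Nil.Ker_closed[OF m] S.EndY_closed[OF S.Shift_EndY[OF T(1)]] by auto
    then have "S.uni T m \<ominus>\<^bsub>N\<^esub> m = T m"
      unfolding S.uni_apply[OF mc(1)] a_minus_def by (simp only: Nil.M.a_assoc Nil.add_minus_cancel Nil.M.a_inv_closed)
    then show ?thesis using S.Shift_Lay[OF T(1) i m] by simp
  qed
  then show "\<phi> \<in> ker_rho R l M"
    using uni_Aut[OF T(1)] unfolding ker_rho_iff T(2) by blast
next
  fix \<phi> assume \<phi>: "\<phi> \<in> ker_rho R l M"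
  then have \<phi>': "\<phi> \<in> M.End" "\<phi> \<in> extensional (carrier M)"
    and L: "\<And>i m. i \<in> {1..l} \<Longrightarrow> m \<in> Nil.Ker i \<Longrightarrow> \<phi> m \<ominus>\<^bsub>N\<^esub> m \<in> Nil.Lay i"
    unfolding ker_rho_iff Bij_def by auto
  have E: "\<phi> \<in> S.EndY" using \<phi>'(1) EndY_eq by simp
  have id: "(\<lambda>m. m) \<in> S.EndY" unfolding EndY_eq by (rule M.EndI) auto
  define T where "T m = \<phi> m \<oplus>\<^bsub>N\<^esub> \<ominus>\<^bsub>N\<^esub> m" for m
  have TE: "T \<in> S.EndY"
    unfolding T_def by (rule S.EndY_add[OF E S.EndY_uminus[OF id]])
  have "T f \<in> Nil.Lay j" if "j \<in> {1..l}" "f \<in> F j" for j f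
    using L[OF that(1), of f] S.F_sub[OF that(1)] that(2) unfolding T_def a_minus_def by blast
  then have "T \<in> S.Shift 1" by (intro S.Lay_Shift TE)
  moreover have "\<phi> = S.uni T"
  proof (rule extensionalityI[OF \<phi>'(2)])
    show "S.uni T \<in> extensional (carrier M)" using S.uni_extensional[of T] by simp
    fix m assume m: "m \<in> carrier M"
    then have mN: "m \<in> carrier N" "\<phi> m \<in> carrier N" using S.EndY_closed[OF E] by auto
    show "\<phi> m = S.uni T m"
      unfolding S.uni_apply[OF mN(1)] T_def using Nil.add_minus_cancel(1)[OF mN] by simp
  qed
  ultimately show "\<phi> \<in> S.uni ` S.Shift 1" by blast
qed

text \<open>The definite description in \<open>xi\<close> is legitimate because every element of \<open>ker \<rho>\<close> is \<open>1 + T'\<close>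
  with \<open>T'\<close> in \<open>EndY\<close>, and \<open>T'\<close> is determined by its values on the generators.\<close>

lemma xi_eq_uni:
  assumes i: "i \<in> {1..l}" and f: "f \<in> F i" and T: "T \<in> S.Shift 1"
    and other: "\<And>k h. k \<in> {1..l} \<Longrightarrow> h \<in> F k \<Longrightarrow> h \<noteq> f \<Longrightarrow> T h = \<zero>\<^bsub>M\<^esub>"
  shows "xi R l M F f (T f) = S.uni T"
  unfolding xi_def
proof (rule the_equality)
  have fc: "f \<in> carrier N" by (rule S.F_closed[OF i f])
  show "S.uni T \<in> ker_rho R l M \<and> S.uni T f = f \<oplus>\<^bsub>M\<^esub> T f
      \<and> (\<forall>h\<in>\<Union> (F ` {1..l}). h \<noteq> f \<longrightarrow> S.uni T h = h)"
  proof (intro conjI ballI impI)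
    show "S.uni T \<in> ker_rho R l M" using T ker_rho_eq by simp
    show "S.uni T f = f \<oplus>\<^bsub>M\<^esub> T f" using S.uni_apply[OF fc] by simp
    fix h assume "h \<in> \<Union> (F ` {1..l})" "h \<noteq> f"
    then obtain k where k: "k \<in> {1..l}" "h \<in> F k" by auto
    have hc: "h \<in> carrier N" by (rule S.F_closed[OF k])
    show "S.uni T h = h" using S.uni_apply[OF hc] other[OF k \<open>h \<noteq> f\<close>] hc by simp
  qed
  fix \<phi> assume \<phi>: "\<phi> \<in> ker_rho R l M \<and> \<phi> f = f \<oplus>\<^bsub>M\<^esub> T f \<and> (\<forall>h\<in>\<Union> (F ` {1..l}). h \<noteq> f \<longrightarrow> \<phi> h = h)"
  then obtain T' where T': "T' \<in> S.Shift 1" "\<phi> = S.uni T'" unfolding ker_rho_eq by auto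
  note E = S.Shift_EndY[OF T] S.Shift_EndY[OF T'(1)]
  have eq: "T' h = T h" if k: "k \<in> {1..l}" "h \<in> F k" for k h
  proof -
    have hc: "h \<in> carrier N" by (rule S.F_closed[OF k])
    have "h \<oplus>\<^bsub>N\<^esub> T' h = h \<oplus>\<^bsub>N\<^esub> T h"
    proof (cases "h = f")
      case True
      then show ?thesis using \<phi> S.uni_apply[OF fc, of T'] T'(2) by simp
    next
      case False
      then have "\<phi> h = h" using \<phi> k by auto
      then show ?thesis using S.uni_apply[OF hc, of T'] T'(2) other[OF k False] hc by simp
    qed
    moreover note c = S.EndY_closed[OF E(1) hc] S.EndY_closed[OF E(2) hc]
    ultimately have "T' h \<oplus>\<^bsub>N\<^esub> h = T h \<oplus>\<^bsub>N\<^esub> h"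
      using Nil.M.a_comm[OF hc c(1)] Nil.M.a_comm[OF hc c(2)] by argo
    then show ?thesis
      by (simp only: Nil.M.add.right_cancel[OF hc c(2,1)])
  qed
  have "T' m = T m" if "m \<in> carrier N" for m
    using eq that by (rule S.EndY_eqI[OF E(2,1)])
  then show "\<phi> = S.uni T" unfolding T'(2) by (rule S.uni_cong)
qed

text \<open>The bound on the weight excludes exactly the generators in \<open>F i\<close> themselves: these are the
  elements of level \<open>i\<close> and weight \<open>-i\<close>, and every other element of level at most \<open>i\<close> has weight at
  least \<open>1 - i\<close>.\<close>

lemma L_gen_iff:
  assumes "i \<in> {1..l}"
  shows "L_gen R l M F i = S.elt ` {p \<in> S.idx. S.lev p \<le> i \<and> 1 - int i \<le> S.wt p}" (is "_ = S.elt ` ?C")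
proof (intro equalityI subsetI)
  fix g assume "g \<in> L_gen R l M F i"
  then obtain j k f where g: "g = act_y R l M (k - j) f" "f \<in> F k" "k \<le> l" "1 \<le> j"
    and jk: "(j < i \<and> j \<le> k) \<or> (j = i \<and> j + 1 \<le> k)"
    using assms unfolding L_gen_def S_gen_def T_gen_def by fastforce
  have k: "k \<in> {1..l}" using g jk by auto
  then have "(k, f, k - j) \<in> ?C"
    using g jk by (auto simp: S.idx_iff S.lev_simp S.wt_simp)
  moreover have "g = S.elt (k, f, k - j)"
    unfolding g(1) S.elt_simp using Y_pow[of f "k - j"] S.F_closed[OF k g(2)] by simp
  ultimately show "g \<in> S.elt ` ?C" by blast
next
  fix g assume "g \<in> S.elt ` ?C"
  then obtain k f t where p: "(k, f, t) \<in> S.idx" "S.lev (k, f, t) \<le> i" "1 - int i \<le> S.wt (k, f, t)"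
    and g: "g = S.elt (k, f, t)" by auto
  have kft: "k \<in> {1..l}" "f \<in> F k" "t < k" "k - t \<le> i" "1 - int i \<le> 2 * int t - int k"
    using p by (auto simp: S.idx_iff S.lev_simp S.wt_simp)
  have g': "g = act_y R l M (k - (k - t)) f"
    unfolding g S.elt_simp using Y_pow[of f t] S.F_closed[OF kft(1,2)] kft(3) by simp
  show "g \<in> L_gen R l M F i"
  proof (cases "k - t < i")
    case True
    have "g \<in> S_gen R l M F (k - t)"
      unfolding S_gen_def using kft(1,2) g' by (intro UN_I[of k]) auto
    then show ?thesis using True kft(3) unfolding L_gen_def by auto
  next
    case False
    then have "k - t = i" using kft(4) by simp
    with kft(1-3,5) g' have "g \<in> T_gen R l M F i"
      unfolding T_gen_def by (intro UN_I[of k]) auto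
    then show ?thesis unfolding L_gen_def by auto
  qed
qed

text \<open>That the maps \<open>\<xi>\<^bsub>f,g\<^esub>\<close> lie in \<open>ker \<rho>\<close> needs \<open>\<L>\<^sub>i B \<subseteq> L\<^sub>i(M)\<close>.  The converse inclusion is
  \<open>Shift_generated\<close> for the group that they generate.\<close>

theorem generators_of_ker_rho:
  assumes B: "free_generating_set \<Z> (int_module R) B"
  defines "X \<equiv> (\<Union>i\<in>{1..l}. {xi R l M F f g | f g. f \<in> F i \<and> g \<in> L_gen_times R l M F i B})"
  shows "generate (module_Aut PR M) X = ker_rho R l M"
proof -
  let ?A = "module_Aut PR M"
  interpret A: group ?A by (rule M.module_Aut_group)
  note Bgen = int_basis_generates[OF ring.axioms(1)[OF cring.axioms(1)[OF R_cring]] B]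
  have uni_carrier: "S.uni T \<in> carrier ?A" if "T \<in> S.Shift 1" for T
    using uni_Aut[OF that] by (simp add: M.module_Aut_carrier)
  have ker_carrier: "ker_rho R l M \<subseteq> carrier ?A"
    unfolding ker_rho_eq using uni_carrier by auto
  have inv_uni: "inv\<^bsub>?A\<^esub> (S.uni T) = S.uni T'"
    if "T \<in> S.Shift 1" "T' \<in> S.Shift 1" "compose (carrier N) (S.uni T') (S.uni T) = S.idM" for T T'
    using that uni_carrier M.module_Aut_mult
    by (intro A.inv_equality) (simp_all add: module_Aut_one S.idM_def)
  have subgroup: "subgroup (ker_rho R l M) ?A"
  proof (rule A.subgroupI[OF ker_carrier])
    show "ker_rho R l M \<noteq> {}" unfolding ker_rho_eq using S.Shift_zero by blast
    fix a assume "a \<in> ker_rho R l M"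
    then obtain T where T: "T \<in> S.Shift 1" "a = S.uni T" unfolding ker_rho_eq by auto
    then show "inv\<^bsub>?A\<^esub> a \<in> ker_rho R l M"
      using S.uni_inverse[OF _ T(1)] inv_uni[OF T(1)] unfolding ker_rho_eq by auto
    fix b assume "b \<in> ker_rho R l M"
    then obtain T' where T': "T' \<in> S.Shift 1" "b = S.uni T'" unfolding ker_rho_eq by auto
    have "a \<otimes>\<^bsub>?A\<^esub> b = compose (carrier N) (S.uni T) (S.uni T')"
      unfolding T(2) T'(2) using M.module_Aut_mult[OF uni_carrier[OF T(1)] uni_carrier[OF T'(1)]] by simp
    also have "\<dots> = S.uni (S.circ T T')"
      by (rule S.compose_uni[OF S.Shift_EndY[OF T(1)] S.Shift_EndY[OF T'(1)]])
    finally show "a \<otimes>\<^bsub>?A\<^esub> b \<in> ker_rho R l M"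
      unfolding ker_rho_eq using S.Shift_circ[OF T(1) T'(1)] by simp
  qed
  have X_ker: "X \<subseteq> ker_rho R l M"
  proof
    fix \<phi> assume "\<phi> \<in> X"
    then obtain i f g b where i: "i \<in> {1..l}" "f \<in> F i" and g: "g \<in> L_gen R l M F i" "b \<in> B"
      and \<phi>: "\<phi> = xi R l M F f (act_const R l M g b)"
      unfolding X_def L_gen_times_def by auto
    have "g \<in> Nil.Lay i"
      using g(1) S.elt_Lay unfolding L_gen_iff[OF i(1)] by auto
    then have gb: "b \<odot>\<^bsub>N\<^esub> g \<in> Nil.Lay i"
      using Bgen(1) g(2) LinearCombinations.submodule.smult_closed[OF Nil.Lay_submodule] by blast
    obtain T where T: "T \<in> S.EndY" "T f = b \<odot>\<^bsub>N\<^esub> g"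
      and T0: "\<And>k h. k \<in> {1..l} \<Longrightarrow> h \<in> F k \<Longrightarrow> h \<noteq> f \<Longrightarrow> T h = \<zero>\<^bsub>N\<^esub>"
      using S.EndY_single[OF i Nil.Lay_sub_Ker[OF gb]] by metis
    have "T h \<in> Nil.Lay k" if k: "k \<in> {1..l}" "h \<in> F k" for k h
    proof (cases "h = f")
      case True
      then have "k = i" using S.F_disjoint[OF k(1) i(1)] k(2) i(2) by simp
      then show ?thesis using True T(2) gb by simp
    next
      case False
      then show ?thesis
        using T0[OF k] LinearCombinations.submodule.zero_closed[OF Nil.Lay_submodule] by simp
    qed
    then have S: "T \<in> S.Shift 1" by (intro S.Lay_Shift T(1))
    have "T f = act_const R l M g b" using T(2) by (simp add: act_const_def)
    then have "\<phi> = S.uni T"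
      using xi_eq_uni[OF i S] T0 unfolding \<phi> by simp
    then show "\<phi> \<in> ker_rho R l M" using S ker_rho_eq by simp
  qed
  have gen_sub: "generate ?A X \<subseteq> ker_rho R l M"
    by (rule A.generate_subgroup_incl[OF X_ker subgroup])
  interpret G: subgroup "generate ?A X" ?A
    using X_ker ker_carrier by (intro A.generate_is_subgroup) auto
  interpret unipotent_generators R N Y l F B "generate ?A X"
  proof unfold_locales
    show "B \<subseteq> carrier R" by (rule Bgen(1))
    show "carrier R \<subseteq> U" if "subgroup U (add_monoid R)" "B \<subseteq> U" for U
      by (rule Bgen(2)[OF that])
    show "S.idM \<in> generate ?A X"
      using G.one_closed by (simp add: module_Aut_one S.idM_def)
    show "compose (carrier N) g h \<in> generate ?A X" if "g \<in> generate ?A X" "h \<in> generate ?A X" for g h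
      using G.m_closed[OF that] M.module_Aut_mult that G.subset by auto
    show "S.uni T' \<in> generate ?A X"
      if "T \<in> S.Shift 1" "T' \<in> S.Shift 1" "S.uni T \<in> generate ?A X"
        "compose (carrier N) (S.uni T) (S.uni T') = S.idM" "compose (carrier N) (S.uni T') (S.uni T) = S.idM"
      for T T'
      using G.m_inv_closed[OF that(3)] inv_uni[OF that(1,2,5)] by simp
    fix k f p b T
    assume k: "k \<in> {1..l}" "f \<in> F k" and p: "p \<in> S.idx" "S.lev p \<le> k" "1 - int k \<le> S.wt p"
      and b: "b \<in> B" and T: "T \<in> S.EndY" "T f = b \<odot>\<^bsub>N\<^esub> S.elt p"
      and T0: "\<And>k' f'. k' \<in> {1..l} \<Longrightarrow> f' \<in> F k' \<Longrightarrow> f' \<noteq> f \<Longrightarrow> T f' = \<zero>\<^bsub>N\<^esub>"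
    have "S.elt p \<in> L_gen R l M F k"
      using p unfolding L_gen_iff[OF k(1)] by blast
    then have g: "T f \<in> L_gen_times R l M F k B"
      using b T(2) unfolding L_gen_times_def by (auto simp: act_const_def)
    have "T h \<in> Nil.Lay k'" if k': "k' \<in> {1..l}" "h \<in> F k'" for k' h
    proof (cases "h = f")
      case True
      then have "k' = k" using S.F_disjoint[OF k'(1) k(1)] k'(2) k(2) by simp
      moreover have "b \<odot>\<^bsub>N\<^esub> S.elt p \<in> Nil.Lay k"
        using S.elt_Lay[OF p] Bgen(1) b LinearCombinations.submodule.smult_closed[OF Nil.Lay_submodule] by blast
      ultimately show ?thesis using True T(2) by simp
    next
      case False
      then show ?thesis
        using T0[OF k'] LinearCombinations.submodule.zero_closed[OF Nil.Lay_submodule] by simp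
    qed
    then have "T \<in> S.Shift 1" by (intro S.Lay_Shift T(1))
    then have "S.uni T = xi R l M F f (T f)"
      using xi_eq_uni[OF k] T0 by simp
    then have "S.uni T \<in> X" using k g unfolding X_def by blast
    then show "S.uni T \<in> generate ?A X" by (rule generate.incl)
  qed
  have "ker_rho R l M \<subseteq> generate ?A X"
    unfolding ker_rho_eq using Shift_generated[of 1] by auto
  with gen_sub show ?thesis by blast
qed

end

theorem theorem3p11:
  fixes K :: "('k, 'x) ring_scheme"
    and OK :: "'k set"
    and R :: "('k, 'x) ring_scheme"
    and l :: nat
    and M :: "((nat \<Rightarrow> 'k) set, 'm, 'z) module_scheme"
    and F :: "nat \<Rightarrow> 'm set"
    and B :: "'k set"
  assumes "number_field K"
    and "maximal_order K OK"
    and "R = K\<lparr>carrier := OK\<rparr>"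
    and "l > 0"
    and "standard_module R l M"
    and "standard_generating_sequence R l M F"
    and "free_generating_set \<Z> (int_module R) B"
  shows "generate (module_Aut (trunc_poly R l) M)
           (\<Union>i\<in>{1..l}. {xi R l M F f g | f g. f \<in> F i \<and> g \<in> L_gen_times R l M F i B})
         = ker_rho R l M"
proof -
  interpret K: field K using assms(1) unfolding number_field_def by simp
  have OK: "subring OK K" using assms(2) unfolding maximal_order_def is_order_def by simp
  have "domain R" unfolding assms(3) by (rule K.subring_is_domain[OF OK])
  then interpret R: domain R .
  interpret standard_truncated_module R l M F
  proof (intro standard_truncated_module.intro truncated_module.intro standard_truncated_module_axioms.intro)
    show "cring R" by (rule R.is_cring)
    show "\<one>\<^bsub>R\<^esub> \<noteq> \<zero>\<^bsub>R\<^esub>" by (rule R.one_not_zero)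
    show "Module.module (trunc_poly R l) M" "integral_module M"
      using assms(5) unfolding standard_module_def by blast+
    show "standard_generating_sequence R l M F" by (rule assms(6))
  qed
  show ?thesis by (rule generators_of_ker_rho[OF assms(7)])
qed

end
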